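(* Let $d\ge3$ and $\gamma\in[1,2)$ with $\gamma<2(d-1)/d$. There exists $\epsilon>0$ such that every liquid Lane–Emden star with central density $\rho_0$ satisfying $1<\rho_0<1+\epsilon$ (small relative central density $\rho_0-1$) is linearly stable against radial perturbations; indeed $Q[\chi]\ge 0$ for all $\chi\in H^1_r$.
   Context: Fix an integer $d\ge 3$ and $\gamma\in[1,2]$. For $\rho_0>0$, the (radial, gaseous) Lane–Emden profile with central density $\rho_0$ is the unique continuous function $\rho:[0,R_g)\to(0,\infty)$, defined on its maximal interval of existence $[0,R_g)$, $R_g\in(0,\infty]$, with $\rho(0)=\rho_0$ and, writing $m(r)=4\pi\int_0^r y^{d-1}\rho(y)\,dy$, $\frac{d}{dr}\big(\rho(r)^\gamma\big)=-\rho(r)\,m(r)/r^{d-1}$ for $0<r<R_g$ (equivalently: for $\gamma>1$, $w=\rho^{\gamma-1}$ satisfies $w'(r)=-4\pi\frac{\gamma-1}{\gamma}r^{1-d}\int_0^r y^{d-1}w(y)^{\alpha}dy$ with $\alpha=1/(\gamma-1)$; for $\gamma=1$, $h=\ln\rho$ satisfies $h'(r)=-4\pi r^{1-d}\int_0^r y^{d-1}e^{h(y)}dy$). This profile is strictly decreasing and tends to $0$ at the end of its interval of existence. If $\rho_0>1$, let $R$ be the unique radius with $\rho(R)=1$; the liquid Lane–Emden star with central density $\rho_0$ is $\bar\rho=\rho|_{[0,R]}$, with radius $R$ and relative central density $\rho_0-1$. For such a star, let $H^1_r$ be the space of functions $\chi:[0,R]\to\mathbb R$ whose radial extension $x\mapsto\chi(|x|)$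 lies in $H^1(B_R)$, where $B_R\subset\mathbb R^{d+2}$ is the open ball of radius $R$. Define $L\chi=-\gamma\,(\bar\rho^\gamma y^{d+1}\chi')'+(2(d-1)-d\gamma)\,y^d(\bar\rho^\gamma)'\chi$ and the quadratic form $Q[\chi]=\int_0^R\big[\gamma\bar\rho^\gamma y^{d+1}(\chi')^2+(2(d-1)-d\gamma)y^d\chi^2(\bar\rho^\gamma)'\big]dy+d\gamma R^d\chi(R)^2$ (which equals $\int_0^R (L\chi)\chi\,dy$ for smooth $\chi$ with $d\chi(R)+R\chi'(R)=0$). A growing mode is a pair $(\lambda,\chi)$ with $\lambda>0$, $0\neq\chi\in H^1_r\cap C^2((0,R])$, $L\chi=-\lambda^2y^{d+1}\bar\rho\chi$ on $(0,R]$ and $d\chi(R)+R\chi'(R)=0$; these correspond to solutions $\zeta=e^{\lambda t}\chi(y)$ of the radial Euler–Poisson system (pressure $p=\rho^\gamma-1$) linearised in Lagrangian coordinates about $\bar\rho$, with particle paths $\eta(y,t)=y(1+\zeta(y,t))$. The star is linearly unstable (against radial perturbations) if a growing mode exists, and linearly stable otherwise. *)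

theory Defs
  imports "HOL-Analysis.Analysis"
begin

definition LE_mass :: "nat \<Rightarrow> (real \<Rightarrow> real) \<Rightarrow> real \<Rightarrow> real" where
  "LE_mass d \<rho> r = 4 * pi * integral {0..r} (\<lambda>y. y ^ (d - 1) * \<rho> y)"

definition LE_sol :: "nat \<Rightarrow> real \<Rightarrow> real \<Rightarrow> (real \<Rightarrow> real) \<Rightarrow> ereal \<Rightarrow> bool" where
  "LE_sol d \<gamma> \<rho>0 \<rho> T \<longleftrightarrow>
     0 < T \<and>
     continuous_on {r. 0 \<le> r \<and> ereal r < T} \<rho> \<and>
     (\<forall>r. 0 \<le> r \<and> ereal r < T \<longrightarrow> 0 < \<rho> r) \<and>
     \<rho> 0 = \<rho>0 \<and>
     (\<forall>r. 0 < r \<and> ereal r < T \<longrightarrow>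
        ((\<lambda>s. \<rho> s powr \<gamma>) has_real_derivative (- \<rho> r * LE_mass d \<rho> r / r ^ (d - 1))) (at r))"

definition LE_profile :: "nat \<Rightarrow> real \<Rightarrow> real \<Rightarrow> (real \<Rightarrow> real) \<Rightarrow> ereal \<Rightarrow> bool" where
  "LE_profile d \<gamma> \<rho>0 \<rho> Rg \<longleftrightarrow>
     LE_sol d \<gamma> \<rho>0 \<rho> Rg \<and>
     \<not> (\<exists>\<rho>' T'. Rg < T' \<and> LE_sol d \<gamma> \<rho>0 \<rho>' T' \<and>
                 (\<forall>r. 0 \<le> r \<and> ereal r < Rg \<longrightarrow> \<rho>' r = \<rho> r))"

definition liquid_star :: "nat \<Rightarrow> real \<Rightarrow> real \<Rightarrow> (real \<Rightarrow> real) \<Rightarrow> real \<Rightarrow> bool" where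
  "liquid_star d \<gamma> \<rho>0 \<rho>b R \<longleftrightarrow>
     1 < \<rho>0 \<and>
     (\<exists>\<rho> Rg. LE_profile d \<gamma> \<rho>0 \<rho> Rg \<and> 0 < R \<and> ereal R < Rg \<and> \<rho> R = 1 \<and>
             (\<forall>y\<in>{0..R}. \<rho>b y = \<rho> y))"

text \<open>Smooth (C-infinity) functions on real^n: all iterated partial derivatives exist
  (as Frechet derivatives) everywhere.\<close>
definition smooth_fun :: "(real^'n \<Rightarrow> real) \<Rightarrow> bool" where
  "smooth_fun f \<longleftrightarrow>
     (\<exists>S. f \<in> S \<and>
        (\<forall>g\<in>S. (\<forall>x. g differentiable (at x)) \<and>
                (\<forall>i. (\<lambda>x. frechet_derivative g (at x) (axis i 1)) \<in> S)))"

definition test_fun :: "(real^'n) set \<Rightarrow> (real^'n \<Rightarrow> real) \<Rightarrow> bool" where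
  "test_fun U \<phi> \<longleftrightarrow> smooth_fun \<phi> \<and> compact (closure {x. \<phi> x \<noteq> 0}) \<and>
                      closure {x. \<phi> x \<noteq> 0} \<subseteq> U"

definition H1_on :: "(real^'n) set \<Rightarrow> (real^'n \<Rightarrow> real) \<Rightarrow> bool" where
  "H1_on U u \<longleftrightarrow>
     set_borel_measurable lebesgue U u \<and>
     set_integrable lebesgue U (\<lambda>x. (u x)\<^sup>2) \<and>
     (\<exists>g :: real^'n \<Rightarrow> real^'n.
        (\<forall>i. set_borel_measurable lebesgue U (\<lambda>x. g x $ i) \<and>
             set_integrable lebesgue U (\<lambda>x. (g x $ i)\<^sup>2)) \<and>
        (\<forall>\<phi> i. test_fun U \<phi> \<longrightarrow>
           (LINT x:U|lebesgue. u x * frechet_derivative \<phi> (at x) (axis i 1))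
             = - (LINT x:U|lebesgue. g x $ i * \<phi> x)))"

text \<open>H^1_r: functions on [0,R] whose radial extension to the ball of radius R in
  real^'n (with CARD('n) = d+2 in applications) lies in H^1; chi is taken to be the
  continuous representative on (0,R].\<close>
definition H1r :: "'n::finite itself \<Rightarrow> real \<Rightarrow> (real \<Rightarrow> real) \<Rightarrow> bool" where
  "H1r (n::'n itself) R \<xi> \<longleftrightarrow>
     H1_on (ball (0::real^'n) R) (\<lambda>x. \<xi> (norm x)) \<and> continuous_on {0<..R} \<xi>"

definition Lop :: "nat \<Rightarrow> real \<Rightarrow> (real \<Rightarrow> real) \<Rightarrow> real \<Rightarrow> (real \<Rightarrow> real) \<Rightarrow> real \<Rightarrow> real" where
  "Lop d \<gamma> \<rho>b R \<xi> y =
     - \<gamma> * vector_derivative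
             (\<lambda>s. \<rho>b s powr \<gamma> * s ^ (d + 1) * vector_derivative \<xi> (at s within {0<..R}))
             (at y within {0<..R})
     + (2 * (real d - 1) - real d * \<gamma>) * y ^ d *
         vector_derivative (\<lambda>s. \<rho>b s powr \<gamma>) (at y within {0<..R}) * \<xi> y"

definition Qform :: "nat \<Rightarrow> real \<Rightarrow> (real \<Rightarrow> real) \<Rightarrow> real \<Rightarrow> (real \<Rightarrow> real) \<Rightarrow> real" where
  "Qform d \<gamma> \<rho>b R \<xi> =
     integral {0..R} (\<lambda>y.
        \<gamma> * \<rho>b y powr \<gamma> * y ^ (d + 1) * (vector_derivative \<xi> (at y within {0..R}))\<^sup>2
        + (2 * (real d - 1) - real d * \<gamma>) * y ^ d * (\<xi> y)\<^sup>2 *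
            vector_derivative (\<lambda>s. \<rho>b s powr \<gamma>) (at y within {0..R}))
     + real d * \<gamma> * R ^ d * (\<xi> R)\<^sup>2"

definition C2_on_left_closed :: "real \<Rightarrow> (real \<Rightarrow> real) \<Rightarrow> bool" where
  "C2_on_left_closed R \<xi> \<longleftrightarrow>
     (\<exists>\<xi>1 \<xi>2. (\<forall>y\<in>{0<..R}. (\<xi> has_real_derivative \<xi>1 y) (at y within {0<..R}) \<and>
                           (\<xi>1 has_real_derivative \<xi>2 y) (at y within {0<..R})) \<and>
              continuous_on {0<..R} \<xi>2)"

definition growing_mode :: "'n::finite itself \<Rightarrow> nat \<Rightarrow> real \<Rightarrow> (real \<Rightarrow> real) \<Rightarrow> real \<Rightarrow>
                            real \<Rightarrow> (real \<Rightarrow> real) \<Rightarrow> bool" where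
  "growing_mode n d \<gamma> \<rho>b R lam \<xi> \<longleftrightarrow>
     0 < lam \<and> (\<exists>y\<in>{0<..R}. \<xi> y \<noteq> 0) \<and>
     H1r n R \<xi> \<and> C2_on_left_closed R \<xi> \<and>
     (\<forall>y\<in>{0<..R}. Lop d \<gamma> \<rho>b R \<xi> y = - lam\<^sup>2 * y ^ (d + 1) * \<rho>b y * \<xi> y) \<and>
     real d * \<xi> R + R * vector_derivative \<xi> (at R within {0<..R}) = 0"

definition linearly_stable :: "'n::finite itself \<Rightarrow> nat \<Rightarrow> real \<Rightarrow> (real \<Rightarrow> real) \<Rightarrow> real \<Rightarrow> bool" where
  "linearly_stable n d \<gamma> \<rho>b R \<longleftrightarrow> \<not> (\<exists>lam \<xi>. growing_mode n d \<gamma> \<rho>b R lam \<xi>)"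

end

theory Submission
  imports Defs
begin

text \<open>
  A star of relative central density \<open>\<rho>0 - 1\<close> has radius of order \<open>(\<rho>0 - 1)\<^sup>1\<^sup>/\<^sup>2\<close>, and
  \<open>(\<rho>\<^sup>\<gamma>)' = - D\<close> with \<open>0 \<le> D y \<le> C y\<close>. Hence the negative part of \<open>Q\<close> is at most a constant times
  \<open>\<integral> y\<^sup>d\<^sup>+\<^sup>1 \<xi>\<^sup>2\<close>, which by a Hardy inequality is at most \<open>R\<^sup>2\<close> times \<open>\<integral> y\<^sup>d\<^sup>+\<^sup>1 \<xi>'\<^sup>2\<close> plus a
  boundary term, so it is absorbed once \<open>R\<close> is small. To make sense of \<open>\<xi>'\<close>, the weak gradient is
  tested with radial vector fields whose divergence approximates a difference of two spherical
  shells; this shows that \<open>\<xi>\<close> is locally absolutely continuous, and its a.e. derivative is the one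
  occurring in \<open>Q\<close>. For a growing mode, the flux \<open>w = \<rho>\<^sup>\<gamma> y\<^sup>d\<^sup>+\<^sup>1 \<xi>'\<close> must vanish at the centre,
  since otherwise \<open>\<xi>\<close> grows like \<open>y\<^sup>-\<^sup>d\<close> and is not square integrable; then \<open>w \<xi> \<rightarrow> 0\<close> at the centre,
  and integrating the equation against \<open>\<xi>\<close> contradicts the nonnegativity of \<open>Q\<close>.
\<close>

text \<open>\<open>Qform\<close> is built from total operators: the pointwise
  \<open>vector_derivative\<close>, and the Henstock-Kurzweil \<open>integral\<close>, whose value
  is 0 on a non-integrable integrand. Hence a weak derivative alone does not suffice: \<xi> has to
  be classically differentiable almost everywhere, and this is obtained from Henstock's lemma and a
  Vitali covering. Integrability of the weighted square of \<xi>' on \<open>[a, R]\<close> is read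
  off from the integrand of \<open>Qform\<close> itself; if that integrand is not integrable, only
  the boundary term is left, and it is nonnegative.

  The centre is the second obstacle. \<xi> may be unbounded there, so every inequality is proved on
  \<open>[a, R]\<close> with constants independent of \<open>a\<close>, and \<open>a\<close> tends
  to 0 at the end. A growing mode is not inserted into \<open>Qform_nonneg\<close>, which would say
  nothing if the integral took its default value; both claims rest on
  \<open>truncated_energy_bound\<close>. Its smallness hypothesis is \<kappa> C R^2 \<le> 1 with
  \<kappa> = 2(d - 1) - d \<gamma>, which is nonnegative by the upper bound on \<gamma>.\<close>

section \<open>Differentiation of indefinite integrals almost everywhere\<close>

text \<open>Every point of the set is an endpoint of arbitrarily short intervals on which the mean
  of \<open>f\<close> misses \<open>f x\<close> by more than \<open>e\<close>. Henstock's lemma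
  limits the total length of finitely many disjoint such intervals tagged at these endpoints, and
  Vitali's covering lemma makes their fivefold enlargements cover the set, so its outer measure is
  at most any \<eta>.\<close>

lemma negligible_not_derivative_integral:
  fixes f :: "real \<Rightarrow> real"
  assumes f: "f integrable_on {a..b}" and e: "e > 0"
  shows "negligible {x\<in>{a..b}. \<forall>\<delta>>0. \<exists>y\<in>{a..b}. \<bar>y - x\<bar> < \<delta> \<and>
           e * \<bar>y - x\<bar> < \<bar>integral {a..y} f - integral {a..x} f - (y - x) * f x\<bar>}"
    (is "negligible ?E")
proof -
  define E where "E = ?E"
  have E_def': "x \<in> E \<longleftrightarrow> x \<in> {a..b} \<and> (\<forall>\<delta>>0. \<exists>y\<in>{a..b}. \<bar>y - x\<bar> < \<delta> \<and>
           e * \<bar>y - x\<bar> < \<bar>integral {a..y} f - integral {a..x} f - (y - x) * f x\<bar>)" for x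
    by (simp add: E_def)
  have "negligible E"
  proof (subst negligible_outer_le, intro allI impI)
    fix \<eta> :: real assume \<eta>: "\<eta> > 0"
    \<comment> \<open>The factor e / 5 is used up in two steps: division by \<open>e\<close> bounds
      the total length by \<eta> / 5, and the enlargement by 5 restores \<eta>.\<close>
    obtain \<gamma> where \<gamma>: "gauge \<gamma>"
      and hen: "\<And>p. \<lbrakk>p tagged_partial_division_of (cbox a b); \<gamma> fine p\<rbrakk> \<Longrightarrow>
               sum (\<lambda>(x,k). norm(measure lborel k *\<^sub>R f x - integral k f)) p < \<eta> * e / 5"
      using Henstock_lemma[of f a b "\<eta> * e / 5"] f \<eta> e by auto
    \<comment> \<open>The closed interval between \<open>x\<close> and \<open>y\<close> in either
      order, written as a ball because the covering lemma is about balls; it contains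
      \<open>x\<close>, which can therefore serve as tag.\<close>
    define I where "I x y = cball ((x + y)/2) (\<bar>y - x\<bar>/2)" for x y :: real
    have I_eq: "I x y = {min x y..max x y}" for x y
      by (auto simp: I_def cball_eq_atLeastAtMost min_def max_def abs_if field_simps)
    have "\<exists>y\<in>{a..b}. y \<noteq> x \<and> I x y \<subseteq> \<gamma> x \<and>
             e * \<bar>y - x\<bar> < \<bar>integral {a..y} f - integral {a..x} f - (y - x) * f x\<bar>"
      if x: "x \<in> E" for x
    proof -
      have "open (\<gamma> x)" "x \<in> \<gamma> x" using \<gamma> by (auto simp: gauge_def)
      then obtain \<delta> where \<delta>: "\<delta> > 0" "ball x \<delta> \<subseteq> \<gamma> x" by (meson openE)
      obtain y where y: "y\<in>{a..b}" "\<bar>y - x\<bar> < \<delta>"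
        "e * \<bar>y - x\<bar> < \<bar>integral {a..y} f - integral {a..x} f - (y - x) * f x\<bar>"
        using x \<delta>(1) unfolding E_def' by blast
      have "I x y \<subseteq> ball x \<delta>" using y(2) by (auto simp: I_eq dist_real_def min_def max_def split: if_splits)
      moreover have "y \<noteq> x" using y(3) by auto
      ultimately show ?thesis using y \<delta> by blast
    qed
    then have "\<forall>x\<in>E. \<exists>y. y\<in>{a..b} \<and> y \<noteq> x \<and> I x y \<subseteq> \<gamma> x \<and>
             e * \<bar>y - x\<bar> < \<bar>integral {a..y} f - integral {a..x} f - (y - x) * f x\<bar>"
      unfolding Bex_def by (intro ballI)
    from bchoice[OF this] obtain Y where Y: "\<And>x. x \<in> E \<Longrightarrow> Y x \<in> {a..b} \<and> Y x \<noteq> x \<and> I x (Y x) \<subseteq> \<gamma> x \<and>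
             e * \<bar>Y x - x\<bar> < \<bar>integral {a..Y x} f - integral {a..x} f - (Y x - x) * f x\<bar>"
      by blast
    define c where "c x = (x + Y x)/2" for x
    define r where "r x = \<bar>Y x - x\<bar>/2" for x
    have I: "I x (Y x) = cball (c x) (r x)" for x by (simp add: I_def c_def r_def)
    have r: "0 < r x \<and> r x \<le> b - a" if "x \<in> E" for x
      using Y[OF that] that by (auto simp: r_def E_def')
    have xI: "x \<in> cball (c x) (r x)" for x
      unfolding I[symmetric] I_eq by auto
    have IU: "E \<subseteq> (\<Union>x\<in>E. cball (c x) (r x))" by (rule subsetI, rule UN_I, assumption, rule xI)
    obtain C where C: "countable C" "C \<subseteq> E"
       "pairwise (\<lambda>i j. disjnt (cball (c i) (r i)) (cball (c j) (r j))) C"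
       "E \<subseteq> (\<Union>i\<in>C. cball (c i) (5 * r i))"
      by (rule Vitali_covering_lemma_cballs[OF IU r])
    have bound: "measure lebesgue (\<Union>i\<in>F. cball (c i) (5 * r i)) \<le> \<eta>" if F: "F \<subseteq> C" "finite F" for F
    proof -
      define p where "p = (\<lambda>x. (x, I x (Y x))) ` F"
      have inj: "inj_on (\<lambda>x. (x, I x (Y x))) F" by (auto simp: inj_on_def)
      have FE: "x \<in> E" if "x \<in> F" for x using that F C by blast
      have dis: "disjnt (I x (Y x)) (I y (Y y))" if "x \<in> F" "y \<in> F" "x \<noteq> y" for x y
        using pairwiseD[OF C(3), of x y] that F I by auto
      have "p tagged_partial_division_of (cbox a b)"
        unfolding tagged_partial_division_of_def
      proof (intro conjI allI impI)
        show "finite p" using F by (simp add: p_def)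
      next
        fix x K assume xK: "(x, K) \<in> p"
        then have K: "K = I x (Y x)" "x \<in> F" by (auto simp: p_def)
        show "x \<in> K" using K I xI by simp
        show "K \<subseteq> cbox a b"
          using Y[OF FE[OF K(2)]] FE[OF K(2)] by (auto simp: K(1) I_eq E_def')
        show "\<exists>a b. K = cbox a b" unfolding K I_eq by (metis cbox_interval)
      next
        fix x1 K1 x2 K2
        assume "(x1, K1) \<in> p \<and> (x2, K2) \<in> p \<and> (x1, K1) \<noteq> (x2, K2)"
        then have K: "K1 = I x1 (Y x1)" "x1 \<in> F" "K2 = I x2 (Y x2)" "x2 \<in> F" "x1 \<noteq> x2"
          by (auto simp: p_def)
        then have "K1 \<inter> K2 = {}" using dis[of x1 x2] by (simp add: disjnt_def)
        then show "interior K1 \<inter> interior K2 = {}"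
          using interior_subset by fastforce
      qed
      moreover have "\<gamma> fine p" using Y FE by (auto simp: fine_def p_def)
      ultimately have *: "sum (\<lambda>(x,k). norm(measure lborel k *\<^sub>R f x - integral k f)) p < \<eta> * e / 5"
        by (rule hen)
      have "sum (\<lambda>(x,k). norm(measure lborel k *\<^sub>R f x - integral k f)) p =
          (\<Sum>x\<in>F. \<bar>measure lborel (I x (Y x)) * f x - integral (I x (Y x)) f\<bar>)"
        unfolding p_def by (subst sum.reindex[OF inj]) simp
      also have "\<dots> \<ge> (\<Sum>x\<in>F. e * (2 * r x))"
      proof (rule sum_mono)
        fix x assume "x \<in> F"
        note x = FE[OF this]
        have int: "integral {a..v} f - integral {a..u} f = integral {u..v} f" 
          if "a \<le> u" "u \<le> v" "v \<le> b" for u v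
          using Henstock_Kurzweil_Integration.integral_combine[of a u v f] 
            integrable_subinterval_real[OF f, of a v] that by auto
        show "e * (2 * r x) \<le> \<bar>measure lborel (I x (Y x)) * f x - integral (I x (Y x)) f\<bar>"
        proof (cases "x < Y x")
          case True
          then have "integral (I x (Y x)) f = integral {a..Y x} f - integral {a..x} f"
            "measure lborel (I x (Y x)) = Y x - x"
            using Y[OF x] x int[of x "Y x"] by (auto simp: I_eq E_def')
          then have "\<bar>measure lborel (I x (Y x)) * f x - integral (I x (Y x)) f\<bar> =
              \<bar>integral {a..Y x} f - integral {a..x} f - (Y x - x) * f x\<bar>"
            by (simp only: abs_minus_commute)
          then show ?thesis using Y[OF x] by (simp add: r_def)
        next
          case False
          then have "integral (I x (Y x)) f = - (integral {a..Y x} f - integral {a..x} f)"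
            "measure lborel (I x (Y x)) = - (Y x - x)"
            using Y[OF x] x int[of "Y x" x] by (auto simp: I_eq E_def' min_def max_def)
          moreover have "\<bar>- u * v - - w\<bar> = \<bar>w - u * v\<bar>" for u v w :: real
            by (simp add: algebra_simps)
          ultimately have "\<bar>measure lborel (I x (Y x)) * f x - integral (I x (Y x)) f\<bar> =
              \<bar>integral {a..Y x} f - integral {a..x} f - (Y x - x) * f x\<bar>"
            by metis
          then show ?thesis using Y[OF x] by (simp add: r_def)
        qed
      qed
      finally have "(\<Sum>x\<in>F. e * (2 * r x)) < \<eta> * e / 5" using * by linarith
      then have "e * (\<Sum>x\<in>F. 2 * r x) < e * (\<eta> / 5)"
        by (simp add: sum_distrib_left mult_ac)
      then have s: "(\<Sum>x\<in>F. 2 * r x) < \<eta> / 5" using e by simp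
      have "measure lebesgue (\<Union>i\<in>F. cball (c i) (5 * r i)) \<le>
         (\<Sum>i\<in>F. measure lebesgue (cball (c i) (5 * r i)))"
        by (rule measure_UNION_le) (use F in auto)
      also have "\<dots> = (\<Sum>i\<in>F. 5 * (2 * r i))"
      proof (rule sum.cong)
        fix x assume "x \<in> F"
        then show "measure lebesgue (cball (c x) (5 * r x)) = 5 * (2 * r x)"
          using r[OF FE, of x] by (simp add: cball_eq_atLeastAtMost)
      qed simp
      also have "\<dots> \<le> \<eta>" using s by (simp add: sum_distrib_left[symmetric])
      finally show ?thesis .
    qed
    show "\<exists>T. E \<subseteq> T \<and> T \<in> lmeasurable \<and> measure lebesgue T \<le> \<eta>"
    proof (intro exI conjI)
      show "E \<subseteq> (\<Union>i\<in>C. cball (c i) (5 * r i))" by fact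
      show "(\<Union>i\<in>C. cball (c i) (5 * r i)) \<in> lmeasurable"
        by (rule fmeasurable_UN_bound[OF C(1)]) (use bound in auto)
      show "measure lebesgue (\<Union>i\<in>C. cball (c i) (5 * r i)) \<le> \<eta>"
        by (rule measure_UN_bound[OF C(1)]) (use bound in auto)
    qed
  qed
  then show ?thesis by (simp add: E_def)
qed

text \<open>The exceptional set is the union of those for e = 1/(k+1). \<open>f\<close> is only
  assumed Henstock-Kurzweil integrable, and the derivative is one within the closed interval, the
  kind that \<open>Qform\<close> uses.\<close>

theorem integral_has_real_derivative_ae:
  fixes f :: "real \<Rightarrow> real"
  assumes f: "f integrable_on {a..b}"
  obtains N where "negligible N"
    "\<And>x. x \<in> {a..b} - N \<Longrightarrow>
       ((\<lambda>u. integral {a..u} f) has_real_derivative f x) (at x within {a..b})"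
proof
  let ?F = "\<lambda>u. integral {a..u} f"
  define E where "E e = {x\<in>{a..b}. \<forall>\<delta>>0. \<exists>y\<in>{a..b}. \<bar>y - x\<bar> < \<delta> \<and>
           e * \<bar>y - x\<bar> < \<bar>?F y - ?F x - (y - x) * f x\<bar>}" for e :: real
  show "negligible (\<Union>k. E (inverse (of_nat (Suc k))))"
    unfolding E_def
    by (intro negligible_Union_nat negligible_not_derivative_integral[OF f]) simp
  fix x assume x: "x \<in> {a..b} - (\<Union>k. E (inverse (of_nat (Suc k))))"
  show "(?F has_real_derivative f x) (at x within {a..b})"
    unfolding has_field_derivative_def has_derivative_within_alt
  proof (intro conjI allI impI bounded_linear_mult_right)
    fix e :: real assume "e > 0"
    then obtain k where k: "inverse (of_nat (Suc k)) < e" using reals_Archimedean by blast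
    have "x \<notin> E (inverse (of_nat (Suc k)))" using x by blast
    then have "\<not> (\<forall>\<delta>>0. \<exists>y\<in>{a..b}. \<bar>y - x\<bar> < \<delta> \<and>
           inverse (of_nat (Suc k)) * \<bar>y - x\<bar> < \<bar>?F y - ?F x - (y - x) * f x\<bar>)"
      using x unfolding E_def by blast
    then obtain \<delta> where "\<delta> > 0" and \<delta>': "\<not> (\<exists>y\<in>{a..b}. \<bar>y - x\<bar> < \<delta> \<and>
           inverse (of_nat (Suc k)) * \<bar>y - x\<bar> < \<bar>?F y - ?F x - (y - x) * f x\<bar>)"
      by blast
    have \<delta>: "\<bar>?F y - ?F x - (y - x) * f x\<bar> \<le> inverse (of_nat (Suc k)) * \<bar>y - x\<bar>"
      if "y\<in>{a..b}" "\<bar>y - x\<bar> < \<delta>" for y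
      by (rule leI) (use \<delta>' that in blast)
    show "\<exists>d>0. \<forall>y\<in>{a..b}. norm (y - x) < d \<longrightarrow>
            norm (?F y - ?F x - f x * (y - x)) \<le> e * norm (y - x)"
    proof (intro exI[of _ \<delta>] conjI ballI impI \<open>\<delta> > 0\<close>)
      fix y assume y: "y \<in> {a..b}" "norm (y - x) < \<delta>"
      have "\<bar>?F y - ?F x - (y - x) * f x\<bar> \<le> inverse (of_nat (Suc k)) * \<bar>y - x\<bar>"
        using \<delta> y by simp
      also have "\<dots> \<le> e * \<bar>y - x\<bar>" using k by (intro mult_right_mono) auto
      finally show "norm (?F y - ?F x - f x * (y - x)) \<le> e * norm (y - x)"
        by (simp add: mult.commute)
    qed
  qed
qed

section \<open>Smooth cutoff functions\<close>

text \<open>The factor \<open>(1/t)^k\<close> is carried along because differentiation raises it: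
  the derivative of member k is a combination of members k + 1 and k + 2, so the linear span of the
  family is closed under differentiation.\<close>

definition exp_cut :: "nat \<Rightarrow> real \<Rightarrow> real" where
  "exp_cut k t = (if 0 < t then (1 / t) ^ k * exp (- 1 / t) else 0)"

text \<open>\<open>exp_cut k t / t\<close> is the difference quotient at 0. On the right the
  substitution t = 1/x turns it into a power over \<open>exp x\<close>.\<close>

lemma exp_cut_tendsto_0: "((\<lambda>t. exp_cut k t / t) \<longlongrightarrow> 0) (at 0)"
proof -
  have L: "((\<lambda>t. exp_cut k t / t) \<longlongrightarrow> 0) (at_left 0)"
    by (rule tendsto_eventually) (auto simp: exp_cut_def eventually_at_left_field intro!: exI[of _ "-1"])
  have "((\<lambda>x::real. x ^ Suc k / exp x) \<longlongrightarrow> 0) at_top"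
    by (rule tendsto_power_div_exp_0)
  then have "((\<lambda>t::real. inverse t ^ Suc k / exp (inverse t)) \<longlongrightarrow> 0) (at_right 0)"
    by (rule filterlim_compose) (rule filterlim_inverse_at_top_right)
  then have R: "((\<lambda>t. exp_cut k t / t) \<longlongrightarrow> 0) (at_right 0)"
    by (rule Lim_transform_eventually)
       (auto simp: eventually_at_right_field exp_cut_def exp_minus field_simps intro!: exI[of _ 1])
  show ?thesis using L R by (simp add: filterlim_at_split)
qed

lemma has_real_derivative_exp_cut:
  "(exp_cut k has_real_derivative (exp_cut (k + 2) t - of_nat k * exp_cut (k + 1) t)) (at t)"
proof -
  consider "t < 0" | "t = 0" | "t > 0" by linarith
  then show ?thesis
  proof cases
    case 1
    have "((\<lambda>t. 0) has_real_derivative 0) (at t)" by simp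
    then have "(exp_cut k has_real_derivative 0) (at t)"
      by (rule has_field_derivative_transform_within_open[of _ _ _ "{..<0}"])
        (use 1 in \<open>auto simp: exp_cut_def\<close>)
    then show ?thesis using 1 by (simp add: exp_cut_def)
  next
    case 2
    then show ?thesis using exp_cut_tendsto_0[of k]
      by (simp add: has_field_derivative_iff exp_cut_def)
  next
    case 3
    have "((\<lambda>t. (1 / t) ^ k * exp (- 1 / t)) has_real_derivative
       (exp_cut (k + 2) t - of_nat k * exp_cut (k + 1) t)) (at t)"
    proof -
      have d: "((\<lambda>t. (1 / t) ^ k * exp (- 1 / t)) has_real_derivative
          (1 / t) ^ k * (exp (- 1 / t) * (1 / t\<^sup>2)) +
          (of_nat k * (1 / t) ^ (k - 1) * (- 1 / t\<^sup>2)) * exp (- 1 / t)) (at t)"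
        using 3 by (auto intro!: derivative_eq_intros simp: power2_eq_square)
      \<comment> \<open>For k = 0 the exponent k - 1 is truncated to 0, harmless because of the
        factor \<open>of_nat k\<close>.\<close>
      have "of_nat k * (1 / t) ^ (k - 1) * (1 / t) = of_nat k * (1 / t) ^ k"
        by (cases k) auto
      then have e: "of_nat k * (1 / t) ^ (k - 1) * (- 1 / t\<^sup>2) = - (of_nat k * (1 / t) ^ k * (1 / t))"
        by (metis (no_types, opaque_lifting) divide_minus_left mult.assoc mult_1 mult_minus_right power2_eq_square times_divide_times_eq)
      show ?thesis
        using d[unfolded e] 3 by (simp add: exp_cut_def power_add power2_eq_square algebra_simps)
    qed
    then show ?thesis
      by (rule has_field_derivative_transform_within_open[of _ _ _ "{0<..}"])
        (use 3 in \<open>auto simp: exp_cut_def\<close>)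
  qed
qed

lemma exp_cut_nonneg: "0 \<le> exp_cut k t"
  by (simp add: exp_cut_def)

lemma exp_cut_0_mono: "s \<le> t \<Longrightarrow> exp_cut 0 s \<le> exp_cut 0 t"
  by (auto simp: exp_cut_def frac_le)

lemma continuous_exp_cut [continuous_intros]:
  "continuous_on S f \<Longrightarrow> continuous_on S (\<lambda>x. exp_cut k (f x))"
  using continuous_on_compose2[of UNIV "exp_cut k" S f] has_real_derivative_exp_cut
  by (meson DERIV_isCont continuous_at_imp_continuous_on subset_UNIV)

text \<open>\<open>smooth_fun\<close> asks for a set of differentiable functions that contains the
  partial derivatives of its members. This class is that set: each constructor differentiates into
  expressions built from the same constructors. Positivity in \<open>powr\<close> keeps the power
  differentiable everywhere.\<close>

inductive_set smooth_class :: "(real^'n \<Rightarrow> real) set" where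
  const: "(\<lambda>x. c) \<in> smooth_class"
| coord: "(\<lambda>x. x $ i) \<in> smooth_class"
| add: "f \<in> smooth_class \<Longrightarrow> g \<in> smooth_class \<Longrightarrow> (\<lambda>x. f x + g x) \<in> smooth_class"
| mult: "f \<in> smooth_class \<Longrightarrow> g \<in> smooth_class \<Longrightarrow> (\<lambda>x. f x * g x) \<in> smooth_class"
| exp_cut: "f \<in> smooth_class \<Longrightarrow> (\<lambda>x. exp_cut k (f x)) \<in> smooth_class"
| powr: "f \<in> smooth_class \<Longrightarrow> (\<And>x. 0 < f x) \<Longrightarrow> (\<lambda>x. f x powr p) \<in> smooth_class"

text \<open>The induction carries the total derivative, for the product and chain rules, together
  with membership of all directional derivatives, for closure.\<close>

lemma smooth_class_derivative:
  assumes "f \<in> smooth_class"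
  shows "\<exists>f'. (\<forall>x. (f has_derivative f' x) (at x)) \<and> (\<forall>v. (\<lambda>x. f' x v) \<in> smooth_class)"
  using assms
proof induction
  case (const c)
  then show ?case by (intro exI[of _ "\<lambda>x v. 0"]) (auto intro: smooth_class.const)
next
  case (coord i)
  then show ?case by (intro exI[of _ "\<lambda>x v. v $ i"])
     (auto intro: smooth_class.const bounded_linear_imp_has_derivative bounded_linear_vec_nth)
next
  case (add f g)
  then obtain f' g' where *: "\<And>x. (f has_derivative f' x) (at x)" "\<And>v. (\<lambda>x. f' x v) \<in> smooth_class"
    "\<And>x. (g has_derivative g' x) (at x)" "\<And>v. (\<lambda>x. g' x v) \<in> smooth_class" by blast
  show ?case
    by (intro exI[of _ "\<lambda>x v. f' x v + g' x v"] conjI allI has_derivative_add smooth_class.add *)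
next
  case (mult f g)
  then obtain f' g' where *: "\<And>x. (f has_derivative f' x) (at x)" "\<And>v. (\<lambda>x. f' x v) \<in> smooth_class"
    "\<And>x. (g has_derivative g' x) (at x)" "\<And>v. (\<lambda>x. g' x v) \<in> smooth_class" by blast
  show ?case
    by (intro exI[of _ "\<lambda>x v. f x * g' x v + f' x v * g x"] conjI allI has_derivative_mult
         smooth_class.add smooth_class.mult * mult.hyps)
next
  case (exp_cut f k)
  then obtain f' where *: "\<And>x. (f has_derivative f' x) (at x)" "\<And>v. (\<lambda>x. f' x v) \<in> smooth_class"
    by blast
  show ?case
  proof (intro exI conjI allI)
    fix x
    show "((\<lambda>x. exp_cut k (f x)) has_derivative
      (\<lambda>v. (exp_cut (k + 2) (f x) + - of_nat k * exp_cut (k + 1) (f x)) * f' x v)) (at x)"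
      using has_derivative_compose[OF *(1) has_real_derivative_exp_cut[unfolded has_field_derivative_def]]
      by simp
    show "(\<lambda>x. (exp_cut (k + 2) (f x) + - of_nat k * exp_cut (k + 1) (f x)) * f' x v) \<in> smooth_class" for v
      by (intro smooth_class.add smooth_class.mult smooth_class.const smooth_class.exp_cut * exp_cut.hyps)
  qed
next
  case (powr f p)
  then obtain f' where *: "\<And>x. (f has_derivative f' x) (at x)" "\<And>v. (\<lambda>x. f' x v) \<in> smooth_class"
    by blast
  show ?case
  proof (intro exI conjI allI)
    fix x
    have "((\<lambda>t. t powr p) has_real_derivative (p * f x powr (p - 1))) (at (f x))"
      using powr.hyps(2)[of x] by (auto intro!: derivative_eq_intros)
    then show "((\<lambda>x. f x powr p) has_derivative (\<lambda>v. p * f x powr (p - 1) * f' x v)) (at x)"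
      using has_derivative_compose[OF *(1), of "\<lambda>t. t powr p"]
      by (simp add: has_field_derivative_def)
    show "(\<lambda>x. p * f x powr (p - 1) * f' x v) \<in> smooth_class" for v
      by (intro smooth_class.mult smooth_class.const smooth_class.powr * powr.hyps)
  qed
qed

lemma smooth_class_partial:
  assumes "f \<in> smooth_class"
  shows "f differentiable (at x)" "(\<lambda>x. frechet_derivative f (at x) v) \<in> smooth_class"
proof -
  obtain f' where f': "\<And>x. (f has_derivative f' x) (at x)" "\<And>v. (\<lambda>x. f' x v) \<in> smooth_class"
    using smooth_class_derivative[OF assms] by blast
  show "f differentiable (at x)" using f' differentiableI by blast
  have "(\<lambda>x. frechet_derivative f (at x) v) = (\<lambda>x. f' x v)"
    using frechet_derivative_at[OF f'(1)] by metis
  then show "(\<lambda>x. frechet_derivative f (at x) v) \<in> smooth_class" using f'(2) by simp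
qed

lemma smooth_fun_smooth_class: "f \<in> smooth_class \<Longrightarrow> smooth_fun f"
  unfolding smooth_fun_def
  by (intro exI[of _ smooth_class] conjI ballI allI smooth_class_partial)

lemma smooth_class_sum:
  "(\<And>i. i \<in> I \<Longrightarrow> f i \<in> smooth_class) \<Longrightarrow> (\<lambda>x. \<Sum>i\<in>I. f i x) \<in> smooth_class"
  by (induction I rule: infinite_finite_induct) (auto intro: smooth_class.intros)

lemma smooth_class_continuous:
  assumes "f \<in> smooth_class"
  shows "continuous_on S f"
  using smooth_class_derivative[OF assms] has_derivative_continuous continuous_at_imp_continuous_on
  by metis

text \<open>The inner difference is nonpositive for s \<le> 0 and is the constant
  \<open>exp_cut 0 1\<close> for s \<ge> 1; the outer \<open>exp_cut 0\<close> cuts the first case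
  to 0, and the division normalises the second to 1. Only a division by a constant occurs, so
  membership in \<open>smooth_class\<close> is immediate.\<close>

definition smooth_step :: "real \<Rightarrow> real" where
  "smooth_step s = exp_cut 0 (exp_cut 0 1 - exp_cut 0 (1 - s)) / exp_cut 0 (exp_cut 0 1)"

definition smooth_step' :: "real \<Rightarrow> real" where
  "smooth_step' s = exp_cut 2 (exp_cut 0 1 - exp_cut 0 (1 - s)) * exp_cut 2 (1 - s) / exp_cut 0 (exp_cut 0 1)"

lemma exp_cut_pos: "0 < t \<Longrightarrow> 0 < exp_cut k t" by (simp add: exp_cut_def)

lemma smooth_step_le_0: "s \<le> 0 \<Longrightarrow> smooth_step s = 0"
  using exp_cut_0_mono[of 1 "1 - s"]
  by (auto simp: smooth_step_def exp_cut_def[of 0 "_ - _"])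

lemma smooth_step_ge_1: "s \<ge> 1 \<Longrightarrow> smooth_step s = 1"
  using exp_cut_pos[OF exp_cut_pos[of 1 0], of 0]
  by (simp add: smooth_step_def exp_cut_def[of 0 "1 - s"])

lemma smooth_step'_eq_0: "s \<le> 0 \<or> 1 \<le> s \<Longrightarrow> smooth_step' s = 0"
  using exp_cut_0_mono[of 1 "1 - s"]
  by (auto simp: smooth_step'_def exp_cut_def[of 2])

lemma smooth_step_bounds: "0 \<le> smooth_step s" "smooth_step s \<le> 1"
  using exp_cut_0_mono[of "exp_cut 0 1 - exp_cut 0 (1 - s)" "exp_cut 0 1"] 
     exp_cut_pos[OF exp_cut_pos[of 1 0], of 0] exp_cut_nonneg
  by (auto simp: smooth_step_def field_simps)

lemma smooth_step'_nonneg: "0 \<le> smooth_step' s"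
  by (simp add: smooth_step'_def exp_cut_nonneg)

lemma has_real_derivative_smooth_step:
  "(smooth_step has_real_derivative smooth_step' s) (at s)"
proof -
  let ?c = "exp_cut 0 1"
  have "((\<lambda>s. exp_cut 0 (1 - s)) has_real_derivative - exp_cut 2 (1 - s)) (at s)"
    using DERIV_chain2[OF has_real_derivative_exp_cut DERIV_diff[OF DERIV_const DERIV_ident],
       of 0 1 s UNIV] by (simp add: numeral_2_eq_2)
  from DERIV_diff[OF DERIV_const[of ?c] this]
  have "((\<lambda>s. ?c - exp_cut 0 (1 - s)) has_real_derivative exp_cut 2 (1 - s)) (at s)" by simp
  from DERIV_chain2[OF has_real_derivative_exp_cut this, of 0]
  have "((\<lambda>s. exp_cut 0 (?c - exp_cut 0 (1 - s))) has_real_derivative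
     exp_cut 2 (?c - exp_cut 0 (1 - s)) * exp_cut 2 (1 - s)) (at s)"
    by (simp add: numeral_2_eq_2)
  from DERIV_cdivide[OF this, of "exp_cut 0 ?c"]
  show ?thesis unfolding smooth_step_def [abs_def] smooth_step'_def .
qed

lemma continuous_smooth_step' [continuous_intros]:
  "continuous_on S f \<Longrightarrow> continuous_on S (\<lambda>x. smooth_step' (f x))"
  unfolding smooth_step'_def by (intro continuous_intros) 
    (use exp_cut_pos[OF exp_cut_pos[of 1 0], of 0] in auto)

lemma smooth_class_smooth_step:
  "f \<in> smooth_class \<Longrightarrow> (\<lambda>x. smooth_step (f x)) \<in> smooth_class"
proof -
  assume f: "f \<in> smooth_class"
  have "(\<lambda>x. exp_cut 0 (exp_cut 0 1 + (-1) * exp_cut 0 (1 + (-1) * f x)) * (1 / exp_cut 0 (exp_cut 0 1))) \<in> smooth_class"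
    by (intro smooth_class.intros f)
  then show ?thesis by (simp add: smooth_step_def [abs_def])
qed

section \<open>Radial functions on Euclidean space\<close>

definition sphere_area :: "'a::euclidean_space itself \<Rightarrow> real" where
  "sphere_area (t::'a itself) = real DIM('a) * unit_ball_vol (real DIM('a))"

lemma sphere_area_pos: "0 < sphere_area TYPE('a::euclidean_space)"
  by (simp add: sphere_area_def)

text \<open>Polar coordinates for radial integrands. The half-lines generate the Borel sets, and on
  \<open>{..x}\<close> both measures give the volume of the ball of radius \<open>x\<close>, whose
  derivative in \<open>x\<close> is the density.\<close>

lemma distr_lborel_norm:
  "distr lborel borel (norm :: 'a::euclidean_space \<Rightarrow> real) =
   density lborel (\<lambda>r. ennreal (sphere_area TYPE('a) * r ^ (DIM('a) - 1) * indicator {0..} r))"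
  (is "?M = ?N")
proof (rule measure_eqI_generator_eq[where \<Omega> = UNIV and E = "range (\<lambda>a. {..a::real})" 
      and A = "\<lambda>i. {..real i}"])
  let ?c = "sphere_area TYPE('a)" and ?n = "DIM('a)"
  let ?v = "unit_ball_vol (real ?n)"
  have n: "Suc (?n - 1) = ?n" by simp
  have M: "emeasure ?M {..x} = ennreal (if x < 0 then 0 else ?v * x ^ ?n)" for x
  proof -
    have "emeasure ?M {..x} = emeasure lborel (cball (0::'a) x)"
      by (subst emeasure_distr) (auto intro!: arg_cong[where f = "emeasure lborel"])
    then show ?thesis
      by (auto simp: emeasure_cball)
  qed
  have N: "emeasure ?N {..x} = ennreal (if x < 0 then 0 else ?v * x ^ ?n)" for x
  proof (cases "x < 0")
    case True
    then show ?thesis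
      by (subst emeasure_density, simp, simp, subst nn_integral_cong[where v = "\<lambda>_. 0"])
        (auto simp: indicator_def)
  next
    case False
    have "emeasure ?N {..x} = (\<integral>\<^sup>+r. ennreal (?c * r ^ (?n - 1)) * indicator {0..x} r \<partial>lborel)"
      by (subst emeasure_density) (auto intro!: nn_integral_cong simp: indicator_def)
    also have "\<dots> = ennreal (?v * x ^ ?n - ?v * 0 ^ ?n)"
    proof (rule nn_integral_FTC_Icc)
      fix r :: real assume r: "r \<in> {0..x}"
      show "((\<lambda>r. ?v * r ^ ?n) has_real_derivative ?c * r ^ (?n - 1)) (at r)"
        by (auto intro!: derivative_eq_intros simp: sphere_area_def)
      show "0 \<le> ?c * r ^ (?n - 1)" using r sphere_area_pos[where 'a='a] by simp
    qed (use False in auto)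
    finally show ?thesis using False by simp
  qed
  show "emeasure ?M X = emeasure ?N X" if "X \<in> range (\<lambda>a. {..a::real})" for X
    using that M N by auto
  show "emeasure ?M {..real i} \<noteq> \<infinity>" for i by (simp add: M)
  show "Int_stable (range (\<lambda>a. {..a::real}))"
    by (auto simp: Int_stable_def intro!: image_eqI[of _ _ "min _ _"])
  show "sets ?M = sigma_sets UNIV (range (\<lambda>a. {..a::real}))"
    by (simp add: borel_eq_atMost sets_measure_of)
  show "sets ?N = sigma_sets UNIV (range (\<lambda>a. {..a::real}))"
    by (simp add: borel_eq_atMost sets_measure_of)
  show "(\<Union>i. {..real i}) = UNIV" using real_arch_simple by auto
qed auto

lemma
  fixes f :: "real \<Rightarrow> real"
  assumes f [measurable]: "f \<in> borel_measurable borel"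
  shows integrable_lebesgue_norm:
    "integrable lebesgue (\<lambda>x::'a::euclidean_space. f (norm x)) \<longleftrightarrow>
     integrable lborel (\<lambda>r. sphere_area TYPE('a) * r ^ (DIM('a) - 1) * indicator {0..} r * f r)"
      (is ?int)
    and integral_lebesgue_norm:
    "(\<integral>x. f (norm (x::'a)) \<partial>lebesgue) =
     (\<integral>r. sphere_area TYPE('a) * r ^ (DIM('a) - 1) * indicator {0..} r * f r \<partial>lborel)"
      (is ?eq)
proof -
  let ?w = "\<lambda>r. sphere_area TYPE('a) * r ^ (DIM('a) - 1) * indicator {0..} r"
  have w: "0 \<le> ?w r" for r using sphere_area_pos[where 'a='a] by (simp add: indicator_def)
  have "integrable lebesgue (\<lambda>x::'a. f (norm x)) \<longleftrightarrow> integrable lborel (\<lambda>x::'a. f (norm x))"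
    by (rule integrable_completion) simp
  also have "\<dots> \<longleftrightarrow> integrable (distr lborel borel (norm :: 'a \<Rightarrow> real)) f"
    by (subst integrable_distr_eq) auto
  also have "\<dots> \<longleftrightarrow> integrable lborel (\<lambda>r. ?w r * f r)"
    unfolding distr_lborel_norm using w
    by (subst integrable_density) (auto simp: AE_I2)
  finally show ?int .
  have "(\<integral>x. f (norm (x::'a)) \<partial>lebesgue) = (\<integral>x. f (norm (x::'a)) \<partial>lborel)"
    by (rule integral_completion) simp
  also have "\<dots> = integral\<^sup>L (distr lborel borel (norm :: 'a \<Rightarrow> real)) f"
    by (subst integral_distr) auto
  also have "\<dots> = (\<integral>r. ?w r * f r \<partial>lborel)"
    unfolding distr_lborel_norm using w
    by (subst integral_density) (auto simp: AE_I2)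
  finally show ?eq .
qed

section \<open>Radial marginals of functions that need not be radial\<close>

lemma null_sets_lebesgue_norm:
  assumes "A \<in> null_sets lborel"
  shows "{x::'a::euclidean_space. norm x \<in> A} \<in> null_sets lebesgue"
proof -
  have A [measurable]: "A \<in> sets borel" and A0: "emeasure lborel A = 0" using assms by auto
  have "emeasure lborel {x::'a. norm x \<in> A} = emeasure (distr lborel borel (norm :: 'a \<Rightarrow> real)) A"
    by (subst emeasure_distr) (auto intro!: arg_cong[where f = "emeasure lborel"])
  also have "\<dots> = 0"
    unfolding distr_lborel_norm
    using assms absolutely_continuousI_density[of "\<lambda>r. ennreal (sphere_area TYPE('a) * r ^ (DIM('a) - 1) * indicator {0..} r)" lborel]
    by (auto simp: absolutely_continuous_def null_sets_def subset_iff)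
  finally have "{x::'a. norm x \<in> A} \<in> null_sets lborel"
    by (auto simp: null_sets_def)
  then show ?thesis by (rule null_sets_completionI)
qed

text \<open>The mass of \<open>H\<close> pushed forward under the norm is absolutely continuous,
  since null sets of radii have null preimages; \<open>G\<close> is its Radon-Nikodym density. Thus
  \<open>H\<close> is integrated over spheres without a disintegration of Lebesgue measure.\<close>

lemma radial_density_nonneg:
  fixes H :: "'a::euclidean_space \<Rightarrow> real"
  assumes H: "integrable lebesgue H" and H0: "\<And>x. 0 \<le> H x"
  shows "\<exists>G. integrable lborel G \<and> (\<forall>A\<in>sets borel.
           (\<integral>r. indicator A r * G r \<partial>lborel) = (\<integral>x. indicator A (norm x) * H x \<partial>lebesgue))"
proof -
  note [measurable] = borel_measurable_integrable[OF H]
  have n [measurable]: "(norm :: 'a \<Rightarrow> real) \<in> borel_measurable lebesgue"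
    by (rule measurable_completion) simp
  define N where "N = distr (density lebesgue (\<lambda>x. ennreal (H x))) borel norm"
  have N: "emeasure N A = ennreal (\<integral>x. indicator A (norm x) * H x \<partial>lebesgue)"
    and NI: "integrable lebesgue (\<lambda>x. indicator A (norm x) * H x)"
    if [measurable]: "A \<in> sets borel" for A
  proof -
    show *: "integrable lebesgue (\<lambda>x. indicator A (norm x) * H x)"
      by (rule Bochner_Integration.integrable_bound[OF H]) (auto simp: indicator_def)
    have "emeasure N A = (\<integral>\<^sup>+x. ennreal (H x) * indicator (norm -` A \<inter> space lebesgue) x \<partial>lebesgue)"
      unfolding N_def using measurable_sets[OF n that]
      by (subst emeasure_distr) (auto simp: emeasure_density)
    also have "\<dots> = (\<integral>\<^sup>+x. ennreal (indicator A (norm x) * H x) \<partial>lebesgue)"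
      by (rule nn_integral_cong) (auto simp: indicator_def)
    also have "\<dots> = ennreal (\<integral>x. indicator A (norm x) * H x \<partial>lebesgue)"
      by (rule nn_integral_eq_integral[OF *]) (auto simp: H0)
    finally show "emeasure N A = ennreal (\<integral>x. indicator A (norm x) * H x \<partial>lebesgue)" .
  qed
  have "absolutely_continuous lborel N"
    unfolding absolutely_continuous_def
  proof
    fix A :: "real set" assume A: "A \<in> null_sets lborel"
    have "emeasure N A = ennreal (\<integral>x. indicator A (norm x) * H x \<partial>lebesgue)"
      using A by (intro N) auto
    also have "(\<integral>x. indicator A (norm x) * H x \<partial>lebesgue) = 0"
    proof (rule integral_eq_zero_AE)
      show "AE x in lebesgue. indicator A (norm x) * H x = 0"
        by (rule AE_I'[OF null_sets_lebesgue_norm[OF A]]) (auto simp: indicator_def)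
    qed
    finally show "A \<in> null_sets N" using A by (auto simp: null_sets_def N_def)
  qed
  then obtain f where f [measurable]: "f \<in> borel_measurable lborel" and fN: "density lborel f = N"
    using sigma_finite_measure.Radon_Nikodym[OF sigma_finite_lborel, of N] by (auto simp: N_def)
  have fA: "(\<integral>\<^sup>+r. f r * indicator A r \<partial>lborel) = ennreal (\<integral>x. indicator A (norm x) * H x \<partial>lebesgue)"
    if "A \<in> sets borel" for A
    using N[OF that] that unfolding fN[symmetric] by (simp add: emeasure_density)
  \<comment> \<open>The density is \<open>ennreal\<close>-valued; finite total mass makes it finite
    almost everywhere, so passing to \<open>enn2real\<close> changes no integral.\<close>
  have fin: "(\<integral>\<^sup>+r. f r \<partial>lborel) < \<infinity>" using fA[of UNIV] by simp
  then have "AE r in lborel. f r \<noteq> \<infinity>"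
    by (intro nn_integral_PInf_AE) auto
  then have ae: "AE r in lborel. ennreal (enn2real (f r)) = f r"
    by eventually_elim (simp add: less_top)
  have int: "integrable lborel (\<lambda>r. enn2real (f r))"
  proof (rule integrableI_nonneg)
    have "(\<integral>\<^sup>+r. ennreal (enn2real (f r)) \<partial>lborel) = (\<integral>\<^sup>+r. f r \<partial>lborel)"
      by (rule nn_integral_cong_AE) (use ae in auto)
    then show "(\<integral>\<^sup>+r. ennreal (enn2real (f r)) \<partial>lborel) < \<infinity>" using fin by simp
  qed auto
  show ?thesis
  proof (intro exI[of _ "\<lambda>r. enn2real (f r)"] conjI ballI)
    show "integrable lborel (\<lambda>r. enn2real (f r))" by (rule int)
    fix A :: "real set" assume A [measurable]: "A \<in> sets borel"
    have iA: "integrable lborel (\<lambda>r. indicator A r * enn2real (f r))"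
      by (rule Bochner_Integration.integrable_bound[OF int]) (auto simp: indicator_def)
    have "ennreal (\<integral>r. indicator A r * enn2real (f r) \<partial>lborel) =
        (\<integral>\<^sup>+r. ennreal (indicator A r * enn2real (f r)) \<partial>lborel)"
      by (rule nn_integral_eq_integral[OF iA, symmetric]) auto
    also have "\<dots> = (\<integral>\<^sup>+r. f r * indicator A r \<partial>lborel)"
      by (rule nn_integral_cong_AE) (use ae in eventually_elim, auto simp: indicator_def)
    also have "\<dots> = ennreal (\<integral>x. indicator A (norm x) * H x \<partial>lebesgue)"
      by (rule fA[OF A])
    finally show "(\<integral>r. indicator A r * enn2real (f r) \<partial>lborel) = (\<integral>x. indicator A (norm x) * H x \<partial>lebesgue)"
      by (subst (asm) ennreal_inj) (auto intro!: integral_nonneg_AE AE_I2 mult_nonneg_nonneg H0)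
  qed
qed

lemma radial_density:
  fixes H :: "'a::euclidean_space \<Rightarrow> real"
  assumes H: "integrable lebesgue H"
  shows "\<exists>G. integrable lborel G \<and> (\<forall>A\<in>sets borel.
           (\<integral>r. indicator A r * G r \<partial>lborel) = (\<integral>x. indicator A (norm x) * H x \<partial>lebesgue))"
proof -
  have [measurable]: "(norm :: 'a \<Rightarrow> real) \<in> borel_measurable lebesgue"
    by (rule measurable_completion) simp
  have p: "integrable lebesgue (\<lambda>x. max 0 (H x))" "integrable lebesgue (\<lambda>x. max 0 (- H x))"
    using H by (auto intro!: integrable_max)
  obtain G1 G2 where G: "integrable lborel G1" "integrable lborel G2"
    "\<And>A. A\<in>sets borel \<Longrightarrow> (\<integral>r. indicator A r * G1 r \<partial>lborel) = (\<integral>x. indicator A (norm x) * max 0 (H x) \<partial>lebesgue)"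
    "\<And>A. A\<in>sets borel \<Longrightarrow> (\<integral>r. indicator A r * G2 r \<partial>lborel) = (\<integral>x. indicator A (norm x) * max 0 (- H x) \<partial>lebesgue)"
    using radial_density_nonneg[OF p(1)] radial_density_nonneg[OF p(2)] by auto
  show ?thesis
  proof (intro exI[of _ "\<lambda>r. G1 r - G2 r"] conjI ballI)
    show "integrable lborel (\<lambda>r. G1 r - G2 r)" using G by auto
    fix A :: "real set" assume A [measurable]: "A \<in> sets borel"
    have i: "integrable lborel (\<lambda>r. indicator A r * K r)" if K: "integrable lborel K" for K :: "real \<Rightarrow> real"
      by (rule Bochner_Integration.integrable_bound[OF K]) 
        (use borel_measurable_integrable[OF K] in \<open>auto simp: indicator_def\<close>)
    have j: "integrable lebesgue (\<lambda>x::'a. indicator A (norm x) * K x)" if K: "integrable lebesgue K" for K :: "'a \<Rightarrow> real"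
      by (rule Bochner_Integration.integrable_bound[OF K]) 
        (use borel_measurable_integrable[OF K] in \<open>auto simp: indicator_def\<close>)
    have "(\<integral>r. indicator A r * (G1 r - G2 r) \<partial>lborel) =
      (\<integral>x. indicator A (norm x) * max 0 (H x) \<partial>lebesgue) - (\<integral>x. indicator A (norm x) * max 0 (- H x) \<partial>lebesgue)"
      using G i by (simp add: right_diff_distrib A)
    also have "\<dots> = (\<integral>x. indicator A (norm x) * max 0 (H x) - indicator A (norm x) * max 0 (- H x) \<partial>lebesgue)"
      using j p by simp
    also have "\<dots> = (\<integral>x. indicator A (norm x) * H x \<partial>lebesgue)"
      by (rule Bochner_Integration.integral_cong) (auto simp: max_def)
    finally show "(\<integral>r. indicator A r * (G1 r - G2 r) \<partial>lborel) = (\<integral>x. indicator A (norm x) * H x \<partial>lebesgue)" .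
  qed
qed

section \<open>Approximate spherical shells and radial test fields\<close>

definition ring_cutoff' :: "real \<Rightarrow> real \<Rightarrow> real \<Rightarrow> real" where
  "ring_cutoff' \<epsilon> a r = smooth_step' ((r\<^sup>2 - a\<^sup>2) / \<epsilon>) * (2 * r / \<epsilon>)"

text \<open>The step is taken in r^2 rather than in r, so that the corresponding function of x is a
  smooth function of a polynomial, also at the origin. On r \<ge> 0 its derivative
  \<open>ring_cutoff'\<close> is a bump of mass one on
  \<open>[a, sqrt (a\<^sup>2 + \<epsilon>)]\<close>.\<close>

lemma has_real_derivative_ring_cutoff:
  "((\<lambda>r. smooth_step ((r\<^sup>2 - a\<^sup>2) / \<epsilon>)) has_real_derivative ring_cutoff' \<epsilon> a r) (at r within S)"
proof -
  have "((\<lambda>r. (r\<^sup>2 - a\<^sup>2) / \<epsilon>) has_real_derivative 2 * r / \<epsilon>) (at r within S)"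
    by (rule DERIV_cdivide) (auto intro!: derivative_eq_intros)
  from DERIV_chain2[OF has_real_derivative_smooth_step this]
  show ?thesis by (simp add: ring_cutoff'_def)
qed

lemma ring_cutoff'_eq_0:
  assumes "0 < \<epsilon>" "0 \<le> a" "0 \<le> r" "r \<le> a \<or> sqrt (a\<^sup>2 + \<epsilon>) \<le> r"
  shows "ring_cutoff' \<epsilon> a r = 0"
proof -
  have "(r\<^sup>2 - a\<^sup>2) / \<epsilon> \<le> 0 \<or> 1 \<le> (r\<^sup>2 - a\<^sup>2) / \<epsilon>"
    using assms(4)
  proof
    assume "r \<le> a"
    then have "r\<^sup>2 \<le> a\<^sup>2" using assms by (intro power_mono) auto
    then show ?thesis using assms by (auto simp: divide_le_0_iff)
  next
    assume "sqrt (a\<^sup>2 + \<epsilon>) \<le> r"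
    then have "a\<^sup>2 + \<epsilon> \<le> r\<^sup>2" by (rule sqrt_le_D)
    then show ?thesis using assms by auto
  qed
  then show ?thesis unfolding ring_cutoff'_def by (simp add: smooth_step'_eq_0)
qed

lemma ring_cutoff'_nonneg: "0 < \<epsilon> \<Longrightarrow> 0 \<le> r \<Longrightarrow> 0 \<le> ring_cutoff' \<epsilon> a r"
  by (simp add: ring_cutoff'_def smooth_step'_nonneg)

lemma continuous_ring_cutoff': "\<epsilon> \<noteq> 0 \<Longrightarrow> continuous_on S (ring_cutoff' \<epsilon> a)"
  unfolding ring_cutoff'_def [abs_def] by (intro continuous_intros) auto

lemma has_integral_ring_cutoff':
  assumes "0 < \<epsilon>" "0 < a"
  shows "(ring_cutoff' \<epsilon> a has_integral 1) {a..sqrt (a\<^sup>2 + \<epsilon>)}"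
proof -
  have le: "a \<le> sqrt (a\<^sup>2 + \<epsilon>)" using assms by (intro real_le_rsqrt) auto
  have "(ring_cutoff' \<epsilon> a has_integral
      (smooth_step (((sqrt (a\<^sup>2 + \<epsilon>))\<^sup>2 - a\<^sup>2) / \<epsilon>) - smooth_step ((a\<^sup>2 - a\<^sup>2) / \<epsilon>)))
       {a..sqrt (a\<^sup>2 + \<epsilon>)}"
    using has_real_derivative_ring_cutoff 
    by (intro fundamental_theorem_of_calculus le) (simp add: has_real_derivative_iff_has_vector_derivative)
  moreover have "(sqrt (a\<^sup>2 + \<epsilon>))\<^sup>2 = a\<^sup>2 + \<epsilon>" using assms by simp
  ultimately show ?thesis using assms by (simp add: smooth_step_le_0 smooth_step_ge_1)
qed

text \<open>Integration in polar coordinates produces the integral over the whole of (0, R); the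
  bump confines it to a compact interval away from 0, where \<xi> is continuous.\<close>

lemma ring_cutoff'_has_integral:
  assumes \<xi>: "continuous_on {0<..R} \<xi>" and a: "0 < a" and \<epsilon>: "0 < \<epsilon>" 
    and R: "a\<^sup>2 + \<epsilon> < R\<^sup>2" "0 < R"
  shows "((\<lambda>r. \<xi> r * ring_cutoff' \<epsilon> a r) has_integral
     integral {a..sqrt (a\<^sup>2 + \<epsilon>)} (\<lambda>r. \<xi> r * ring_cutoff' \<epsilon> a r)) {0<..<R}"
    "(\<lambda>r. \<xi> r * ring_cutoff' \<epsilon> a r) integrable_on {a..sqrt (a\<^sup>2 + \<epsilon>)}"
proof -
  let ?b = "sqrt (a\<^sup>2 + \<epsilon>)" and ?w = "ring_cutoff' \<epsilon> a"
  have bR: "?b < R" using R by (metis abs_of_pos real_sqrt_abs real_sqrt_less_iff)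
  have c: "continuous_on {a..?b} (\<lambda>r. \<xi> r * ?w r)"
    using \<epsilon> a bR by (intro continuous_on_mult continuous_ring_cutoff' continuous_on_subset[OF \<xi>]) auto
  then show i: "(\<lambda>r. \<xi> r * ?w r) integrable_on {a..?b}"
    by (rule integrable_continuous_real)
  show "((\<lambda>r. \<xi> r * ?w r) has_integral integral {a..?b} (\<lambda>r. \<xi> r * ?w r)) {0<..<R}"
  proof (subst has_integral_spike_set_eq[where T = "{a..?b}"])
    show "((\<lambda>r. \<xi> r * ?w r) has_integral integral {a..?b} (\<lambda>r. \<xi> r * ?w r)) {a..?b}"
      using i by (rule integrable_integral)
    have "{r \<in> {0<..<R} - {a..?b}. \<xi> r * ?w r \<noteq> 0} = {}"
      using ring_cutoff'_eq_0[OF \<epsilon>, of a] a by fastforce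
    then show "negligible {r \<in> {0<..<R} - {a..?b}. \<xi> r * ?w r \<noteq> 0}" by (simp only: negligible_empty)
    have "{a..?b} - {0<..<R} = {}" using a bR by auto
    then show "negligible {r \<in> {a..?b} - {0<..<R}. \<xi> r * ?w r \<noteq> 0}"
      by (metis (no_types, lifting) empty_iff negligible_empty mem_Collect_eq subsetI subset_empty)
  qed
qed

lemma ring_cutoff'_integral_near:
  assumes \<xi>: "continuous_on {0<..R} \<xi>" and a: "0 < a" and \<epsilon>: "0 < \<epsilon>" 
    and R: "a\<^sup>2 + \<epsilon> < R\<^sup>2" "0 < R"
    and near: "\<And>r. a \<le> r \<Longrightarrow> r \<le> sqrt (a\<^sup>2 + \<epsilon>) \<Longrightarrow> \<bar>\<xi> r - \<xi> a\<bar> \<le> e"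
  shows "\<bar>integral {0<..<R} (\<lambda>r. \<xi> r * ring_cutoff' \<epsilon> a r) - \<xi> a\<bar> \<le> e"
proof -
  let ?b = "sqrt (a\<^sup>2 + \<epsilon>)" and ?w = "ring_cutoff' \<epsilon> a"
  have w: "(?w has_integral 1) {a..?b}" by (rule has_integral_ring_cutoff'[OF \<epsilon> a])
  note i' = ring_cutoff'_has_integral(1)[OF assms(1-5)]
  note i = integrable_integral[OF ring_cutoff'_has_integral(2)[OF assms(1-5)]]
  have "((\<lambda>r. \<xi> r * ?w r - \<xi> a * ?w r) has_integral
      (integral {a..?b} (\<lambda>r. \<xi> r * ?w r) - \<xi> a * 1)) {a..?b}"
    by (intro has_integral_diff has_integral_mult_right i w)
  moreover have "((\<lambda>r. e * ?w r) has_integral (e * 1)) {a..?b}"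
    by (intro has_integral_mult_right w)
  moreover have "norm (\<xi> r * ?w r - \<xi> a * ?w r) \<le> (e * ?w r) \<bullet> 1" if "r \<in> {a..?b}" for r
  proof -
    have "0 \<le> ?w r" using that a \<epsilon> by (intro ring_cutoff'_nonneg) auto
    then have "\<bar>\<xi> r - \<xi> a\<bar> * ?w r \<le> e * ?w r" using near that by (intro mult_right_mono) auto
    then show ?thesis using \<open>0 \<le> ?w r\<close> by (simp add: left_diff_distrib[symmetric] abs_mult)
  qed
  ultimately have "norm (integral {a..?b} (\<lambda>r. \<xi> r * ?w r) - \<xi> a * 1) \<le> (e * 1) \<bullet> 1"
    by (rule has_integral_norm_bound_integral_component)
  then show "\<bar>integral {0<..<R} (\<lambda>r. \<xi> r * ?w r) - \<xi> a\<bar> \<le> e"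
    using i' by (simp add: integral_unique)
qed

text \<open>The bumps are nonnegative, have mass one and shrink to \<open>a\<close> from the right:
  they form an approximate identity, and continuity of \<xi> at \<open>a\<close> gives the
  limit.\<close>

lemma ring_cutoff'_integral_tendsto:
  fixes \<epsilon> :: "nat \<Rightarrow> real"
  assumes \<xi>: "continuous_on {0<..R} \<xi>" and a: "0 < a" "a < R"
    and \<epsilon>: "\<And>k. 0 < \<epsilon> k" "\<And>k. a\<^sup>2 + \<epsilon> k < R\<^sup>2" "\<epsilon> \<longlonglongrightarrow> 0"
  shows "(\<lambda>k. integral {0<..<R} (\<lambda>r. \<xi> r * ring_cutoff' (\<epsilon> k) a r)) \<longlonglongrightarrow> \<xi> a"
proof (rule tendstoI)
  fix e :: real assume e: "e > 0"
  have R: "0 < R" using a by simp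
  have "continuous (at a within {0<..R}) \<xi>"
    using \<xi> a by (simp add: continuous_on_eq_continuous_within)
  then obtain \<delta> where \<delta>: "\<delta> > 0" "\<And>r. r \<in> {0<..R} \<Longrightarrow> dist r a < \<delta> \<Longrightarrow> dist (\<xi> r) (\<xi> a) < e / 2"
    using e unfolding continuous_within_eps_delta by (metis half_gt_zero)
  have "(\<lambda>k. sqrt (a\<^sup>2 + \<epsilon> k)) \<longlonglongrightarrow> sqrt (a\<^sup>2 + 0)"
    by (intro tendsto_intros \<epsilon>)
  then have "(\<lambda>k. sqrt (a\<^sup>2 + \<epsilon> k)) \<longlonglongrightarrow> a" using a by simp
  then have "eventually (\<lambda>k. sqrt (a\<^sup>2 + \<epsilon> k) < a + \<delta>) sequentially"
    by (rule order_tendstoD) (use \<delta> in simp)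
  then show "eventually (\<lambda>k. dist (integral {0<..<R} (\<lambda>r. \<xi> r * ring_cutoff' (\<epsilon> k) a r)) (\<xi> a) < e) sequentially"
  proof eventually_elim
    case (elim k)
    have "sqrt (a\<^sup>2 + \<epsilon> k) < R" using R \<epsilon>(2) by (metis abs_of_pos real_sqrt_abs real_sqrt_less_iff)
    then have "\<bar>\<xi> r - \<xi> a\<bar> \<le> e / 2" if "a \<le> r" "r \<le> sqrt (a\<^sup>2 + \<epsilon> k)" for r
      using \<delta>(2)[of r] that elim a by (auto simp: dist_real_def)
    from ring_cutoff'_integral_near[OF \<xi> a(1) \<epsilon>(1)[of k] \<epsilon>(2)[of k] R this]
    show ?case using e by (simp add: dist_real_def)
  qed
qed

text \<open>The value at t = 0 is 0, which is why the limiting shells are the half-open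
  \<open>{a<..b}\<close>.\<close>

lemma smooth_step_tendsto:
  assumes "\<And>k. 0 < \<epsilon> k" "\<epsilon> \<longlonglongrightarrow> 0"
  shows "(\<lambda>k. smooth_step (t / \<epsilon> k)) \<longlonglongrightarrow> (if 0 < t then 1 else 0)"
proof (cases "0 < t")
  case True
  have "eventually (\<lambda>k. \<epsilon> k < t) sequentially" by (rule order_tendstoD(2)[OF assms(2) True])
  then have "eventually (\<lambda>k. smooth_step (t / \<epsilon> k) = 1) sequentially"
  proof eventually_elim
    case (elim k)
    then have "1 \<le> t / \<epsilon> k" using assms(1)[of k] by simp
    then show ?case by (rule smooth_step_ge_1)
  qed
  then show ?thesis using True by (simp add: tendsto_eventually)
next
  case False
  then have "smooth_step (t / \<epsilon> k) = 0" for k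
    using assms(1)[of k] by (intro smooth_step_le_0) (simp add: divide_le_0_iff)
  then show ?thesis using False by simp
qed

lemma power2_powr_half:
  assumes "0 \<le> (r::real)"
  shows "r\<^sup>2 powr (- p / 2) = r powr (- p)"
proof (cases "r = 0")
  case False
  then have "r\<^sup>2 = r powr 2" using assms by simp
  then show ?thesis by (simp only: powr_powr) simp
qed simp

text \<open>Component \<open>i\<close> of the field \<open>x |x|\<^sup>-\<^sup>n \<theta>(|x|)\<close>, whose divergence is \<open>|x|\<^sup>1\<^sup>-\<^sup>n \<theta>'(|x|)\<close>.\<close>
definition radial_field :: "real \<Rightarrow> real \<Rightarrow> real \<Rightarrow> 'n::finite \<Rightarrow> real^'n \<Rightarrow> real" where
  "radial_field \<epsilon> a b i x = x $ i * norm x powr (- real CARD('n)) *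
     (smooth_step (((norm x)\<^sup>2 - a\<^sup>2) / \<epsilon>) - smooth_step (((norm x)\<^sup>2 - b\<^sup>2) / \<epsilon>))"

lemma radial_field_smooth_class:
  fixes i :: "'n::finite"
  assumes "0 < \<epsilon>" "0 < a" "a < b"
  shows "radial_field \<epsilon> a b i \<in> smooth_class"
proof -
  have q: "(\<lambda>x::real^'n. (norm x)\<^sup>2) \<in> smooth_class"
  proof -
    have "(\<lambda>x::real^'n. \<Sum>j\<in>UNIV. x $ j * x $ j) \<in> smooth_class"
      by (intro smooth_class_sum smooth_class.mult smooth_class.coord)
    then show ?thesis by (simp add: power2_norm_eq_inner inner_vec_def)
  qed
  have lin: "(\<lambda>x::real^'n. c + s * (norm x)\<^sup>2) \<in> smooth_class" for c s
    by (intro smooth_class.add smooth_class.mult smooth_class.const q)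
  let ?p = "- real CARD('n) / 2"
  let ?b = "\<lambda>x::real^'n. (norm x)\<^sup>2 + exp_cut 0 (a\<^sup>2 + (- 1) * (norm x)\<^sup>2)"
  \<comment> \<open>\<open>|x|\<^sup>2 powr p\<close> is singular at \<open>0\<close>; \<open>?b\<close> is positive everywhere and equals \<open>|x|\<^sup>2\<close> on the support.\<close>
  have pos: "0 < ?b x" for x
  proof (cases "(norm x)\<^sup>2 < a\<^sup>2")
    case True
    then have "0 < exp_cut 0 (a\<^sup>2 + (- 1) * (norm x)\<^sup>2)" by (intro exp_cut_pos) simp
    then show ?thesis by (simp add: add_nonneg_pos)
  next
    case False
    moreover have "0 < a\<^sup>2" using assms by simp
    ultimately have "0 < (norm x)\<^sup>2" by linarith
    then show ?thesis using exp_cut_nonneg[of 0 "a\<^sup>2 + (- 1) * (norm x)\<^sup>2"] by linarith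
  qed
  have st: "(\<lambda>x::real^'n. smooth_step (- c\<^sup>2 / \<epsilon> + 1 / \<epsilon> * (norm x)\<^sup>2)) \<in> smooth_class" for c
    by (intro smooth_class_smooth_step lin)
  have "(\<lambda>x. x $ i * ?b x powr ?p *
     (smooth_step (- a\<^sup>2 / \<epsilon> + 1 / \<epsilon> * (norm x)\<^sup>2) + (- 1) * smooth_step (- b\<^sup>2 / \<epsilon> + 1 / \<epsilon> * (norm x)\<^sup>2))) 
      \<in> smooth_class" (is "?f \<in> _")
    by (intro smooth_class.add smooth_class.mult smooth_class.const smooth_class.coord
      smooth_class.powr smooth_class.exp_cut q pos st)
  also have "?f = radial_field \<epsilon> a b i"
  proof
    fix x :: "real^'n"
    have eq: "- c\<^sup>2 / \<epsilon> + 1 / \<epsilon> * (norm x)\<^sup>2 = ((norm x)\<^sup>2 - c\<^sup>2) / \<epsilon>" for c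
      by (simp add: diff_divide_distrib)
    show "?f x = radial_field \<epsilon> a b i x"
    proof (cases "(norm x)\<^sup>2 \<le> a\<^sup>2")
      case True
      moreover have "a\<^sup>2 \<le> b\<^sup>2" using assms by (intro power_mono) auto
      ultimately have "((norm x)\<^sup>2 - a\<^sup>2) / \<epsilon> \<le> 0" "((norm x)\<^sup>2 - b\<^sup>2) / \<epsilon> \<le> 0"
        using assms by (auto simp: divide_le_0_iff)
      then show ?thesis unfolding radial_field_def eq by (simp add: smooth_step_le_0)
    next
      case False
      then have "0 < norm x" by (auto simp: not_le)
      have "?b x powr ?p = ((norm x)\<^sup>2) powr ?p" using False by (simp add: exp_cut_def)
      also have "\<dots> = norm x powr (- real CARD('n))" by (rule power2_powr_half) simp
      finally show ?thesis unfolding radial_field_def eq by simp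
    qed
  qed
  finally show ?thesis .
qed

text \<open>Inside radius \<open>a\<close> both steps are 0, and outside the larger radius both are
  1 and cancel. A single step would leave the tail x |x|^(-n), without compact support.\<close>

lemma radial_field_eq_0:
  fixes x :: "real^'n"
  assumes "0 < \<epsilon>" "0 < a" "a < b" "norm x \<le> a \<or> sqrt (b\<^sup>2 + \<epsilon>) \<le> norm x"
  shows "radial_field \<epsilon> a b i x = 0"
proof -
  have ab: "a\<^sup>2 \<le> b\<^sup>2" using assms by (intro power_mono) auto
  from assms(4) show ?thesis
  proof
    assume "norm x \<le> a"
    then have "(norm x)\<^sup>2 \<le> a\<^sup>2" by (intro power_mono) auto
    then have "((norm x)\<^sup>2 - a\<^sup>2) / \<epsilon> \<le> 0" "((norm x)\<^sup>2 - b\<^sup>2) / \<epsilon> \<le> 0"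
      using assms ab by (auto simp: divide_le_0_iff)
    then show ?thesis unfolding radial_field_def by (simp add: smooth_step_le_0)
  next
    assume "sqrt (b\<^sup>2 + \<epsilon>) \<le> norm x"
    then have "b\<^sup>2 + \<epsilon> \<le> (norm x)\<^sup>2" by (rule sqrt_le_D)
    then have "\<epsilon> \<le> (norm x)\<^sup>2 - a\<^sup>2" "\<epsilon> \<le> (norm x)\<^sup>2 - b\<^sup>2" using ab by linarith+
    then have "1 \<le> ((norm x)\<^sup>2 - a\<^sup>2) / \<epsilon>" "1 \<le> ((norm x)\<^sup>2 - b\<^sup>2) / \<epsilon>"
      using assms(1) by auto
    then show ?thesis unfolding radial_field_def by (simp add: smooth_step_ge_1)
  qed
qed

lemma radial_field_test_fun:
  fixes i :: "'n::finite"
  assumes "0 < \<epsilon>" "0 < a" "a < b" "b\<^sup>2 + \<epsilon> < R\<^sup>2" "0 < R"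
  shows "test_fun (ball 0 R) (radial_field \<epsilon> a b i)"
proof -
  have "{x. radial_field \<epsilon> a b i x \<noteq> 0} \<subseteq> cball 0 (sqrt (b\<^sup>2 + \<epsilon>))"
  proof
    fix x assume "x \<in> {x. radial_field \<epsilon> a b i x \<noteq> 0}"
    then have "\<not> sqrt (b\<^sup>2 + \<epsilon>) \<le> norm x" using radial_field_eq_0[OF assms(1-3)] by blast
    then show "x \<in> cball 0 (sqrt (b\<^sup>2 + \<epsilon>))" by simp
  qed
  then have sub: "closure {x. radial_field \<epsilon> a b i x \<noteq> 0} \<subseteq> cball 0 (sqrt (b\<^sup>2 + \<epsilon>))"
    by (rule closure_minimal) simp
  have "sqrt (b\<^sup>2 + \<epsilon>) < R" using assms(4,5) by (metis abs_of_pos real_sqrt_abs real_sqrt_less_iff)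
  then have "cball 0 (sqrt (b\<^sup>2 + \<epsilon>)) \<subseteq> ball (0::real^'n) R" by auto
  moreover have "compact (closure {x. radial_field \<epsilon> a b i x \<noteq> 0})"
    using bounded_subset[OF bounded_cball sub] by (simp add: compact_eq_bounded_closed)
  ultimately show ?thesis
    using smooth_fun_smooth_class[OF radial_field_smooth_class[OF assms(1-3)]] sub
    by (auto simp: test_fun_def)
qed

text \<open>The field x |x|^(-n) has divergence zero away from the origin, so only the derivative of
  the radial factor survives. The radial part is treated as a function of t = x . x, which avoids
  differentiating the norm.\<close>

lemma radial_field_divergence:
  fixes x :: "real^'n"
  assumes "0 < \<epsilon>" "0 < a" "a < b"
  shows "(\<Sum>i\<in>UNIV. frechet_derivative (radial_field \<epsilon> a b i) (at x) (axis i 1)) =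
     norm x powr (1 - real CARD('n)) * (ring_cutoff' \<epsilon> a (norm x) - ring_cutoff' \<epsilon> b (norm x))"
\<comment> \<open>The field vanishes on a ball around the origin, and at the origin the right-hand
  side is 0 because 0 \<open>powr\<close> any exponent is 0.\<close>
proof (cases "x = 0")
  case True
  have "frechet_derivative (radial_field \<epsilon> a b i) (at x) = (\<lambda>v. 0)" for i
  proof (rule frechet_derivative_at[symmetric], rule has_derivative_transform_within_open)
    show "((\<lambda>x. 0) has_derivative (\<lambda>v. 0)) (at x)" by simp
    show "open (ball (0::real^'n) a)" by simp
    show "x \<in> ball 0 a" using True assms by simp
    show "0 = radial_field \<epsilon> a b i y" if "y \<in> ball 0 a" for y
      using that assms radial_field_eq_0[OF assms, of y i] by simp
  qed
  then show ?thesis using True by simp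
next
  case False
  let ?n = "real CARD('n)"
  let ?\<theta> = "\<lambda>t. smooth_step ((t - a\<^sup>2) / \<epsilon>) - smooth_step ((t - b\<^sup>2) / \<epsilon>)"
  let ?\<theta>' = "\<lambda>t. smooth_step' ((t - a\<^sup>2) / \<epsilon>) / \<epsilon> - smooth_step' ((t - b\<^sup>2) / \<epsilon>) / \<epsilon>"
  let ?F = "\<lambda>t. t powr (- ?n / 2) * ?\<theta> t"
  let ?t = "x \<bullet> x"
  define F' where "F' = - ?n / 2 * ?t powr (- ?n / 2 - 1) * ?\<theta> ?t + ?t powr (- ?n / 2) * ?\<theta>' ?t"
  have t: "0 < ?t" using False by simp
  have r: "0 < norm x" using False by simp
  have \<theta>: "(?\<theta> has_real_derivative ?\<theta>' ?t) (at ?t)"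
  proof -
    have "((\<lambda>t. smooth_step ((t - c\<^sup>2) / \<epsilon>)) has_real_derivative smooth_step' ((?t - c\<^sup>2) / \<epsilon>) / \<epsilon>) (at ?t)" for c
    proof -
      have "((\<lambda>t. (t - c\<^sup>2) / \<epsilon>) has_real_derivative 1 / \<epsilon>) (at ?t)"
        by (rule DERIV_cdivide) (auto intro!: derivative_eq_intros)
      from DERIV_chain2[OF has_real_derivative_smooth_step this] show ?thesis by simp
    qed
    then show ?thesis by (intro DERIV_diff)
  qed
  have "((\<lambda>t. t powr (- ?n / 2)) has_real_derivative (- ?n / 2 * ?t powr (- ?n / 2 - 1))) (at ?t)"
    using t by (auto intro!: derivative_eq_intros)
  from DERIV_mult[OF this \<theta>] have F: "(?F has_real_derivative F') (at ?t)"
    by (simp add: F'_def algebra_simps)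
  have rf: "radial_field \<epsilon> a b i = (\<lambda>y. y $ i * ?F (y \<bullet> y))" for i :: 'n
  proof
    fix y :: "real^'n"
    have "norm y powr (- ?n) = (y \<bullet> y) powr (- ?n / 2)"
      by (simp only: power2_powr_half norm_ge_zero power2_norm_eq_inner[symmetric])
    then show "radial_field \<epsilon> a b i y = y $ i * ?F (y \<bullet> y)"
      by (simp add: radial_field_def power2_norm_eq_inner mult.assoc)
  qed
  have d: "frechet_derivative (radial_field \<epsilon> a b i) (at x) (axis i 1) = 2 * F' * (x $ i * x $ i) + ?F ?t" for i
  proof -
    have 1: "((\<lambda>y::real^'n. y \<bullet> y) has_derivative (\<lambda>v. x \<bullet> v + v \<bullet> x)) (at x)"
      by (rule has_derivative_inner[OF has_derivative_ident has_derivative_ident])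
    have 2: "((\<lambda>y. ?F (y \<bullet> y)) has_derivative (\<lambda>v. F' * (x \<bullet> v + v \<bullet> x))) (at x)"
      using has_derivative_compose[OF 1 F[unfolded has_field_derivative_def]] .
    have 3: "((\<lambda>y. y $ i) has_derivative (\<lambda>v. v $ i)) (at x)"
      by (rule bounded_linear_imp_has_derivative) (rule bounded_linear_vec_nth)
    have "(radial_field \<epsilon> a b i has_derivative (\<lambda>v. x $ i * (F' * (x \<bullet> v + v \<bullet> x)) + v $ i * ?F ?t)) (at x)"
      unfolding rf by (rule has_derivative_mult[OF 3 2])
    from frechet_derivative_at[OF this, symmetric]
    show ?thesis by (simp add: inner_axis inner_axis' algebra_simps)
  qed
  have "(\<Sum>i\<in>UNIV. frechet_derivative (radial_field \<epsilon> a b i) (at x) (axis i 1)) =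
      2 * F' * ?t + ?n * ?F ?t"
    unfolding d by (simp add: sum.distrib sum_distrib_left[symmetric] inner_vec_def)
  \<comment> \<open>The factor \<open>?n/2 - ?n/2\<close> displays the cancellation: the power of t
    contributes -n when differentiated, the coordinate functions together +n.\<close>
  also have "\<dots> = 2 * (?t powr (- ?n / 2 - 1) * ?t) * (?t powr 0 * (?n/ 2 - ?n/2)) * ?\<theta> ?t + 2 * (?t * ?t powr (- ?n / 2)) * ?\<theta>' ?t"
  proof -
    have "?t powr (- ?n / 2) = ?t powr (- ?n / 2 - 1) * ?t"
      using t by (simp add: powr_diff)
    then show ?thesis unfolding F'_def by (simp add: algebra_simps)
  qed
  also have "\<dots> = 2 * (?t * ?t powr (- ?n / 2)) * ?\<theta>' ?t" by simp
  also have "?t * ?t powr (- ?n / 2) = norm x powr (1 - ?n) * norm x"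
  proof -
    have "?t powr (- ?n / 2) = norm x powr (- ?n)"
      by (simp only: power2_powr_half norm_ge_zero power2_norm_eq_inner[symmetric])
    moreover have "norm x powr (1 - ?n) = norm x * norm x powr (- ?n)" 
      using r by (simp add: powr_diff powr_minus divide_inverse)
    moreover have "?t = norm x * norm x" by (simp add: dot_square_norm power2_eq_square)
    ultimately show ?thesis by simp
  qed
  also have "2 * (norm x powr (1 - ?n) * norm x) * ?\<theta>' ?t = 
      norm x powr (1 - ?n) * (ring_cutoff' \<epsilon> a (norm x) - ring_cutoff' \<epsilon> b (norm x))"
    by (simp add: ring_cutoff'_def power2_norm_eq_inner algebra_simps)
  finally show ?thesis .
qed

section \<open>Radial Sobolev functions are absolutely continuous\<close>

lemma indicator_mult_borel_measurable:
  assumes "continuous_on {0<..R} (\<xi> :: real \<Rightarrow> real)"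
  shows "(\<lambda>r. indicator {0<..<R} r * \<xi> r) \<in> borel_measurable borel"
proof -
  have "continuous_on {0<..<R} \<xi>" by (rule continuous_on_subset[OF assms]) auto
  then have "(\<lambda>r. indicator {0<..<R} r *\<^sub>R \<xi> r) \<in> borel_measurable borel"
    by (intro borel_measurable_continuous_on_indicator) auto
  then show ?thesis by simp
qed

lemma H1r_square_integrable:
  assumes H: "H1r TYPE('n::finite) R \<xi>"
  shows "(\<lambda>r. r ^ (CARD('n) - 1) * (\<xi> r)\<^sup>2) absolutely_integrable_on {0..R}"
proof -
  let ?F = "\<lambda>r. (indicator {0<..<R} r * \<xi> r)\<^sup>2"
  let ?c = "sphere_area TYPE(real^'n)"
  have [measurable]: "(\<lambda>r. indicator {0<..<R} r * \<xi> r) \<in> borel_measurable borel"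
    using H by (intro indicator_mult_borel_measurable) (simp add: H1r_def)
  have "set_integrable lebesgue (ball 0 R) (\<lambda>x::real^'n. (\<xi> (norm x))\<^sup>2)"
    using H by (simp add: H1r_def H1_on_def)
  then have "integrable lebesgue (\<lambda>x::real^'n. ?F (norm x))"
    unfolding set_integrable_def
  proof (rule integrable_cong_AE_imp)
    show "(\<lambda>x::real^'n. ?F (norm x)) \<in> borel_measurable lebesgue"
      by (intro measurable_completion) simp
    \<comment> \<open>Continuity of \<xi> is only given on (0, R], so \<open>\<xi> 0\<close> is
      arbitrary; the origin is discarded as a null set.\<close>
    have "AE x::real^'n in lebesgue. x \<noteq> 0"
      by (intro AE_completion AE_lborel_singleton)
    then show "AE x::real^'n in lebesgue. indicat_real (ball 0 R) x *\<^sub>R (\<xi> (norm x))\<^sup>2 = ?F (norm x)"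
      by eventually_elim (auto simp: indicator_def)
  qed
  then have "integrable lborel (\<lambda>r. ?c * r ^ (CARD('n) - 1) * indicator {0..} r * ?F r)"
    by (subst (asm) integrable_lebesgue_norm) auto
  then have "integrable lborel (\<lambda>r. (1 / ?c) * (?c * r ^ (CARD('n) - 1) * indicator {0..} r * ?F r))"
    by (rule integrable_mult_right)
  also have "(\<lambda>r. (1 / ?c) * (?c * r ^ (CARD('n) - 1) * indicator {0..} r * ?F r)) =
     (\<lambda>r. indicator {0<..<R} r *\<^sub>R (r ^ (CARD('n) - 1) * (\<xi> r)\<^sup>2))"
    using sphere_area_pos[where 'a="real^'n"] by (auto simp: indicator_def fun_eq_iff power_mult_distrib)
  finally have "(\<lambda>r. r ^ (CARD('n) - 1) * (\<xi> r)\<^sup>2) absolutely_integrable_on {0<..<R}"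
    unfolding set_integrable_def by (subst integrable_completion) (auto dest: borel_measurable_integrable)
  then show ?thesis
    by (rule absolutely_integrable_spike_set)
      (auto intro: negligible_subset[of "{0, R}"])
qed

text \<open>The pointwise bound |t| \<le> 1 + t^2 has an integrable right-hand side, because the set
  has finite measure.\<close>

lemma set_integrable_of_square:
  fixes f :: "'a \<Rightarrow> real"
  assumes m: "set_borel_measurable M A f" and f2: "set_integrable M A (\<lambda>x. (f x)\<^sup>2)"
    and A: "A \<in> fmeasurable M"
  shows "set_integrable M A f"
  unfolding set_integrable_def
proof (rule Bochner_Integration.integrable_bound)
  show "integrable M (\<lambda>x. indicator A x + indicator A x *\<^sub>R (f x)\<^sup>2)"
    using A f2 unfolding set_integrable_def
    by (intro Bochner_Integration.integrable_add integrable_real_indicator) (auto simp: fmeasurable_def)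
  show "(\<lambda>x. indicator A x *\<^sub>R f x) \<in> borel_measurable M"
    using m by (simp add: set_borel_measurable_def)
  have "\<bar>t\<bar> \<le> 1 + t\<^sup>2" for t :: real
  proof -
    have "0 \<le> (\<bar>t\<bar> - 1)\<^sup>2" by simp
    then have "2 * \<bar>t\<bar> \<le> 1 + t\<^sup>2" by (simp add: power2_diff)
    then show ?thesis by linarith
  qed
  then show "AE x in M. norm (indicat_real A x *\<^sub>R f x) \<le> norm (indicat_real A x + indicat_real A x *\<^sub>R (f x)\<^sup>2)"
    by (auto simp: indicator_def)
qed

lemma set_integrable_mult_continuous:
  fixes f \<phi> :: "'a::euclidean_space \<Rightarrow> real"
  assumes f: "set_integrable lebesgue (ball 0 R) f" and \<phi>: "continuous_on UNIV \<phi>"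
  shows "set_integrable lebesgue (ball 0 R) (\<lambda>x. f x * \<phi> x)"
proof -
  have "compact (\<phi> ` cball 0 R)"
    by (intro compact_continuous_image continuous_on_subset[OF \<phi>]) auto
  then obtain C where C: "\<And>x. x \<in> cball 0 R \<Longrightarrow> norm (\<phi> x) \<le> C"
    using compact_imp_bounded bounded_pos by (metis imageI)
  show ?thesis
    unfolding set_integrable_def
  proof (rule Bochner_Integration.integrable_bound)
    show "integrable lebesgue (\<lambda>x. C * (indicator (ball 0 R) x *\<^sub>R f x))"
      using f unfolding set_integrable_def by (rule integrable_mult_right)
    have "\<phi> \<in> borel_measurable lebesgue"
      by (rule measurable_completion) (use \<phi> in \<open>simp add: borel_measurable_continuous_onI\<close>)
    moreover have "(\<lambda>x. indicator (ball 0 R) x *\<^sub>R f x) \<in> borel_measurable lebesgue"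
      using f unfolding set_integrable_def by (rule borel_measurable_integrable)
    ultimately have "(\<lambda>x. (indicator (ball 0 R) x *\<^sub>R f x) * \<phi> x) \<in> borel_measurable lebesgue"
      by (rule borel_measurable_times[rotated])
    then show "(\<lambda>x. indicator (ball 0 R) x *\<^sub>R (f x * \<phi> x)) \<in> borel_measurable lebesgue"
      by (simp add: mult.assoc)
    show "AE x in lebesgue. norm (indicat_real (ball 0 R) x *\<^sub>R (f x * \<phi> x))
        \<le> norm (C * (indicat_real (ball 0 R) x *\<^sub>R f x))"
    proof (rule AE_I2)
      fix x
      show "norm (indicat_real (ball 0 R) x *\<^sub>R (f x * \<phi> x))
        \<le> norm (C * (indicat_real (ball 0 R) x *\<^sub>R f x))"
      proof (cases "x \<in> ball 0 R")
        case True
        then have "\<bar>\<phi> x\<bar> \<le> C" using C[of x] by simp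
        then have "\<bar>\<phi> x\<bar> * \<bar>f x\<bar> \<le> \<bar>C\<bar> * \<bar>f x\<bar>" by (intro mult_right_mono) auto
        then show ?thesis using True by (simp add: abs_mult mult.commute)
      qed simp
    qed
  qed
qed

text \<open>Component i of the weak gradient is tested with component i of the radial field, and the
  identities are added. On the left the divergence formula gives |x|^(1-n) times a difference of
  bumps, and this power cancels the weight r^(n-1) of polar coordinates. On the right the product g
  . x appears; it is not claimed to be a radial function.\<close>

lemma H1r_weak_radial_derivative:
  assumes H: "H1r TYPE('n::finite) R \<xi>" and R: "0 < R"
  obtains h :: "real^'n \<Rightarrow> real" where "set_integrable lebesgue (ball 0 R) h"
    "\<And>\<epsilon> a b. 0 < \<epsilon> \<Longrightarrow> 0 < a \<Longrightarrow> a < b \<Longrightarrow> b\<^sup>2 + \<epsilon> < R\<^sup>2 \<Longrightarrow>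
       sphere_area TYPE(real^'n) *
         integral {0<..<R} (\<lambda>r. \<xi> r * (ring_cutoff' \<epsilon> a r - ring_cutoff' \<epsilon> b r)) =
       - (LINT x:ball 0 R|lebesgue. h x * (norm x powr (- real CARD('n)) *
           (smooth_step (((norm x)\<^sup>2 - a\<^sup>2) / \<epsilon>) - smooth_step (((norm x)\<^sup>2 - b\<^sup>2) / \<epsilon>))))"
proof -
  let ?U = "ball (0::real^'n) R" and ?c = "sphere_area TYPE(real^'n)" and ?n = "real CARD('n)"
  have U: "?U \<in> lmeasurable" by simp
  have c\<xi>: "continuous_on {0<..R} \<xi>" using H by (simp add: H1r_def)
  have "H1_on ?U (\<lambda>x. \<xi> (norm x))" using H unfolding H1r_def by (rule conjunct1)
  note H1 = this[unfolded H1_on_def]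
  have u: "set_integrable lebesgue ?U (\<lambda>x. \<xi> (norm x))"
    by (rule set_integrable_of_square[OF H1[THEN conjunct1] H1[THEN conjunct2, THEN conjunct1] U])
  from H1[THEN conjunct2, THEN conjunct2] obtain g :: "real^'n \<Rightarrow> real^'n" where
    "\<forall>i. set_borel_measurable lebesgue ?U (\<lambda>x. g x $ i) \<and>
       set_integrable lebesgue ?U (\<lambda>x. (g x $ i)\<^sup>2)"
    and weak: "\<forall>\<phi> i. test_fun ?U \<phi> \<longrightarrow>
           (LINT x:?U|lebesgue. \<xi> (norm x) * frechet_derivative \<phi> (at x) (axis i 1))
             = - (LINT x:?U|lebesgue. g x $ i * \<phi> x)"
    by (elim exE conjE) (rule that; assumption)
  then have g: "\<And>i. set_borel_measurable lebesgue ?U (\<lambda>x. g x $ i)"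
       "\<And>i. set_integrable lebesgue ?U (\<lambda>x. (g x $ i)\<^sup>2)" by simp_all
  have gi: "set_integrable lebesgue ?U (\<lambda>x. g x $ i)" for i
    by (rule set_integrable_of_square[OF g U])
  define h where "h x = (\<Sum>i\<in>UNIV. g x $ i * x $ i)" for x
  show thesis
  proof
    have "set_integrable lebesgue ?U (\<lambda>x. g x $ i * x $ i)" for i
      by (intro set_integrable_mult_continuous gi continuous_intros)
    then show "set_integrable lebesgue ?U h"
      unfolding h_def set_integrable_def scaleR_sum_right by (intro Bochner_Integration.integrable_sum)
    fix \<epsilon> a b :: real
    assume \<epsilon>: "0 < \<epsilon>" and a: "0 < a" and b: "a < b" and bR: "b\<^sup>2 + \<epsilon> < R\<^sup>2"
    let ?\<phi> = "\<lambda>i::'n. radial_field \<epsilon> a b i"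
    let ?D = "\<lambda>i x. frechet_derivative (?\<phi> i) (at x) (axis i 1)"
    let ?W = "\<lambda>r. ring_cutoff' \<epsilon> a r - ring_cutoff' \<epsilon> b r"
    note sc = radial_field_smooth_class[OF \<epsilon> a b]
    have uD: "integrable lebesgue (\<lambda>x. indicator ?U x *\<^sub>R (\<xi> (norm x) * ?D i x))" for i
      unfolding set_integrable_def[symmetric]
      by (intro set_integrable_mult_continuous u smooth_class_continuous smooth_class_partial sc)
    have gD: "integrable lebesgue (\<lambda>x. indicator ?U x *\<^sub>R (g x $ i * ?\<phi> i x))" for i
      unfolding set_integrable_def[symmetric]
      by (intro set_integrable_mult_continuous gi smooth_class_continuous sc)
    \<comment> \<open>The indicator makes the radial profile Borel measurable on the whole line and
      absorbs the arbitrary value of \<xi> at the origin.\<close>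
    let ?F = "\<lambda>r. indicator {0<..<R} r * \<xi> r * (r powr (1 - ?n) * ?W r)"
    have F: "(\<Sum>i\<in>UNIV. indicator ?U x *\<^sub>R (\<xi> (norm x) * ?D i x)) = ?F (norm x)" for x
    proof -
      have "(\<Sum>i\<in>UNIV. indicator ?U x *\<^sub>R (\<xi> (norm x) * ?D i x)) = 
          indicator ?U x * (\<xi> (norm x) * (\<Sum>i\<in>UNIV. ?D i x))"
        by (simp add: sum_distrib_left)
      also have "\<dots> = ?F (norm x)"
        unfolding radial_field_divergence[OF \<epsilon> a b] by (cases "x = 0") (auto simp: indicator_def)
      finally show ?thesis .
    qed
    have Fm: "?F \<in> borel_measurable borel"
    proof -
      have W: "?W \<in> borel_measurable borel"
        using \<epsilon> by (intro borel_measurable_continuous_onI continuous_on_diff continuous_ring_cutoff') auto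
      have p: "(\<lambda>r::real. r powr (1 - ?n)) \<in> borel_measurable borel" by measurable
      show ?thesis
        by (rule borel_measurable_times[OF indicator_mult_borel_measurable[OF c\<xi>] borel_measurable_times[OF p W]])
    qed
    have Fi: "integrable lebesgue (\<lambda>x::real^'n. ?F (norm x))"
      unfolding F[symmetric] by (intro Bochner_Integration.integrable_sum uD)
    have w: "?c * r ^ (CARD('n) - 1) * indicator {0..} r * ?F r =
        ?c * (indicator {0<..<R} r *\<^sub>R (\<xi> r * ?W r))" for r
    proof (cases "0 < r")
      case True
      have "r ^ (CARD('n) - 1) * r powr (1 - ?n) = r powr (?n - 1) * r powr (1 - ?n)"
        using True by (simp add: powr_realpow[symmetric] of_nat_diff Suc_leI)
      also have "\<dots> = 1" using True by (simp add: powr_add[symmetric])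
      finally have "r ^ (CARD('n) - 1) * r powr (1 - ?n) = 1" .
      then have "?c * (r ^ (CARD('n) - 1) * r powr (1 - ?n)) * (indicator {0<..<R} r * (\<xi> r * ?W r)) =
        ?c * (indicator {0<..<R} r *\<^sub>R (\<xi> r * ?W r))" by simp
      then show ?thesis using True by (simp add: mult_ac)
    qed simp
    have "integrable lborel (\<lambda>r. ?c * (indicator {0<..<R} r *\<^sub>R (\<xi> r * ?W r)))"
      using Fi unfolding integrable_lebesgue_norm[OF Fm] by (simp only: w[symmetric] DIM_cart DIM_real mult_1_right)
    then have Wi: "set_integrable lborel {0<..<R} (\<lambda>r. \<xi> r * ?W r)"
      using sphere_area_pos[where 'a = "real^'n"] unfolding set_integrable_def
      by (subst (asm) integrable_mult_left_iff) auto
    have "?c * integral {0<..<R} (\<lambda>r. \<xi> r * ?W r) = 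
        (\<integral>r. ?c * (indicator {0<..<R} r *\<^sub>R (\<xi> r * ?W r)) \<partial>lborel)"
      using set_borel_integral_eq_integral(2)[OF Wi] 
      by (simp only: set_lebesgue_integral_def integral_mult_right_zero)
    also have "\<dots> = (\<integral>x. ?F (norm (x::real^'n)) \<partial>lebesgue)"
      unfolding integral_lebesgue_norm[OF Fm] by (simp only: w[symmetric] DIM_cart DIM_real mult_1_right)
    also have "\<dots> = (\<Sum>i\<in>UNIV. LINT x:?U|lebesgue. \<xi> (norm x) * ?D i x)"
      unfolding F[symmetric] set_lebesgue_integral_def by (intro Bochner_Integration.integral_sum uD)
    also have "\<dots> = - (\<Sum>i\<in>UNIV. LINT x:?U|lebesgue. g x $ i * ?\<phi> i x)"
      unfolding sum_negf[symmetric]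
      by (intro sum.cong refl weak[rule_format] radial_field_test_fun \<epsilon> a b bR R)
    also have "(\<Sum>i\<in>UNIV. LINT x:?U|lebesgue. g x $ i * ?\<phi> i x) = 
        (\<integral>x. (\<Sum>i\<in>UNIV. indicator ?U x *\<^sub>R (g x $ i * ?\<phi> i x)) \<partial>lebesgue)"
      unfolding set_lebesgue_integral_def
      by (intro Bochner_Integration.integral_sum[symmetric] gD)
    also have "\<dots> = (LINT x:?U|lebesgue. h x * (norm x powr (- ?n) *
           (smooth_step (((norm x)\<^sup>2 - a\<^sup>2) / \<epsilon>) - smooth_step (((norm x)\<^sup>2 - b\<^sup>2) / \<epsilon>))))"
      unfolding set_lebesgue_integral_def h_def radial_field_def
      by (intro Bochner_Integration.integral_cong refl) 
        (simp add: sum_distrib_left sum_distrib_right mult.assoc)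
    finally show "?c * integral {0<..<R} (\<lambda>r. \<xi> r * ?W r) = - (LINT x:?U|lebesgue. h x * (norm x powr (- ?n) *
           (smooth_step (((norm x)\<^sup>2 - a\<^sup>2) / \<epsilon>) - smooth_step (((norm x)\<^sup>2 - b\<^sup>2) / \<epsilon>))))" .
  qed
qed

text \<open>As \<epsilon> tends to 0, the left-hand side of the weak identity tends to a multiple of
  \<xi> a - \<xi> b by the approximate identity, and the cutoffs on the right tend to the indicator
  of a shell. The area constant is absorbed into \<open>h\<close>, which does not depend on
  \<open>a\<close> and \<open>b\<close>.\<close>

lemma H1r_increment:
  assumes H: "H1r TYPE('n::finite) R \<xi>" and R: "0 < R"
  obtains h :: "real^'n \<Rightarrow> real" where "set_integrable lebesgue (ball 0 R) h"
    "\<And>a b. 0 < a \<Longrightarrow> a < b \<Longrightarrow> b < R \<Longrightarrow>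
       \<xi> b - \<xi> a = (LINT x:ball 0 R|lebesgue. h x *
          (norm x powr (- real CARD('n)) * indicator {a<..b} (norm x)))"
proof -
  let ?U = "ball (0::real^'n) R" and ?c = "sphere_area TYPE(real^'n)" and ?n = "real CARD('n)"
  have c: "0 < ?c" by (rule sphere_area_pos)
  have c\<xi>: "continuous_on {0<..R} \<xi>" using H by (simp add: H1r_def)
  obtain h :: "real^'n \<Rightarrow> real" where hi: "set_integrable lebesgue ?U h"
    and h: "\<And>\<epsilon> a b. 0 < \<epsilon> \<Longrightarrow> 0 < a \<Longrightarrow> a < b \<Longrightarrow> b\<^sup>2 + \<epsilon> < R\<^sup>2 \<Longrightarrow>
       ?c * integral {0<..<R} (\<lambda>r. \<xi> r * (ring_cutoff' \<epsilon> a r - ring_cutoff' \<epsilon> b r)) =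
       - (LINT x:?U|lebesgue. h x * (norm x powr (- ?n) *
           (smooth_step (((norm x)\<^sup>2 - a\<^sup>2) / \<epsilon>) - smooth_step (((norm x)\<^sup>2 - b\<^sup>2) / \<epsilon>))))"
    using H1r_weak_radial_derivative[OF H R] by blast
  have hm: "(\<lambda>x. indicator ?U x *\<^sub>R h x) \<in> borel_measurable lebesgue"
    using hi unfolding set_integrable_def by (rule borel_measurable_integrable)
  have Bm: "f \<in> borel_measurable borel \<Longrightarrow> (\<lambda>x::real^'n. f (norm x)) \<in> borel_measurable lebesgue" for f :: "real \<Rightarrow> real"
    by (rule measurable_completion) simp
  show thesis
  proof
    show "set_integrable lebesgue ?U (\<lambda>x. 1 / ?c * h x)"
      using hi by (rule set_integrable_mult_right)
    fix a b :: real assume a: "0 < a" and b: "a < b" and bR: "b < R"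
    have b2: "b\<^sup>2 < R\<^sup>2" using a b bR by (intro power_strict_mono) auto
    have ab2: "a\<^sup>2 < b\<^sup>2" using a b by (intro power_strict_mono) auto
    \<comment> \<open>The denominator k + 2 keeps b^2 + \<epsilon> k strictly below R^2 for k = 0 as
      well, so all bumps lie inside the ball.\<close>
    define \<epsilon> where "\<epsilon> k = (R\<^sup>2 - b\<^sup>2) * inverse (real (Suc (Suc k)))" for k
    have \<epsilon>: "0 < \<epsilon> k" for k using b2 by (simp add: \<epsilon>_def)
    have \<epsilon>R: "b\<^sup>2 + \<epsilon> k < R\<^sup>2" for k
    proof -
      have "\<epsilon> k < (R\<^sup>2 - b\<^sup>2) * 1" unfolding \<epsilon>_def using b2 
        by (intro mult_strict_left_mono) (auto simp: field_simps)
      then show ?thesis by simp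
    qed
    have \<epsilon>aR: "a\<^sup>2 + \<epsilon> k < R\<^sup>2" for k using \<epsilon>R[of k] ab2 by linarith
    have \<epsilon>0: "\<epsilon> \<longlonglongrightarrow> 0"
    proof -
      have "(\<lambda>k. inverse (real (Suc (Suc k)))) \<longlonglongrightarrow> 0"
        using LIMSEQ_Suc[OF LIMSEQ_inverse_real_of_nat] .
      from tendsto_mult_right_zero[OF this] show ?thesis unfolding \<epsilon>_def .
    qed
    have Wa: "(\<lambda>k. integral {0<..<R} (\<lambda>r. \<xi> r * ring_cutoff' (\<epsilon> k) a r)) \<longlonglongrightarrow> \<xi> a"
      using a b bR by (intro ring_cutoff'_integral_tendsto c\<xi> \<epsilon> \<epsilon>aR \<epsilon>0) auto
    have Wb: "(\<lambda>k. integral {0<..<R} (\<lambda>r. \<xi> r * ring_cutoff' (\<epsilon> k) b r)) \<longlonglongrightarrow> \<xi> b"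
      using a b bR by (intro ring_cutoff'_integral_tendsto c\<xi> \<epsilon> \<epsilon>R \<epsilon>0) auto
    have "integral {0<..<R} (\<lambda>r. \<xi> r * (ring_cutoff' (\<epsilon> k) a r - ring_cutoff' (\<epsilon> k) b r)) =
        integral {0<..<R} (\<lambda>r. \<xi> r * ring_cutoff' (\<epsilon> k) a r) - integral {0<..<R} (\<lambda>r. \<xi> r * ring_cutoff' (\<epsilon> k) b r)" for k
      unfolding right_diff_distrib
      by (intro Henstock_Kurzweil_Integration.integral_diff
        has_integral_integrable[OF ring_cutoff'_has_integral(1)] c\<xi> \<epsilon> \<epsilon>R \<epsilon>aR R) (use a b in auto)
    then have L: "(\<lambda>k. ?c * integral {0<..<R} (\<lambda>r. \<xi> r * (ring_cutoff' (\<epsilon> k) a r - ring_cutoff' (\<epsilon> k) b r))) \<longlonglongrightarrow> ?c * (\<xi> a - \<xi> b)"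
      by (simp only:) (intro tendsto_intros Wa Wb)
    let ?p = "\<lambda>x::real^'n. norm x powr (- ?n)"
    let ?th = "\<lambda>k r. smooth_step ((r\<^sup>2 - a\<^sup>2) / \<epsilon> k) - smooth_step ((r\<^sup>2 - b\<^sup>2) / \<epsilon> k)"
    have smb: "(\<lambda>r. ?th k r) \<in> borel_measurable borel" for k
      using has_real_derivative_ring_cutoff
      by (intro borel_measurable_continuous_onI continuous_on_diff DERIV_continuous_on)
    have R': "(\<lambda>k. LINT x:?U|lebesgue. h x * (?p x * ?th k (norm x))) \<longlonglongrightarrow>
       (LINT x:?U|lebesgue. h x * (?p x * indicator {a<..b} (norm x)))"
      unfolding set_lebesgue_integral_def
    proof (rule integral_dominated_convergence)
      have pm: "?p \<in> borel_measurable lebesgue" by (rule Bm) measurable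
      have eq: "(\<lambda>x. indicator ?U x *\<^sub>R (h x * (?p x * f x))) = (\<lambda>x. (indicator ?U x *\<^sub>R h x) * (?p x * f x))" for f :: "real^'n \<Rightarrow> real"
        by (simp add: mult.assoc)
      show "(\<lambda>x. indicator ?U x *\<^sub>R (h x * (?p x * indicator {a<..b} (norm x)))) \<in> borel_measurable lebesgue"
        unfolding eq by (intro borel_measurable_times hm pm Bm) simp
      show "(\<lambda>x. indicator ?U x *\<^sub>R (h x * (?p x * ?th k (norm x)))) \<in> borel_measurable lebesgue" for k
        unfolding eq by (intro borel_measurable_times hm pm Bm smb)
      \<comment> \<open>Domination: the cutoffs vanish for |x| \<le> a, and beyond that |x|^(-n)
        \<le> a^(-n).\<close>
      show "integrable lebesgue (\<lambda>x. a powr (- ?n) * norm (indicator ?U x *\<^sub>R h x))"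
        using hi unfolding set_integrable_def by (intro integrable_mult_right integrable_norm)
      show "AE x in lebesgue. (\<lambda>k. indicator ?U x *\<^sub>R (h x * (?p x * ?th k (norm x)))) \<longlonglongrightarrow>
         indicator ?U x *\<^sub>R (h x * (?p x * indicator {a<..b} (norm x)))"
      proof (rule AE_I2)
        fix x :: "real^'n"
        have gt: "0 < (norm x)\<^sup>2 - t\<^sup>2 \<longleftrightarrow> t < norm x" if "0 < t" for t
          using that power_mono_iff[of "norm x" t 2] by (simp add: not_le[symmetric])
        have "(\<lambda>k. ?th k (norm x)) \<longlonglongrightarrow> (if 0 < (norm x)\<^sup>2 - a\<^sup>2 then 1 else 0) - (if 0 < (norm x)\<^sup>2 - b\<^sup>2 then 1 else 0)"
          by (intro tendsto_diff smooth_step_tendsto \<epsilon> \<epsilon>0)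
        also have "(if 0 < (norm x)\<^sup>2 - a\<^sup>2 then 1 else 0) - (if 0 < (norm x)\<^sup>2 - b\<^sup>2 then 1 else 0) = (indicator {a<..b} (norm x) :: real)"
          using a b gt[of a] gt[of b] by (auto simp: indicator_def)
        finally show "(\<lambda>k. indicator ?U x *\<^sub>R (h x * (?p x * ?th k (norm x)))) \<longlonglongrightarrow>
         indicator ?U x *\<^sub>R (h x * (?p x * indicator {a<..b} (norm x)))"
          by (intro tendsto_intros)
      qed
      show "AE x in lebesgue. norm (indicator ?U x *\<^sub>R (h x * (?p x * ?th k (norm x)))) \<le>
         a powr (- ?n) * norm (indicator ?U x *\<^sub>R h x)" for k
      proof (rule AE_I2)
        fix x :: "real^'n"
        have "\<bar>?p x * ?th k (norm x)\<bar> \<le> a powr (- ?n)"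
        proof (cases "norm x \<le> a")
          case True
          then have "(norm x)\<^sup>2 \<le> a\<^sup>2" by (intro power_mono) auto
          then have "?th k (norm x) = 0"
            using \<epsilon>[of k] ab2 by (simp add: smooth_step_le_0 divide_le_0_iff)
          then show ?thesis by simp
        next
          case False
          have "?p x \<le> a powr (- ?n)" using False a by (intro powr_mono2') auto
          moreover have "\<bar>?th k (norm x)\<bar> \<le> 1"
            using smooth_step_bounds[of "((norm x)\<^sup>2 - a\<^sup>2) / \<epsilon> k"] smooth_step_bounds[of "((norm x)\<^sup>2 - b\<^sup>2) / \<epsilon> k"]
            by linarith
          ultimately have "?p x * \<bar>?th k (norm x)\<bar> \<le> a powr (- ?n) * 1"
            by (intro mult_mono) auto
          then show ?thesis by (simp add: abs_mult)
        qed
        then have "\<bar>?p x * ?th k (norm x)\<bar> * \<bar>indicator ?U x * h x\<bar> \<le> a powr (- ?n) * \<bar>indicator ?U x * h x\<bar>"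
          by (intro mult_right_mono) auto
        moreover have "norm (indicator ?U x *\<^sub>R (h x * (?p x * ?th k (norm x)))) = \<bar>?p x * ?th k (norm x)\<bar> * \<bar>indicator ?U x * h x\<bar>"
          by (simp add: abs_mult)
        ultimately show "norm (indicator ?U x *\<^sub>R (h x * (?p x * ?th k (norm x)))) \<le> a powr (- ?n) * norm (indicator ?U x *\<^sub>R h x)"
          by simp
      qed
    qed
    have "?c * (\<xi> a - \<xi> b) = - (LINT x:?U|lebesgue. h x * (?p x * indicator {a<..b} (norm x)))"
      using L tendsto_minus[OF R'] unfolding h[OF \<epsilon> a b \<epsilon>R] by (rule LIMSEQ_unique)
    then have "\<xi> b - \<xi> a = 1 / ?c * (LINT x:?U|lebesgue. h x * (?p x * indicator {a<..b} (norm x)))"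
      using c by (simp add: field_simps)
    also have "\<dots> = (LINT x:?U|lebesgue. 1 / ?c * h x * (?p x * indicator {a<..b} (norm x)))"
      by (simp only: set_integral_mult_right[symmetric] mult.assoc)
    finally show "\<xi> b - \<xi> a = (LINT x:?U|lebesgue. 1 / ?c * h x * (?p x * indicator {a<..b} (norm x)))" .
  qed
qed

text \<open>The increments of \<xi> are shell integrals; the radial marginal \<open>G\<close> of
  their integrand makes \<xi> an indefinite integral of \<open>G\<close>, and differentiation almost
  everywhere identifies \<open>G\<close> with the pointwise derivative.\<close>

theorem H1r_absolutely_continuous:
  assumes H: "H1r TYPE('n::finite) R \<xi>" and a0: "0 < a0" "a0 < R"
  shows "(\<lambda>y. vector_derivative \<xi> (at y within {0..R})) absolutely_integrable_on {a0..R}"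
    and "integral {a0..R} (\<lambda>y. vector_derivative \<xi> (at y within {0..R})) = \<xi> R - \<xi> a0"
proof -
  let ?U = "ball (0::real^'n) R" and ?n = "real CARD('n)"
  have R: "0 < R" using a0 by simp
  have c\<xi>: "continuous_on {a0..R} \<xi>"
    using H a0 by (auto simp: H1r_def intro: continuous_on_subset)
  obtain h :: "real^'n \<Rightarrow> real" where hi: "set_integrable lebesgue ?U h"
    and h: "\<And>a b. 0 < a \<Longrightarrow> a < b \<Longrightarrow> b < R \<Longrightarrow>
       \<xi> b - \<xi> a = (LINT x:?U|lebesgue. h x * (norm x powr (- ?n) * indicator {a<..b} (norm x)))"
    using H1r_increment[OF H R] by blast
  \<comment> \<open>Removing the radii below \<open>a0\<close> bounds the factor |x|^(-n), so that
    \<open>K\<close> is integrable and has a marginal.\<close>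
  define K where "K x = indicator ?U x *\<^sub>R h x * (norm x powr (- ?n) * indicator {a0..} (norm x))" for x
  have "integrable lebesgue K"
  proof (rule Bochner_Integration.integrable_bound)
    show "integrable lebesgue (\<lambda>x. a0 powr (- ?n) * (indicator ?U x *\<^sub>R h x))"
      using hi unfolding set_integrable_def by (rule integrable_mult_right)
    have "(\<lambda>x::real^'n. norm x powr (- ?n) * indicator {a0..} (norm x)) \<in> borel_measurable lebesgue"
      by (rule measurable_completion) measurable
    moreover have "(\<lambda>x. indicator ?U x *\<^sub>R h x) \<in> borel_measurable lebesgue"
      using hi unfolding set_integrable_def by (rule borel_measurable_integrable)
    ultimately show "K \<in> borel_measurable lebesgue"
      unfolding K_def [abs_def] by (rule borel_measurable_times[rotated])
    show "AE x in lebesgue. norm (K x) \<le> norm (a0 powr (- ?n) * (indicator ?U x *\<^sub>R h x))"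
    proof (rule AE_I2)
      fix x :: "real^'n"
      have "\<bar>norm x powr (- ?n) * indicator {a0..} (norm x)\<bar> \<le> a0 powr (- ?n)"
        using a0 by (auto simp: indicator_def intro: powr_mono2')
      then have "\<bar>norm x powr (- ?n) * indicator {a0..} (norm x)\<bar> * \<bar>indicator ?U x * h x\<bar> \<le> a0 powr (- ?n) * \<bar>indicator ?U x * h x\<bar>"
        by (rule mult_right_mono) simp
      then show "norm (K x) \<le> norm (a0 powr (- ?n) * (indicator ?U x *\<^sub>R h x))"
        by (simp add: K_def abs_mult mult_ac)
    qed
  qed
  from radial_density[OF this] obtain G where G: "integrable lborel G"
    and GK: "\<And>A. A \<in> sets borel \<Longrightarrow> (\<integral>r. indicator A r * G r \<partial>lborel) = (\<integral>x. indicator A (norm x) * K x \<partial>lebesgue)"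
    by blast
  have Gs: "set_integrable lborel A G" if "A \<in> sets borel" for A
    unfolding set_integrable_def by (rule integrable_mult_indicator) (use that G in auto)
  have Gi: "G integrable_on {a..b}" for a b
    using set_borel_integral_eq_integral(1)[OF Gs] by simp
  have inc: "\<xi> b - \<xi> a0 = integral {a0..b} G" if b: "a0 \<le> b" "b < R" for b
  proof (cases "b = a0")
    case False
    have "\<xi> b - \<xi> a0 = (LINT x:?U|lebesgue. h x * (norm x powr (- ?n) * indicator {a0<..b} (norm x)))"
      using h a0 b False by simp
    also have "\<dots> = (\<integral>x. indicator {a0<..b} (norm x) * K x \<partial>lebesgue)"
      unfolding set_lebesgue_integral_def
      by (rule Bochner_Integration.integral_cong) (auto simp: K_def indicator_def)
    also have "\<dots> = (LINT r:{a0<..b}|lborel. G r)"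
      unfolding set_lebesgue_integral_def by (subst GK[symmetric]) auto
    also have "\<dots> = integral {a0<..b} G"
      by (rule set_borel_integral_eq_integral(2)[OF Gs]) simp
    also have "\<dots> = integral {a0..b} G"
      by (rule integral_spike_set) (auto intro: negligible_subset[of "{a0}"])
    finally show ?thesis .
  qed simp
  \<comment> \<open>Increments are known for end points below R only; continuity of \<xi> on (0, R]
    adds R itself, where the boundary term of \<open>Qform\<close> lives.\<close>
  have rep: "\<xi> y = \<xi> a0 + integral {a0..y} G" if "y \<in> {a0..R}" for y
  proof -
    have cG: "continuous_on {a0..R} (\<lambda>y. integral {a0..y} G)"
      by (rule indefinite_integral_continuous_1[OF Gi])
    have cl: "closure {a0..<R} = {a0..R}" using a0 by simp
    have "continuous_on (closure {a0..<R}) (\<lambda>y. \<xi> y - integral {a0..y} G)"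
      unfolding cl by (intro continuous_on_diff c\<xi> cG)
    moreover have "\<xi> z - integral {a0..z} G = \<xi> a0" if "z \<in> {a0..<R}" for z
      using inc[of z] that by simp
    moreover have "y \<in> closure {a0..<R}" unfolding cl by fact
    ultimately have "\<xi> y - integral {a0..y} G = \<xi> a0"
      by (rule continuous_constant_on_closure)
    then show ?thesis by simp
  qed
  obtain N where N: "negligible N" and dN: "\<And>x. x \<in> {a0..R} - N \<Longrightarrow>
       ((\<lambda>u. integral {a0..u} G) has_real_derivative G x) (at x within {a0..R})"
    using integral_has_real_derivative_ae[OF Gi[of a0 R]] by blast
  \<comment> \<open>\<open>a0\<close> is excluded since there the derivative within
    \<open>{a0..R}\<close> is one-sided, while the one within \<open>{0..R}\<close> is not.\<close>
  have vd: "vector_derivative \<xi> (at y within {0..R}) = G y" if y: "y \<in> {a0..R} - insert a0 N" for y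
  proof -
    have "((\<lambda>u. \<xi> a0 + integral {a0..u} G) has_real_derivative 0 + G y) (at y within {a0..R})"
      by (intro DERIV_add dN) (use y in auto)
    then have 1: "((\<lambda>u. \<xi> a0 + integral {a0..u} G) has_real_derivative G y) (at y within {a0..R})" by simp
    have "(\<xi> has_real_derivative G y) (at y within {a0..R})"
    proof (rule has_field_derivative_transform_within[OF 1 zero_less_one])
      show "y \<in> {a0..R}" using y by simp
    qed (rule rep[symmetric])
    moreover have "at y within {a0..R} = at y within {0..R}"
      by (rule at_within_nhd[where S = "{a0<..}"]) (use y a0 in auto)
    ultimately have "(\<xi> has_vector_derivative G y) (at y within {0..R})"
      by (simp add: has_real_derivative_iff_has_vector_derivative)
    then show ?thesis
      using vector_derivative_within_cbox[of 0 R y \<xi> "G y"] y a0 by auto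
  qed
  have N': "negligible (insert a0 N)" using N by simp
  have "set_integrable lebesgue {a0..R} G"
    using Gs[of "{a0..R}"] unfolding set_integrable_def
    by (subst integrable_completion) (auto dest: borel_measurable_integrable)
  then show "(\<lambda>y. vector_derivative \<xi> (at y within {0..R})) absolutely_integrable_on {a0..R}"
    by (rule absolutely_integrable_spike[OF _ N']) (rule vd)
  have "integral {a0..R} (\<lambda>y. vector_derivative \<xi> (at y within {0..R})) = integral {a0..R} G"
    by (rule integral_spike[OF N']) (rule vd[symmetric])
  also have "\<dots> = \<xi> R - \<xi> a0" using rep[of R] a0 by simp
  finally show "integral {a0..R} (\<lambda>y. vector_derivative \<xi> (at y within {0..R})) = \<xi> R - \<xi> a0" .
qed

section \<open>Liquid stars of small relative central density\<close>

lemma has_integral_power_from_0: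
  assumes "0 \<le> r" "0 < d"
  shows "((\<lambda>y::real. y ^ (d - 1)) has_integral r ^ d / real d) {0..r}"
proof -
  have "((\<lambda>y. y ^ d / real d) has_real_derivative y ^ (d - 1)) (at y within {0..r})" for y
    using assms by (auto intro!: derivative_eq_intros)
  then have "((\<lambda>y::real. y ^ (d - 1)) has_integral r ^ d / real d - 0 ^ d / real d) {0..r}"
    using assms by (intro fundamental_theorem_of_calculus)
      (auto simp: has_real_derivative_iff_has_vector_derivative)
  then show ?thesis using assms by (simp add: zero_power)
qed

text \<open>\<open>D\<close> is the mass term, nonnegative by positivity of \<rho> alone. Hence
  \<rho>^\<gamma> decreases and 1 \<le> \<rho> \<le> \<rho>0 \<le> 2, which traps the mass between 4
  pi r^d / d and twice that. So 4 pi y / d \<le> D y \<le> 16 pi y / d: the upper bound controls the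
  potential term, the lower one the radius.\<close>

lemma liquid_star_bounds:
  assumes star: "liquid_star d \<gamma> \<rho>0 \<rho>b R" and d: "0 < d" and \<gamma>: "1 \<le> \<gamma>" "\<gamma> \<le> 2" and \<rho>02: "\<rho>0 \<le> 2"
  obtains D where "0 < R" "\<rho>b R = 1" "\<And>y. y \<in> {0..R} \<Longrightarrow> 1 \<le> \<rho>b y" "\<And>y. y \<in> {0..R} \<Longrightarrow> \<rho>b y \<le> 2"
    "continuous_on {0..R} \<rho>b" "continuous_on {0<..R} D"
    "\<And>y. y \<in> {0<..R} \<Longrightarrow> ((\<lambda>s. \<rho>b s powr \<gamma>) has_real_derivative - D y) (at y within {0..R})"
    "\<And>y. y \<in> {0<..R} \<Longrightarrow> 0 \<le> D y" "\<And>y. y \<in> {0<..R} \<Longrightarrow> D y \<le> 16 * pi / real d * y"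
    "2 * pi / real d * R\<^sup>2 \<le> \<rho>0\<^sup>2 - 1"
proof -
  obtain \<rho> Rg where "1 < \<rho>0" and prof: "LE_profile d \<gamma> \<rho>0 \<rho> Rg" and R: "0 < R" "ereal R < Rg"
    and \<rho>R: "\<rho> R = 1" and \<rho>b: "\<And>y. y \<in> {0..R} \<Longrightarrow> \<rho>b y = \<rho> y"
    using star unfolding liquid_star_def by blast
  have sol: "LE_sol d \<gamma> \<rho>0 \<rho> Rg" using prof by (simp add: LE_profile_def)
  have Rg: "ereal r < Rg" if "r \<le> R" for r
    using that R(2) by (meson ereal_less_eq(3) le_less_trans)
  have c: "continuous_on {0..R} \<rho>"
    using sol Rg by (auto simp: LE_sol_def intro: continuous_on_subset)
  have pos: "0 < \<rho> y" if "y \<in> {0..R}" for y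
    using sol Rg that by (auto simp: LE_sol_def)
  have \<rho>0: "\<rho> 0 = \<rho>0" using sol by (simp add: LE_sol_def)
  define D where "D y = \<rho> y * LE_mass d \<rho> y / y ^ (d - 1)" for y
  have deriv: "((\<lambda>s. \<rho> s powr \<gamma>) has_real_derivative - D y) (at y)" if "y \<in> {0<..R}" for y
    using sol Rg that by (auto simp: LE_sol_def D_def)
  have ci: "continuous_on {0..R} (\<lambda>y. y ^ (d - 1) * \<rho> y)"
    by (intro continuous_intros c)
  have cp: "continuous_on {0..R} (\<lambda>y. \<rho> y powr \<gamma>)"
    using pos by (intro continuous_intros c) force
  have mi: "(\<lambda>y. y ^ (d - 1) * \<rho> y) integrable_on {0..r}" if "r \<in> {0..R}" for r
    by (rule integrable_continuous_real, rule continuous_on_subset[OF ci]) (use that in auto)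
  have m0: "0 \<le> LE_mass d \<rho> r" if "r \<in> {0..R}" for r
    unfolding LE_mass_def using that pos
    by (intro mult_nonneg_nonneg Henstock_Kurzweil_Integration.integral_nonneg mi) (auto intro!: mult_nonneg_nonneg less_imp_le)
  have D0: "0 \<le> D y" if "y \<in> {0<..R}" for y
    using that m0[of y] pos[of y] by (simp add: D_def)
  have le: "1 \<le> \<rho> y" if y: "y \<in> {0..R}" for y
  proof (cases "y = R")
    case False
    have "\<rho> R powr \<gamma> \<le> \<rho> y powr \<gamma>"
    proof (rule DERIV_nonpos_imp_decreasing_open[of y R "\<lambda>s. \<rho> s powr \<gamma>"])
      fix x assume "y < x" "x < R"
      then have "x \<in> {0<..R}" using y by auto
      then show "\<exists>D'. ((\<lambda>s. \<rho> s powr \<gamma>) has_real_derivative D') (at x) \<and> D' \<le> 0"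
        using deriv[of x] D0[of x] by (intro exI[of _ "- D x"]) auto
    qed (use y in \<open>auto intro: continuous_on_subset[OF cp]\<close>)
    then have "1 \<le> \<rho> y powr \<gamma>" by (simp add: \<rho>R)
    then show ?thesis
      using powr_less_mono2[of \<gamma> "\<rho> y" 1] pos[OF y] \<gamma> by fastforce
  qed (simp add: \<rho>R)
  have ge: "\<rho> y \<le> \<rho>0" if y: "y \<in> {0..R}" for y
  proof (cases "y = 0")
    case False
    have "\<rho> y powr \<gamma> \<le> \<rho> 0 powr \<gamma>"
    proof (rule DERIV_nonpos_imp_decreasing_open[of 0 y "\<lambda>s. \<rho> s powr \<gamma>"])
      fix x assume "0 < x" "x < y"
      then have "x \<in> {0<..R}" using y by auto
      then show "\<exists>D'. ((\<lambda>s. \<rho> s powr \<gamma>) has_real_derivative D') (at x) \<and> D' \<le> 0"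
        using deriv[of x] D0[of x] by (intro exI[of _ "- D x"]) auto
    qed (use y in \<open>auto intro: continuous_on_subset[OF cp]\<close>)
    then have *: "\<rho> y powr \<gamma> \<le> \<rho>0 powr \<gamma>" by (simp add: \<rho>0)
    show ?thesis
      by (rule ccontr) (use * powr_less_mono2[of \<gamma> \<rho>0 "\<rho> y"] \<open>1 < \<rho>0\<close> \<gamma> in auto)
  qed (simp add: \<rho>0)
  have mass: "4 * pi * (r ^ d / real d) \<le> LE_mass d \<rho> r" "LE_mass d \<rho> r \<le> 4 * pi * (2 * (r ^ d / real d))"
    if r: "r \<in> {0..R}" for r
  proof -
    have i: "((\<lambda>y::real. y ^ (d - 1)) has_integral r ^ d / real d) {0..r}"
      using r d by (intro has_integral_power_from_0) auto
    have j: "((\<lambda>y. y ^ (d - 1) * \<rho> y) has_integral integral {0..r} (\<lambda>y. y ^ (d - 1) * \<rho> y)) {0..r}"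
      by (rule integrable_integral[OF mi[OF r]])
    have "r ^ d / real d \<le> integral {0..r} (\<lambda>y. y ^ (d - 1) * \<rho> y)"
    proof (rule has_integral_le[OF i j])
      fix x assume "x \<in> {0..r}"
      then show "x ^ (d - 1) \<le> x ^ (d - 1) * \<rho> x"
        using le[of x] r mult_left_mono[of 1 "\<rho> x" "x ^ (d - 1)"] by auto
    qed
    then show "4 * pi * (r ^ d / real d) \<le> LE_mass d \<rho> r"
      unfolding LE_mass_def by (rule mult_left_mono) simp
    have "integral {0..r} (\<lambda>y. y ^ (d - 1) * \<rho> y) \<le> 2 * (r ^ d / real d)"
    proof (rule has_integral_le[OF j has_integral_mult_right[OF i]])
      fix x assume "x \<in> {0..r}"
      then show "x ^ (d - 1) * \<rho> x \<le> 2 * x ^ (d - 1)"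
        using ge[of x] \<rho>02 r mult_left_mono[of "\<rho> x" 2 "x ^ (d - 1)"] by auto
    qed
    then show "LE_mass d \<rho> r \<le> 4 * pi * (2 * (r ^ d / real d))"
      unfolding LE_mass_def by (rule mult_left_mono) simp
  qed
  have pw: "r ^ d / r ^ (d - 1) = r" if "0 < r" for r :: real
    using that d by (cases d) auto
  have Dle: "D y \<le> 16 * pi / real d * y" if y: "y \<in> {0<..R}" for y
  proof -
    have "\<rho> y * LE_mass d \<rho> y \<le> 2 * (4 * pi * (2 * (y ^ d / real d)))"
      using y mass(2)[of y] ge[of y] \<rho>02 m0[of y] by (intro mult_mono) auto
    then have "D y \<le> 2 * (4 * pi * (2 * (y ^ d / real d))) / y ^ (d - 1)"
      unfolding D_def using y by (intro divide_right_mono) auto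
    also have "\<dots> = 16 * pi / real d * (y ^ d / y ^ (d - 1))" by simp
    also have "y ^ d / y ^ (d - 1) = y" using y by (intro pw) simp
    finally show ?thesis .
  qed
  have Dge: "4 * pi / real d * y \<le> D y" if y: "y \<in> {0<..R}" for y
  proof -
    have "1 * (4 * pi * (y ^ d / real d)) \<le> \<rho> y * LE_mass d \<rho> y"
      using y mass(1)[of y] le[of y] d by (intro mult_mono) auto
    then have "1 * (4 * pi * (y ^ d / real d)) / y ^ (d - 1) \<le> D y"
      unfolding D_def using y by (intro divide_right_mono) auto
    moreover have "1 * (4 * pi * (y ^ d / real d)) / y ^ (d - 1) = 4 * pi / real d * (y ^ d / y ^ (d - 1))" by simp
    moreover have "y ^ d / y ^ (d - 1) = y" using y by (intro pw) simp
    ultimately show ?thesis by (simp only:)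
  qed
  \<comment> \<open>The lower bound on \<open>D\<close> makes \<rho>^\<gamma> + (2 pi / d) s^2
    decreasing; its values at 0 and R bound R^2 by the drop of \<rho>^\<gamma>.\<close>
  have "\<rho> R powr \<gamma> + 2 * pi / real d * R\<^sup>2 \<le> \<rho> 0 powr \<gamma> + 2 * pi / real d * 0\<^sup>2"
  proof (rule DERIV_nonpos_imp_decreasing_open[of 0 R "\<lambda>s. \<rho> s powr \<gamma> + 2 * pi / real d * s\<^sup>2"])
    fix x assume "0 < x" "x < R"
    then have x: "x \<in> {0<..R}" by auto
    have "((\<lambda>s. 2 * pi / real d * s\<^sup>2) has_real_derivative 4 * pi / real d * x) (at x)"
      using d by (auto intro!: derivative_eq_intros)
    from DERIV_add[OF deriv[OF x] this]
    show "\<exists>D'. ((\<lambda>s. \<rho> s powr \<gamma> + 2 * pi / real d * s\<^sup>2) has_real_derivative D') (at x) \<and> D' \<le> 0"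
      using Dge[OF x] by (intro exI conjI) auto
    next
    show "continuous_on {0..R} (\<lambda>s. \<rho> s powr \<gamma> + 2 * pi / real d * s\<^sup>2)"
      by (intro continuous_on_add cp continuous_intros)
  qed (use R in auto)
  moreover have "\<rho>0 powr \<gamma> \<le> \<rho>0\<^sup>2"
    using powr_mono[of \<gamma> 2 \<rho>0] \<gamma> \<open>1 < \<rho>0\<close> by simp
  ultimately have R2: "2 * pi / real d * R\<^sup>2 \<le> \<rho>0\<^sup>2 - 1" by (simp add: \<rho>R \<rho>0)
  show thesis
  proof
    show "continuous_on {0..R} \<rho>b" by (rule continuous_on_eq[OF c]) (simp add: \<rho>b)
    have "continuous_on {0..R} (LE_mass d \<rho>)"
      unfolding LE_mass_def [abs_def]
      by (intro continuous_intros indefinite_integral_continuous_1 mi) (use R in auto)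
    then show "continuous_on {0<..R} D"
      unfolding D_def [abs_def]
      by (intro continuous_intros continuous_on_subset[OF c])
        (auto intro: continuous_on_subset)
    show "((\<lambda>s. \<rho>b s powr \<gamma>) has_real_derivative - D y) (at y within {0..R})" if y: "y \<in> {0<..R}" for y
    proof (rule has_field_derivative_transform_within)
      show "((\<lambda>s. \<rho> s powr \<gamma>) has_real_derivative - D y) (at y within {0..R})"
        using deriv[OF y] by (rule has_field_derivative_at_within)
    qed (use y \<rho>b in \<open>auto intro: zero_less_one\<close>)
    show "\<rho>b R = 1" using \<rho>b[of R] \<rho>R R by simp
    show "1 \<le> \<rho>b y" "\<rho>b y \<le> 2" if "y \<in> {0..R}" for y
      using \<rho>b le[of y] ge[of y] \<rho>02 that by auto
  qed (fact R D0 Dle R2)+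
qed

section \<open>A Hardy inequality and nonnegativity of the quadratic form\<close>

text \<open>The square s^(d+1) (G - c s^(-d-1))^2 is integrated, with c = X / K minimising A - 2 c X
  + c^2 K. \<open>K\<close> bounds the integral \<open>K0\<close> of s^(-d-1) from above and stays
  positive at y = R, where \<open>K0\<close> is 0.\<close>

lemma weighted_Cauchy_Schwarz:
  fixes G :: "real \<Rightarrow> real"
  assumes d: "0 < d" and y: "0 < y" "y \<le> R" and G: "G integrable_on {y..R}"
    and P: "(\<lambda>s. s ^ (d + 1) * (G s)\<^sup>2) integrable_on {y..R}"
  shows "(integral {y..R} G)\<^sup>2 \<le> 1 / (real d * y ^ d) * integral {y..R} (\<lambda>s. s ^ (d + 1) * (G s)\<^sup>2)"
proof -
  define A where "A = integral {y..R} (\<lambda>s. s ^ (d + 1) * (G s)\<^sup>2)"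
  define X where "X = integral {y..R} G"
  define K where "K = 1 / (real d * y ^ d)"
  define K0 where "K0 = K - 1 / (real d * R ^ d)"
  have K: "0 < K" using d y by (simp add: K_def)
  have K0: "K0 \<le> K" using d y by (simp add: K0_def)
  define c where "c = X / K"
  have k: "((\<lambda>s. 1 / s ^ (d + 1)) has_integral K0) {y..R}"
  proof -
    have "((\<lambda>s. 1 / s ^ (d + 1)) has_integral (- 1 / (real d * R ^ d) - (- 1 / (real d * y ^ d)))) {y..R}"
    proof (rule fundamental_theorem_of_calculus[OF y(2)])
      fix s assume s: "s \<in> {y..R}"
      obtain m where m: "d = Suc m" using d gr0_conv_Suc by auto
      have "((\<lambda>s. s ^ d) has_real_derivative real d * s ^ (d - Suc 0)) (at s within {y..R})"
        by (rule DERIV_pow)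
      from DERIV_cmult[OF DERIV_inverse_fun[OF this], of "- 1 / real d"]
      have "((\<lambda>s. - 1 / real d * inverse (s ^ d)) has_real_derivative 
         - 1 / real d * - (inverse (s ^ d) * (real d * s ^ (d - Suc 0)) * inverse (s ^ d))) (at s within {y..R})"
        using s y by (auto simp: field_simps)
      also have "- 1 / real d * - (inverse (s ^ d) * (real d * s ^ (d - Suc 0)) * inverse (s ^ d)) = 1 / s ^ (d + 1)"
      proof -
        have "- 1 / u * - (v * (u * w) * v) = v * w * v" if "u \<noteq> 0" for u v w :: real
          using that by simp
        then have "- 1 / real d * - (inverse (s ^ d) * (real d * s ^ (d - Suc 0)) * inverse (s ^ d)) = 
            inverse (s ^ d) * s ^ (d - Suc 0) * inverse (s ^ d)" using d by simp
        also have "\<dots> = 1 / s ^ (d + 1)" using s y unfolding m by (simp add: field_simps)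
        finally show ?thesis .
      qed
      finally have "((\<lambda>s. - 1 / (real d * s ^ d)) has_real_derivative 1 / s ^ (d + 1)) (at s within {y..R})"
        by (simp add: field_simps)
      then show "((\<lambda>s. - 1 / (real d * s ^ d)) has_vector_derivative 1 / s ^ (d + 1)) (at s within {y..R})"
        by (simp add: has_real_derivative_iff_has_vector_derivative)
    qed
    then show ?thesis by (simp add: K0_def K_def)
  qed
  have "((\<lambda>s. s ^ (d + 1) * (G s)\<^sup>2 - 2 * c * G s + c\<^sup>2 * (1 / s ^ (d + 1))) has_integral A - 2 * c * X + c\<^sup>2 * K0) {y..R}"
    unfolding A_def X_def by (intro has_integral_add has_integral_diff has_integral_mult_right integrable_integral k P G)
  then have "0 \<le> A - 2 * c * X + c\<^sup>2 * K0"
  proof (rule has_integral_nonneg)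
    fix s assume s: "s \<in> {y..R}"
    have "s ^ (d + 1) * (G s)\<^sup>2 - 2 * c * G s + c\<^sup>2 * (1 / s ^ (d + 1)) = s ^ (d + 1) * (G s - c / s ^ (d + 1))\<^sup>2"
      using s y by (simp add: field_simps power2_eq_square)
    also have "0 \<le> \<dots>" using s y by simp
    finally show "0 \<le> s ^ (d + 1) * (G s)\<^sup>2 - 2 * c * G s + c\<^sup>2 * (1 / s ^ (d + 1))" .
  qed
  also have "\<dots> \<le> A - 2 * c * X + c\<^sup>2 * K" using K0 by (simp add: mult_left_mono)
  also have "\<dots> = A - X\<^sup>2 / K" using K by (simp add: c_def power2_eq_square field_simps)
  finally have "X\<^sup>2 / K \<le> A" by simp
  then show ?thesis using K unfolding A_def X_def K_def[symmetric] by (simp add: field_simps)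
qed

lemma Hardy_pointwise:
  fixes G \<xi> :: "real \<Rightarrow> real"
  assumes d: "0 < d" and y: "0 < y" "y \<le> R" and G: "G integrable_on {y..R}"
    and P: "(\<lambda>s. s ^ (d + 1) * (G s)\<^sup>2) integrable_on {y..R}"
    and \<xi>: "\<xi> R - \<xi> y = integral {y..R} G"
  shows "(\<xi> y)\<^sup>2 \<le> 2 * (\<xi> R)\<^sup>2 + 2 / (real d * y ^ d) * integral {y..R} (\<lambda>s. s ^ (d + 1) * (G s)\<^sup>2)"
proof -
  have "(\<xi> y)\<^sup>2 \<le> 2 * (\<xi> R)\<^sup>2 + 2 * (\<xi> R - \<xi> y)\<^sup>2"
    using zero_le_power2[of "2 * \<xi> R - \<xi> y"] by (simp add: power2_diff power2_sum power_mult_distrib algebra_simps)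
  also have "(\<xi> R - \<xi> y)\<^sup>2 \<le> 1 / (real d * y ^ d) * integral {y..R} (\<lambda>s. s ^ (d + 1) * (G s)\<^sup>2)"
    unfolding \<xi> by (rule weighted_Cauchy_Schwarz[OF d y G P])
  finally show ?thesis by simp
qed

text \<open>The pointwise bound times y^(d+1) leaves the integrable weight y in front of the energy.
  The constants do not involve \<open>a\<close>, and the gain R^2 is what smallness of the star
  exploits.\<close>

lemma Hardy_truncated:
  fixes G \<xi> :: "real \<Rightarrow> real"
  assumes d: "0 < d" and a: "0 < a" "a \<le> R" and G: "G integrable_on {a..R}"
    and P: "(\<lambda>s. s ^ (d + 1) * (G s)\<^sup>2) integrable_on {a..R}"
    and \<xi>: "\<And>y. y \<in> {a..R} \<Longrightarrow> \<xi> R - \<xi> y = integral {y..R} G"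
    and c\<xi>: "continuous_on {a..R} \<xi>"
  shows "integral {a..R} (\<lambda>y. y ^ (d + 1) * (\<xi> y)\<^sup>2) \<le>
     R\<^sup>2 / real d * integral {a..R} (\<lambda>s. s ^ (d + 1) * (G s)\<^sup>2) + 2 * R ^ (d + 2) / (real d + 2) * (\<xi> R)\<^sup>2"
proof -
  define A where "A = integral {a..R} (\<lambda>s. s ^ (d + 1) * (G s)\<^sup>2)"
  have A0: "0 \<le> A" unfolding A_def using a by (intro Henstock_Kurzweil_Integration.integral_nonneg P) auto
  have i: "((\<lambda>y. y ^ (d + 1) * (\<xi> y)\<^sup>2) has_integral integral {a..R} (\<lambda>y. y ^ (d + 1) * (\<xi> y)\<^sup>2)) {a..R}"
    by (intro integrable_integral integrable_continuous_real continuous_intros c\<xi>)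
  let ?F = "\<lambda>y. 2 * (\<xi> R)\<^sup>2 / (real d + 2) * y ^ (d + 2) + A / real d * y\<^sup>2"
  have j: "((\<lambda>y. 2 * (\<xi> R)\<^sup>2 * y ^ (d + 1) + 2 * A / real d * y) has_integral ?F R - ?F a) {a..R}"
  proof (rule fundamental_theorem_of_calculus[OF a(2)])
    fix s assume "s \<in> {a..R}"
    have 1: "((\<lambda>y. y ^ (d + 2)) has_real_derivative (real d + 2) * s ^ (d + 1)) (at s within {a..R})"
      by (rule DERIV_cong[OF DERIV_pow]) simp
    have 2: "((\<lambda>y. y\<^sup>2) has_real_derivative 2 * s) (at s within {a..R})"
      by (auto intro!: derivative_eq_intros)
    have "(?F has_real_derivative 2 * (\<xi> R)\<^sup>2 / (real d + 2) * ((real d + 2) * s ^ (d + 1)) + A / real d * (2 * s)) (at s within {a..R})"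
      by (intro DERIV_add DERIV_cmult 1 2)
    also have "2 * (\<xi> R)\<^sup>2 / (real d + 2) * ((real d + 2) * s ^ (d + 1)) + A / real d * (2 * s) = 2 * (\<xi> R)\<^sup>2 * s ^ (d + 1) + 2 * A / real d * s"
    proof -
      have "u / v * (v * w) = u * w" if "v \<noteq> 0" for u v w :: real using that by simp
      from this[of "real d + 2"] show ?thesis by simp
    qed
    finally show "(?F has_vector_derivative 2 * (\<xi> R)\<^sup>2 * s ^ (d + 1) + 2 * A / real d * s) (at s within {a..R})"
      by (simp add: has_real_derivative_iff_has_vector_derivative)
  qed
  have "integral {a..R} (\<lambda>y. y ^ (d + 1) * (\<xi> y)\<^sup>2) \<le> ?F R - ?F a"
  proof (rule has_integral_le[OF i j])
    fix y assume y: "y \<in> {a..R}"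
    have sub: "{y..R} \<subseteq> {a..R}" using y by auto
    have Py: "(\<lambda>s. s ^ (d + 1) * (G s)\<^sup>2) integrable_on {y..R}"
      by (rule integrable_on_subinterval[OF P sub])
    have Ay: "integral {y..R} (\<lambda>s. s ^ (d + 1) * (G s)\<^sup>2) \<le> A"
      unfolding A_def using y a by (intro integral_subset_le sub Py P) auto
    have "(\<xi> y)\<^sup>2 \<le> 2 * (\<xi> R)\<^sup>2 + 2 / (real d * y ^ d) * integral {y..R} (\<lambda>s. s ^ (d + 1) * (G s)\<^sup>2)"
      by (rule Hardy_pointwise) (use y a d Py \<xi> integrable_on_subinterval[OF G sub] in auto)
    also have "\<dots> \<le> 2 * (\<xi> R)\<^sup>2 + 2 / (real d * y ^ d) * A"
      using Ay y a by (intro add_left_mono mult_left_mono) auto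
    finally have "y ^ (d + 1) * (\<xi> y)\<^sup>2 \<le> y ^ (d + 1) * (2 * (\<xi> R)\<^sup>2 + 2 / (real d * y ^ d) * A)"
      using y a by (intro mult_left_mono) auto
    also have "\<dots> = 2 * (\<xi> R)\<^sup>2 * y ^ (d + 1) + 2 * A / real d * y"
      using y a d by (simp add: field_simps)
    finally show "y ^ (d + 1) * (\<xi> y)\<^sup>2 \<le> 2 * (\<xi> R)\<^sup>2 * y ^ (d + 1) + 2 * A / real d * y" .
  qed
  also have "0 \<le> ?F a"
    using a A0 by (intro add_nonneg_nonneg mult_nonneg_nonneg divide_nonneg_nonneg) auto
  then have "?F R - ?F a \<le> ?F R" by linarith
  also have "?F R = R\<^sup>2 / real d * A + 2 * R ^ (d + 2) / (real d + 2) * (\<xi> R)\<^sup>2" by (simp add: mult_ac)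
  finally show ?thesis by (simp only: A_def)
qed

text \<open>This is nonnegativity of the form on \<open>[a, R]\<close>, with \<open>G\<close> in the
  place of \<xi>' and -D for the derivative of \<rho>^\<gamma>; it serves both arbitrary \<xi> and
  growing modes. The factor \<kappa> C R^2 \<le> 1 absorbs the R^2 of the Hardy inequality; the rest
  is 1/d \<le> 1 and 2/(d + 2) \<le> 1 \<le> d \<gamma>.\<close>

lemma truncated_energy_bound:
  fixes G \<xi> \<rho> D :: "real \<Rightarrow> real"
  assumes d: "0 < d" and a: "0 < a" "a \<le> R" and \<gamma>: "1 \<le> \<gamma>" and \<kappa>: "0 \<le> \<kappa>"
    and small: "\<kappa> * C * R\<^sup>2 \<le> 1"
    and \<rho>: "\<And>y. y \<in> {a..R} \<Longrightarrow> 1 \<le> \<rho> y"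
    and D: "\<And>y. y \<in> {a..R} \<Longrightarrow> D y \<le> C * y" "continuous_on {a..R} D"
    and G: "G integrable_on {a..R}"
    and P: "(\<lambda>s. s ^ (d + 1) * (G s)\<^sup>2) integrable_on {a..R}"
    and \<rho>P: "(\<lambda>s. \<gamma> * \<rho> s powr \<gamma> * s ^ (d + 1) * (G s)\<^sup>2) integrable_on {a..R}"
    and \<xi>: "\<And>y. y \<in> {a..R} \<Longrightarrow> \<xi> R - \<xi> y = integral {y..R} G"
    and c\<xi>: "continuous_on {a..R} \<xi>"
  shows "integral {a..R} (\<lambda>y. \<kappa> * y ^ d * (\<xi> y)\<^sup>2 * D y) \<le>
     integral {a..R} (\<lambda>s. \<gamma> * \<rho> s powr \<gamma> * s ^ (d + 1) * (G s)\<^sup>2) + real d * \<gamma> * R ^ d * (\<xi> R)\<^sup>2"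
proof -
  let ?A = "integral {a..R} (\<lambda>s. s ^ (d + 1) * (G s)\<^sup>2)"
  have A0: "0 \<le> ?A" using a by (intro Henstock_Kurzweil_Integration.integral_nonneg P) auto
  have R: "0 < R" using a by simp
  have small': "\<kappa> * C * R\<^sup>2 * X \<le> 1 * X" if "0 \<le> X" for X
    using small that by (rule mult_right_mono)
  have "integral {a..R} (\<lambda>y. \<kappa> * y ^ d * (\<xi> y)\<^sup>2 * D y) \<le> integral {a..R} (\<lambda>y. \<kappa> * C * (y ^ (d + 1) * (\<xi> y)\<^sup>2))"
  proof (rule integral_le)
    show "(\<lambda>y. \<kappa> * y ^ d * (\<xi> y)\<^sup>2 * D y) integrable_on {a..R}"
      by (intro integrable_continuous_real continuous_intros c\<xi> D)
    show "(\<lambda>y. \<kappa> * C * (y ^ (d + 1) * (\<xi> y)\<^sup>2)) integrable_on {a..R}"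
      by (intro integrable_continuous_real continuous_intros c\<xi>)
    fix y assume y: "y \<in> {a..R}"
    have "\<kappa> * y ^ d * (\<xi> y)\<^sup>2 * D y \<le> \<kappa> * y ^ d * (\<xi> y)\<^sup>2 * (C * y)"
      using D y a \<kappa> by (intro mult_left_mono) auto
    then show "\<kappa> * y ^ d * (\<xi> y)\<^sup>2 * D y \<le> \<kappa> * C * (y ^ (d + 1) * (\<xi> y)\<^sup>2)"
      by (simp add: mult_ac)
  qed
  also have "\<dots> = \<kappa> * C * integral {a..R} (\<lambda>y. y ^ (d + 1) * (\<xi> y)\<^sup>2)" by simp
  also have "\<dots> \<le> 1 * (?A / real d + 2 * R ^ d / (real d + 2) * (\<xi> R)\<^sup>2)"
  proof (cases "0 \<le> C")
    case True
    have "\<kappa> * C * integral {a..R} (\<lambda>y. y ^ (d + 1) * (\<xi> y)\<^sup>2) \<le>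
        \<kappa> * C * (R\<^sup>2 / real d * ?A + 2 * R ^ (d + 2) / (real d + 2) * (\<xi> R)\<^sup>2)"
      using True \<kappa> by (intro mult_left_mono Hardy_truncated d a G P \<xi> c\<xi>) auto
    also have "\<dots> = \<kappa> * C * R\<^sup>2 * (?A / real d + 2 * R ^ d / (real d + 2) * (\<xi> R)\<^sup>2)"
      by (simp add: power_add power2_eq_square algebra_simps)
    also have "\<dots> \<le> 1 * (?A / real d + 2 * R ^ d / (real d + 2) * (\<xi> R)\<^sup>2)"
      using A0 R by (intro small') auto
    finally show ?thesis .
  next
    \<comment> \<open>For negative \<open>C\<close> the Hardy inequality cannot be multiplied by
      \<kappa> C, but then the left-hand side is nonpositive.\<close>
    case False
    have "0 \<le> integral {a..R} (\<lambda>y. y ^ (d + 1) * (\<xi> y)\<^sup>2)"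
      using a by (intro Henstock_Kurzweil_Integration.integral_nonneg integrable_continuous_real continuous_intros c\<xi>) auto
    then have "\<kappa> * C * integral {a..R} (\<lambda>y. y ^ (d + 1) * (\<xi> y)\<^sup>2) \<le> 0"
      using False \<kappa> by (intro mult_nonpos_nonneg mult_nonneg_nonpos) auto
    also have "\<dots> \<le> 1 * (?A / real d + 2 * R ^ d / (real d + 2) * (\<xi> R)\<^sup>2)" using A0 R by simp
    finally show ?thesis .
  qed
  also have "\<dots> \<le> ?A + real d * \<gamma> * R ^ d * (\<xi> R)\<^sup>2"
  proof -
    have "?A / real d \<le> ?A" using A0 d divide_left_mono[of 1 "real d" ?A] by simp
    moreover have "2 * R ^ d / (real d + 2) * (\<xi> R)\<^sup>2 \<le> real d * \<gamma> * R ^ d * (\<xi> R)\<^sup>2"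
    proof (rule mult_right_mono)
      have "2 / (real d + 2) \<le> 1" using d by simp
      also have "1 \<le> real d * \<gamma>" using d \<gamma> mult_mono[of 1 "real d" 1 \<gamma>] by simp
      finally have "2 / (real d + 2) * R ^ d \<le> real d * \<gamma> * R ^ d" using R by (intro mult_right_mono) auto
      then show "2 * R ^ d / (real d + 2) \<le> real d * \<gamma> * R ^ d" by simp
    qed simp
    ultimately show ?thesis by simp
  qed
  also have "?A \<le> integral {a..R} (\<lambda>s. \<gamma> * \<rho> s powr \<gamma> * s ^ (d + 1) * (G s)\<^sup>2)"
  proof (rule integral_le[OF P \<rho>P])
    fix s assume s: "s \<in> {a..R}"
    have "1 \<le> \<rho> s powr \<gamma>" using \<rho>[OF s] \<gamma> by (intro ge_one_powr_ge_zero) auto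
    then have "1 * 1 \<le> \<gamma> * \<rho> s powr \<gamma>" using \<gamma> by (intro mult_mono) auto
    then have "1 * (s ^ (d + 1) * (G s)\<^sup>2) \<le> (\<gamma> * \<rho> s powr \<gamma>) * (s ^ (d + 1) * (G s)\<^sup>2)"
      using s a by (intro mult_right_mono) auto
    then show "s ^ (d + 1) * (G s)\<^sup>2 \<le> \<gamma> * \<rho> s powr \<gamma> * s ^ (d + 1) * (G s)\<^sup>2" by (simp add: mult.assoc)
  qed
  finally show ?thesis by simp
qed

text \<open>Each truncated integral over \<open>[a, R]\<close> is at least minus the boundary term,
  and an indefinite integral is continuous in its lower limit, so the bound passes to a = 0.\<close>

lemma Qform_nonneg:
  assumes H: "H1r TYPE('n::finite) R \<xi>" and R: "0 < R" 
    and d: "0 < d" and \<gamma>: "1 \<le> \<gamma>" and \<kappa>: "0 \<le> 2 * (real d - 1) - real d * \<gamma>"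
    and small: "(2 * (real d - 1) - real d * \<gamma>) * C * R\<^sup>2 \<le> 1"
    and \<rho>: "\<And>y. y \<in> {0..R} \<Longrightarrow> 1 \<le> \<rho>b y" "continuous_on {0..R} \<rho>b"
    and D: "continuous_on {0<..R} D" "\<And>y. y \<in> {0<..R} \<Longrightarrow> D y \<le> C * y"
    and D\<rho>: "\<And>y. y \<in> {0<..R} \<Longrightarrow> ((\<lambda>s. \<rho>b s powr \<gamma>) has_real_derivative - D y) (at y within {0..R})"
  shows "0 \<le> Qform d \<gamma> \<rho>b R \<xi>"
proof -
  define \<kappa> where "\<kappa> = 2 * (real d - 1) - real d * \<gamma>"
  let ?G = "\<lambda>y. vector_derivative \<xi> (at y within {0..R})"
  let ?I = "\<lambda>y. \<gamma> * \<rho>b y powr \<gamma> * y ^ (d + 1) * (?G y)\<^sup>2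
        + \<kappa> * y ^ d * (\<xi> y)\<^sup>2 * vector_derivative (\<lambda>s. \<rho>b s powr \<gamma>) (at y within {0..R})"
  let ?b = "real d * \<gamma> * R ^ d * (\<xi> R)\<^sup>2"
  have b0: "0 \<le> ?b" using R \<gamma> by simp
  have Q: "Qform d \<gamma> \<rho>b R \<xi> = integral {0..R} ?I + ?b"
    by (simp add: Qform_def \<kappa>_def)
  show ?thesis
  proof (cases "?I integrable_on {0..R}")
    case False
    then show ?thesis using b0 by (simp add: Q not_integrable_integral)
  next
    case I: True
    have trunc: "- ?b \<le> integral {a..R} ?I" if a: "0 < a" "a < R" for a
    proof -
      have G: "?G absolutely_integrable_on {a..R}" by (rule H1r_absolutely_continuous[OF H a])
      have c\<xi>: "continuous_on {a..R} \<xi>"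
        using H a by (auto simp: H1r_def intro: continuous_on_subset)
      have cD: "continuous_on {a..R} D" by (rule continuous_on_subset[OF D(1)]) (use a in auto)
      let ?B = "\<lambda>y. \<kappa> * y ^ d * (\<xi> y)\<^sup>2 * D y"
      let ?A = "\<lambda>y. \<gamma> * \<rho>b y powr \<gamma> * y ^ (d + 1) * (?G y)\<^sup>2"
      have B: "?B integrable_on {a..R}"
        by (intro integrable_continuous_real continuous_intros c\<xi> cD)
      have Ia: "?I integrable_on {a..R}" by (rule integrable_on_subinterval[OF I]) (use a in auto)
      have vd: "vector_derivative (\<lambda>s. \<rho>b s powr \<gamma>) (at y within {0..R}) = - D y" if "y \<in> {a..R}" for y
        by (rule vector_derivative_within_cbox[of 0 R, simplified])
          (use that a D\<rho>[of y] in \<open>auto simp: has_real_derivative_iff_has_vector_derivative\<close>)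
      have eq: "?I y = ?A y - ?B y" if "y \<in> {a..R}" for y
        unfolding vd[OF that] by simp
      have "(\<lambda>y. ?I y + ?B y) integrable_on {a..R}" by (intro integrable_add Ia B)
      \<comment> \<open>So far \<xi>' is only known to be integrable. Adding the continuous
        potential term back to the integrable \<open>?I\<close> isolates the energy density
        \<open>?A\<close>; since \<gamma> \<rho>^\<gamma> \<ge> 1, it dominates the density without
        this factor.\<close>
      then have A: "?A integrable_on {a..R}"
      proof (rule integrable_eq)
        fix y assume "y \<in> {a..R}"
        from eq[OF this] show "?I y + ?B y = ?A y" by linarith
      qed
      have P: "(\<lambda>s. s ^ (d + 1) * (?G s)\<^sup>2) integrable_on {a..R}"
      proof (rule measurable_bounded_by_integrable_imp_integrable[OF _ A])
        have Gm: "?G \<in> borel_measurable (lebesgue_on {a..R})"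
          by (rule absolutely_integrable_measurable[THEN iffD1, THEN conjunct1]) (use G in auto)
        have pm: "(\<lambda>s. s ^ (d + 1)) \<in> borel_measurable (lebesgue_on {a..R})"
          by (intro continuous_imp_measurable_on_sets_lebesgue continuous_intros) auto
        show "(\<lambda>s. s ^ (d + 1) * (?G s)\<^sup>2) \<in> borel_measurable (lebesgue_on {a..R})"
          by (rule borel_measurable_times[OF pm borel_measurable_power[OF Gm]])
        fix s assume s: "s \<in> {a..R}"
        have "1 \<le> \<rho>b s powr \<gamma>" using \<rho>(1)[of s] s a \<gamma> by (intro ge_one_powr_ge_zero) auto
        then have "1 * 1 \<le> \<gamma> * \<rho>b s powr \<gamma>" using \<gamma> by (intro mult_mono) auto
        then have "1 * (s ^ (d + 1) * (?G s)\<^sup>2) \<le> (\<gamma> * \<rho>b s powr \<gamma>) * (s ^ (d + 1) * (?G s)\<^sup>2)"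
          using s a by (intro mult_right_mono) auto
        moreover have "0 \<le> s ^ (d + 1) * (?G s)\<^sup>2" using s a by simp
        ultimately show "norm (s ^ (d + 1) * (?G s)\<^sup>2) \<le> ?A s" by (simp add: mult.assoc)
      qed auto
      have inc: "\<xi> R - \<xi> y = integral {y..R} ?G" if "y \<in> {a..R}" for y
        using H1r_absolutely_continuous(2)[OF H, of y] that a by (cases "y = R") auto
      have "integral {a..R} ?B \<le> integral {a..R} ?A + ?b"
        by (rule truncated_energy_bound[where C = C])
          (use a d \<gamma> \<kappa> small \<rho> D cD G P A inc c\<xi> in \<open>auto simp: \<kappa>_def absolutely_integrable_on_def\<close>)
      moreover have "integral {a..R} ?I = integral {a..R} ?A - integral {a..R} ?B"
        using Henstock_Kurzweil_Integration.integral_diff[OF A B] 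
          Henstock_Kurzweil_Integration.integral_cong[of "{a..R}" ?I "\<lambda>y. ?A y - ?B y", OF eq] by simp
      ultimately show ?thesis by linarith
    qed
    have "continuous_on {0..R} (\<lambda>x. integral {x..R} ?I)"
      by (rule indefinite_integral_continuous_1'[OF I])
    then have "((\<lambda>x. integral {x..R} ?I) \<longlongrightarrow> integral {0..R} ?I) (at 0 within {0..R})"
      using R by (auto simp: continuous_on_def)
    then have "((\<lambda>x. integral {x..R} ?I) \<longlongrightarrow> integral {0..R} ?I) (at_right 0)"
      using R by (simp add: at_within_Icc_at_right)
    moreover have "eventually (\<lambda>x. - ?b \<le> integral {x..R} ?I) (at_right 0)"
      using trunc R by (auto simp: eventually_at_right_field)
    ultimately have "- ?b \<le> integral {0..R} ?I"
      by (intro tendsto_lowerbound) auto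
    then show ?thesis unfolding Q by simp
  qed
qed

section \<open>Growing modes\<close>

text \<open>Young's inequality |\<xi>| \<le> (\<tau> + \<xi>^2 / \<tau>) / 2 replaces
  Cauchy-Schwarz, and \<tau> = sqrt (N / b^(d+2)) makes the two contributions equal.
  \<open>N\<close> strictly exceeds the integral, so \<tau> is positive even if the integral is 0.
  The bound is uniform in \<open>a\<close>: the flux hardly varies near the centre.\<close>

lemma flux_increment_bound:
  fixes w \<xi> q :: "real \<Rightarrow> real"
  assumes b: "0 < a" "a \<le> b" "b \<le> R" and M: "0 \<le> M"
    and w: "\<And>y. y \<in> {0<..R} \<Longrightarrow> (w has_real_derivative q y * \<xi> y) (at y within {0<..R})"
    and q: "\<And>y. y \<in> {0<..R} \<Longrightarrow> \<bar>q y\<bar> \<le> M * y ^ (d + 1)"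
    and J: "(\<lambda>y. y ^ (d + 1) * (\<xi> y)\<^sup>2) integrable_on {0..R}"
    and N: "integral {0..R} (\<lambda>y. y ^ (d + 1) * (\<xi> y)\<^sup>2) < N"
  shows "\<bar>w b - w a\<bar> \<le> M * sqrt (N * b ^ (d + 2))"
proof -
  let ?J = "\<lambda>y. y ^ (d + 1) * (\<xi> y)\<^sup>2"
  have N0: "0 < N" using N Henstock_Kurzweil_Integration.integral_nonneg[OF J] by fastforce
  define \<tau> where "\<tau> = sqrt (N / b ^ (d + 2))"
  have \<tau>: "0 < \<tau>" using N0 b by (simp add: \<tau>_def)
  have Ja: "?J integrable_on {a..b}" by (rule integrable_on_subinterval[OF J]) (use b in auto)
  have J_le: "integral {a..b} ?J \<le> N"
    using integral_subset_le[OF _ Ja J] b N by fastforce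
  have i: "((\<lambda>y. q y * \<xi> y) has_integral w b - w a) {a..b}"
  proof (rule fundamental_theorem_of_calculus[OF b(2)])
    fix y assume "y \<in> {a..b}"
    then show "(w has_vector_derivative q y * \<xi> y) (at y within {a..b})"
      unfolding has_real_derivative_iff_has_vector_derivative[symmetric]
      using b by (intro has_field_derivative_subset[OF w]) auto
  qed
  have j: "((\<lambda>y. M / 2 * (\<tau> * b ^ (d + 1) + ?J y / \<tau>)) has_integral
      M / 2 * (\<tau> * b ^ (d + 1) * (b - a) + integral {a..b} ?J / \<tau>)) {a..b}"
    by (intro has_integral_mult_right has_integral_add has_integral_divide integrable_integral Ja)
      (use has_integral_const_real[of "\<tau> * b ^ (d + 1)" a b] b in \<open>simp add: mult.commute\<close>)
  have "norm (w b - w a) \<le> (M / 2 * (\<tau> * b ^ (d + 1) * (b - a) + integral {a..b} ?J / \<tau>)) \<bullet> 1"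
  proof (rule has_integral_norm_bound_integral_component[OF i j])
    fix y assume y: "y \<in> {a..b}"
    have "\<bar>q y * \<xi> y\<bar> \<le> M * y ^ (d + 1) * \<bar>\<xi> y\<bar>"
      unfolding abs_mult using y b q[of y] by (intro mult_right_mono) auto
    also have "\<dots> = M * (y ^ (d + 1) * \<bar>\<xi> y\<bar>)" by simp
    also have "\<dots> \<le> M * (1 / 2 * (\<tau> * y ^ (d + 1) + ?J y / \<tau>))"
    proof (rule mult_left_mono[OF _ M])
      have "0 \<le> (\<tau> - \<bar>\<xi> y\<bar>)\<^sup>2" by simp
      then have "2 * \<tau> * \<bar>\<xi> y\<bar> \<le> \<tau>\<^sup>2 + (\<xi> y)\<^sup>2" by (simp add: power2_diff)
      then have "2 * \<tau> * \<bar>\<xi> y\<bar> / (2 * \<tau>) \<le> (\<tau>\<^sup>2 + (\<xi> y)\<^sup>2) / (2 * \<tau>)"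
        using \<tau> by (intro divide_right_mono) auto
      then have "\<bar>\<xi> y\<bar> \<le> 1 / 2 * (\<tau> + (\<xi> y)\<^sup>2 / \<tau>)"
        using \<tau> by (simp add: power2_eq_square add_divide_distrib)
      then have "y ^ (d + 1) * \<bar>\<xi> y\<bar> \<le> y ^ (d + 1) * (1 / 2 * (\<tau> + (\<xi> y)\<^sup>2 / \<tau>))"
        using y b by (intro mult_left_mono) auto
      then show "y ^ (d + 1) * \<bar>\<xi> y\<bar> \<le> 1 / 2 * (\<tau> * y ^ (d + 1) + ?J y / \<tau>)"
        by (simp add: algebra_simps)
    qed
    also have "\<dots> \<le> M * (1 / 2 * (\<tau> * b ^ (d + 1) + ?J y / \<tau>))"
      using \<tau> y b M by (intro mult_left_mono add_right_mono power_mono) auto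
    finally show "norm (q y * \<xi> y) \<le> (M / 2 * (\<tau> * b ^ (d + 1) + ?J y / \<tau>)) \<bullet> 1" by simp
  qed
  also have "(M / 2 * (\<tau> * b ^ (d + 1) * (b - a) + integral {a..b} ?J / \<tau>)) \<bullet> 1
     \<le> M / 2 * (\<tau> * b ^ (d + 1) * b + N / \<tau>)"
  proof -
    have "\<tau> * b ^ (d + 1) * (b - a) \<le> \<tau> * b ^ (d + 1) * b"
      using \<tau> b by (intro mult_left_mono) auto
    moreover have "integral {a..b} ?J / \<tau> \<le> N / \<tau>" using J_le \<tau> by (intro divide_right_mono) auto
    ultimately have "\<tau> * b ^ (d + 1) * (b - a) + integral {a..b} ?J / \<tau> \<le> \<tau> * b ^ (d + 1) * b + N / \<tau>"
      by (rule add_mono)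
    from mult_left_mono[OF this, of "M / 2"] M show ?thesis by simp
  qed
  also have "\<tau> * b ^ (d + 1) * b = sqrt (N * b ^ (d + 2))"
  proof -
    define B where "B = b ^ (d + 2)"
    have B: "0 < B" using b by (simp add: B_def)
    have "\<tau> * b ^ (d + 1) * b = sqrt N / sqrt B * (sqrt B * sqrt B)"
      using B by (simp add: \<tau>_def B_def real_sqrt_divide mult.commute)
    also have "\<dots> = sqrt N * sqrt B"
    proof -
      have "u / v * (v * v) = u * v" if "v \<noteq> 0" for u v :: real using that by simp
      from this[of "sqrt B" "sqrt N"] show ?thesis using B by simp
    qed
    also have "\<dots> = sqrt (N * B)" by (simp add: real_sqrt_mult)
    finally show ?thesis by (simp only: B_def)
  qed
  also have "N / \<tau> = sqrt (N * b ^ (d + 2))"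
  proof -
    define B where "B = b ^ (d + 2)"
    have B: "0 < B" using b by (simp add: B_def)
    have "N / \<tau> = sqrt N * sqrt N / (sqrt N / sqrt B)"
      using N0 by (simp add: \<tau>_def B_def real_sqrt_divide)
    also have "\<dots> = sqrt N * sqrt B"
    proof -
      have "u * u / (u / v) = u * v" if "u \<noteq> 0" for u v :: real using that by simp
      from this[of "sqrt N" "sqrt B"] show ?thesis using N0 by simp
    qed
    also have "\<dots> = sqrt (N * B)" by (simp add: real_sqrt_mult)
    finally show ?thesis by (simp only: B_def)
  qed
  finally show ?thesis by simp
qed

text \<open>A flux bounded away from \<open>0\<close> near the centre would force the growth \<open>y\<^sup>-\<^sup>d\<close> of \<open>\<xi>\<close>, which is
  not square integrable in dimension \<open>d + 2\<close>.\<close>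
lemma flux_not_bounded_below:
  fixes \<xi> \<xi>1 :: "real \<Rightarrow> real"
  assumes d: "2 \<le> d" and b: "0 < b" "b \<le> R" and c: "0 < c"
    and \<xi>: "\<And>y. y \<in> {0<..R} \<Longrightarrow> (\<xi> has_real_derivative \<xi>1 y) (at y within {0<..R})"
    and \<xi>1: "\<And>y. y \<in> {0<..b} \<Longrightarrow> c / y ^ (d + 1) \<le> \<xi>1 y"
    and J: "(\<lambda>y. y ^ (d + 1) * (\<xi> y)\<^sup>2) integrable_on {0..R}"
  shows False
proof -
  let ?J = "\<lambda>y. y ^ (d + 1) * (\<xi> y)\<^sup>2"
  define c4 where "c4 = c / real d"
  have c4: "0 < c4" using c d by (simp add: c4_def)
  \<comment> \<open>\<open>K\<close> is the value at \<open>b\<close> of \<xi> + (c/d) y^(-d), which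
    is nondecreasing on (0, b] because its derivative is \<xi>1 - c / y^(d+1).\<close>
  define K where "K = \<xi> b + c4 / b ^ d"
  have mono: "\<xi> a + c4 / a ^ d \<le> K" if a: "a \<in> {0<..b}" for a
  proof (cases "a = b")
    case False
    have der: "((\<lambda>s. \<xi> s + c4 / s ^ d) has_real_derivative \<xi>1 y - c / y ^ (d + 1)) (at y within {0<..R})"
      if y: "y \<in> {0<..R}" for y
    proof -
      have y0: "0 < y" using y by simp
      obtain m where m: "d = Suc m" using d by (cases d) auto
      have "((\<lambda>s. s ^ d) has_real_derivative real d * y ^ (d - Suc 0)) (at y within {0<..R})"
        by (rule DERIV_pow)
      from DERIV_cmult[OF DERIV_inverse_fun[OF this], of c4]
      have "((\<lambda>s. c4 * inverse (s ^ d)) has_real_derivative 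
         c4 * - (inverse (y ^ d) * (real d * y ^ (d - Suc 0)) * inverse (y ^ d))) (at y within {0<..R})"
        using y0 by (simp add: mult_ac)
      also have "c4 * - (inverse (y ^ d) * (real d * y ^ (d - Suc 0)) * inverse (y ^ d)) = 
         - (c4 * real d) * (inverse (y ^ d) * y ^ (d - Suc 0) * inverse (y ^ d))" by simp
      also have "\<dots> = - c * (inverse (y ^ d) * y ^ (d - Suc 0) * inverse (y ^ d))"
        using d by (simp add: c4_def)
      also have "inverse (y ^ d) * y ^ (d - Suc 0) * inverse (y ^ d) = 1 / y ^ (d + 1)"
        using y0 unfolding m by (simp add: field_simps)
      finally have "((\<lambda>s. c4 / s ^ d) has_real_derivative - c / y ^ (d + 1)) (at y within {0<..R})"
        by (simp add: divide_inverse)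
      from DERIV_add[OF \<xi>[OF y] this] show ?thesis by simp
    qed
    have "- K \<le> - (\<xi> a + c4 / a ^ d)"
      unfolding K_def
    proof (rule DERIV_nonpos_imp_decreasing_open[of a b "\<lambda>s. - (\<xi> s + c4 / s ^ d)"])
      fix x assume x: "a < x" "x < b"
      then have xS: "x \<in> {0<..R}" using a b by auto
      have "at x within {0<..R} = at x"
        by (rule at_within_open_subset[of x "{0<..<R}"]) (use x a b in auto)
      then show "\<exists>y. ((\<lambda>s. - (\<xi> s + c4 / s ^ d)) has_real_derivative y) (at x) \<and> y \<le> 0"
        using DERIV_minus[OF der[OF xS]] \<xi>1[of x] x a by (intro exI[of _ "- (\<xi>1 x - c / x ^ (d + 1))"]) auto
    next
      have "continuous_on {0<..R} (\<lambda>s. \<xi> s + c4 / s ^ d)"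
        using der by (rule DERIV_continuous_on)
      then show "continuous_on {a..b} (\<lambda>s. - (\<xi> s + c4 / s ^ d))"
        using a b by (intro continuous_on_minus) (auto elim: continuous_on_subset)
    qed (use a in auto)
    then show ?thesis by simp
  qed (simp add: K_def)
  \<comment> \<open>Up to \<open>a1\<close>, half of \<open>c4 / y ^ d\<close> is at least |K| + 1,
    so \<xi> is at most minus the other half; a1 \<le> 1 lets powers of y be compared.\<close>
  define a1 where "a1 = min b (min 1 (c4 / (2 * (\<bar>K\<bar> + 1))))"
  have a1: "0 < a1" "a1 \<le> b" "a1 \<le> 1" "a1 \<le> c4 / (2 * (\<bar>K\<bar> + 1))"
    using b c4 by (auto simp: a1_def add_nonneg_pos)
  define k where "k = (c4 / 2)\<^sup>2"
  have k: "0 < k" using c4 by (simp add: k_def)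
  have low: "k / y \<le> ?J y" if y: "0 < y" "y \<le> a1" for y
  proof -
    have "y ^ d \<le> y ^ 1" using y a1 d by (intro power_decreasing) auto
    also have "\<dots> \<le> c4 / (2 * (\<bar>K\<bar> + 1))" using y a1 by simp
    finally have "y ^ d * (2 * (\<bar>K\<bar> + 1)) \<le> c4"
      by (simp add: pos_le_divide_eq)
    then have "\<bar>K\<bar> + 1 \<le> c4 / 2 / y ^ d" using y by (simp add: field_simps)
    moreover have "\<xi> y + c4 / y ^ d \<le> K" using mono y a1 by simp
    moreover have "c4 / y ^ d = c4 / 2 / y ^ d + c4 / 2 / y ^ d" by simp
    ultimately have "c4 / 2 / y ^ d \<le> - \<xi> y" by linarith
    then have "(c4 / 2 / y ^ d)\<^sup>2 \<le> (- \<xi> y)\<^sup>2" using c4 y by (intro power_mono) auto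
    then have "y ^ (d + 1) * (k / (y ^ d)\<^sup>2) \<le> ?J y"
      using y by (intro mult_left_mono) (auto simp: k_def power_divide)
    moreover have "y ^ (d + 1) * (k / (y ^ d)\<^sup>2) = k / y ^ (d - 1)"
    proof -
      obtain m where m: "d = Suc m" using d by (cases d) auto
      show ?thesis using y unfolding m by (simp add: power2_eq_square field_simps)
    qed
    \<comment> \<open>Here d \<ge> 2 enters: y^(d+1) y^(-2d) = y^(1-d) is at least 1/y for y \<le>
      1, and 1/y is not integrable at 0.\<close>
    moreover have "k / y \<le> k / y ^ (d - 1)"
    proof (rule divide_left_mono)
      have "y ^ (d - 1) \<le> y ^ 1" using y a1 d by (intro power_decreasing) auto
      then show "y ^ (d - 1) \<le> y" by simp
    qed (use k y in auto)
    ultimately show ?thesis by linarith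
  qed
  define N where "N = integral {0..R} ?J"
  \<comment> \<open>Chosen so that the integral of k / y over \<open>[a, a1]\<close> is |N| + 1,
    more than the whole integral \<open>N\<close>.\<close>
  define a where "a = a1 * exp (- ((\<bar>N\<bar> + 1) / k))"
  have a: "0 < a" "a \<le> a1" using a1 k by (auto simp: a_def mult_le_cancel_left1)
  have i: "((\<lambda>y. k / y) has_integral k * ln a1 - k * ln a) {a..a1}"
  proof (rule fundamental_theorem_of_calculus[OF a(2)])
    fix y assume "y \<in> {a..a1}"
    then show "((\<lambda>y. k * ln y) has_vector_derivative k / y) (at y within {a..a1})"
      unfolding has_real_derivative_iff_has_vector_derivative[symmetric]
      using a by (auto intro!: derivative_eq_intros)
  qed
  have Ja: "?J integrable_on {a..a1}"
    by (rule integrable_on_subinterval[OF J]) (use a a1 b in auto)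
  have "k * ln a1 - k * ln a \<le> integral {a..a1} ?J"
    by (rule has_integral_le[OF i integrable_integral[OF Ja]]) (use low a in auto)
  also have "\<dots> \<le> N"
    unfolding N_def by (rule integral_subset_le) (use a a1 b Ja J in auto)
  also have "k * ln a1 - k * ln a = \<bar>N\<bar> + 1"
  proof -
    have "ln a = ln a1 - (\<bar>N\<bar> + 1) / k" using a1 by (simp add: a_def ln_mult)
    then show ?thesis using k by (simp add: right_diff_distrib)
  qed
  finally show False by linarith
qed

text \<open>If |w b| exceeded the oscillation bound by c > 0, then w would keep its sign and stay at
  distance c from 0 on (0, b]. With p \<le> 4 this gives |\<xi>1| \<ge> c / (4 y^(d+1)), the growth
  just excluded. So w vanishes at the centre, with a rate.\<close>

lemma flux_square_bound:
  fixes w \<xi> \<xi>1 q p :: "real \<Rightarrow> real"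
  assumes d: "2 \<le> d" and M: "0 \<le> M" and b: "b \<in> {0<..R}"
    and \<xi>: "\<And>y. y \<in> {0<..R} \<Longrightarrow> (\<xi> has_real_derivative \<xi>1 y) (at y within {0<..R})"
    and w: "\<And>y. y \<in> {0<..R} \<Longrightarrow> (w has_real_derivative q y * \<xi> y) (at y within {0<..R})"
    and w_def: "\<And>y. y \<in> {0<..R} \<Longrightarrow> w y = p y * y ^ (d + 1) * \<xi>1 y"
    and p: "\<And>y. y \<in> {0<..R} \<Longrightarrow> 0 < p y" "\<And>y. y \<in> {0<..R} \<Longrightarrow> p y \<le> 4"
    and q: "\<And>y. y \<in> {0<..R} \<Longrightarrow> \<bar>q y\<bar> \<le> M * y ^ (d + 1)"
    and J: "(\<lambda>y. y ^ (d + 1) * (\<xi> y)\<^sup>2) integrable_on {0..R}"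
    and N: "integral {0..R} (\<lambda>y. y ^ (d + 1) * (\<xi> y)\<^sup>2) < N"
  shows "\<bar>w b\<bar> \<le> M * sqrt (N * b ^ (d + 2))"
proof (rule ccontr)
  let ?e = "M * sqrt (N * b ^ (d + 2))"
  assume "\<not> \<bar>w b\<bar> \<le> ?e"
  then have big: "?e < \<bar>w b\<bar>" by simp
  define c where "c = \<bar>w b\<bar> - ?e"
  have c: "0 < c" using big by (simp add: c_def)
  define \<sigma> where "\<sigma> = sgn (w b)"
  have wb: "w b \<noteq> 0" using big M N Henstock_Kurzweil_Integration.integral_nonneg[OF J] b
    by (fastforce simp: mult_less_0_iff)
  have \<sigma>: "\<sigma> * w b = \<bar>w b\<bar>" "\<bar>\<sigma>\<bar> = 1" "\<sigma>\<^sup>2 = 1"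
    using wb by (auto simp: \<sigma>_def sgn_if)
  have near: "c \<le> \<sigma> * w a" if a: "a \<in> {0<..b}" for a
  proof -
    have "\<bar>w b - w a\<bar> \<le> ?e"
      using a b by (intro flux_increment_bound[OF _ _ _ M w q J N]) auto
    then have "\<bar>\<sigma> * (w b - w a)\<bar> \<le> ?e" by (simp add: abs_mult \<sigma>)
    then show ?thesis using \<sigma>(1) by (simp add: c_def right_diff_distrib)
  qed
  show False
  proof (rule flux_not_bounded_below[OF d, of b R "c / 4" "\<lambda>y. \<sigma> * \<xi> y" "\<lambda>y. \<sigma> * \<xi>1 y"])
    show "((\<lambda>y. \<sigma> * \<xi> y) has_real_derivative \<sigma> * \<xi>1 y) (at y within {0<..R})" if "y \<in> {0<..R}" for y
      by (rule DERIV_cmult[OF \<xi>[OF that]])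
    show "(\<lambda>y. y ^ (d + 1) * (\<sigma> * \<xi> y)\<^sup>2) integrable_on {0..R}"
      using J by (simp add: power_mult_distrib \<sigma>)
    show "c / 4 / y ^ (d + 1) \<le> \<sigma> * \<xi>1 y" if y: "y \<in> {0<..b}" for y
    proof -
      have yR: "y \<in> {0<..R}" and y0: "0 < y" using y b by auto
      have *: "c \<le> p y * (y ^ (d + 1) * (\<sigma> * \<xi>1 y))"
        using near[OF y] w_def[OF yR] by (simp add: mult_ac)
      then have "0 < p y * (y ^ (d + 1) * (\<sigma> * \<xi>1 y))" using c by linarith
      then have "0 < y ^ (d + 1) * (\<sigma> * \<xi>1 y)" using p(1)[OF yR] zero_less_mult_pos by blast
      then have "p y * (y ^ (d + 1) * (\<sigma> * \<xi>1 y)) \<le> 4 * (y ^ (d + 1) * (\<sigma> * \<xi>1 y))"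
        using p(2)[OF yR] by (intro mult_right_mono) auto
      then have "c / 4 \<le> (\<sigma> * \<xi>1 y) * y ^ (d + 1)" using * by (simp add: mult_ac)
      then show ?thesis using y0 by (simp only: pos_divide_le_eq zero_less_power)
    qed
  qed (use b c in auto)
qed

section \<open>From the eigenvalue equation to an energy identity\<close>

lemma at_within_half_open:
  fixes y R :: real
  assumes "y \<in> {0<..R}"
  shows "at y within {0<..R} = at y within {y / 2..R}"
  by (rule at_within_nhd[where S = "{y / 2<..}"]) (use assms in auto)

text \<open>Uniqueness of a derivative within a set is taken from closed intervals;
  \<open>[y/2, R]\<close> agrees with (0, R] near y, also for y = R.\<close>

lemma vector_derivative_half_open:
  fixes f :: "real \<Rightarrow> real"
  assumes "(f has_real_derivative f') (at y within {0<..R})" "y \<in> {0<..R}"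
  shows "vector_derivative f (at y within {0<..R}) = f'"
  using assms vector_derivative_within_cbox[of "y / 2" R y f f']
  by (simp add: has_real_derivative_iff_has_vector_derivative at_within_half_open)

lemma integral_energy_identity:
  fixes w \<xi> \<xi>1 q :: "real \<Rightarrow> real"
  assumes a: "0 < a" "a \<le> R"
    and \<xi>: "\<And>y. y \<in> {0<..R} \<Longrightarrow> (\<xi> has_real_derivative \<xi>1 y) (at y within {0<..R})"
    and w: "\<And>y. y \<in> {0<..R} \<Longrightarrow> (w has_real_derivative q y * \<xi> y) (at y within {0<..R})"
  shows "((\<lambda>y. q y * (\<xi> y)\<^sup>2 + w y * \<xi>1 y) has_integral w R * \<xi> R - w a * \<xi> a) {a..R}"
proof (rule fundamental_theorem_of_calculus[OF a(2)])
  fix y assume "y \<in> {a..R}"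
  then have y: "y \<in> {0<..R}" using a by auto
  have "((\<lambda>y. w y * \<xi> y) has_real_derivative q y * (\<xi> y)\<^sup>2 + w y * \<xi>1 y) (at y within {0<..R})"
    using DERIV_mult[OF w[OF y] \<xi>[OF y]] by (simp add: power2_eq_square algebra_simps)
  then show "((\<lambda>y. w y * \<xi> y) has_vector_derivative q y * (\<xi> y)\<^sup>2 + w y * \<xi>1 y) (at y within {a..R})"
    unfolding has_real_derivative_iff_has_vector_derivative[symmetric]
    by (rule has_field_derivative_subset) (use a in auto)
qed

text \<open>The equation is multiplied by \<xi> and integrated over \<open>[a, R]\<close>. The
  boundary condition and \<open>truncated_energy_bound\<close> take care of all terms except
  \<open>lam\<^sup>2\<close> times a weighted square of \<xi> on one side and -\<gamma> w(a)
  \<xi>(a) on the other, and the latter is O(a).\<close>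

lemma no_growing_mode_ode:
  fixes \<xi> \<xi>1 \<rho> D w :: "real \<Rightarrow> real"
  assumes d: "2 \<le> d" and R: "0 < R" and \<gamma>: "1 \<le> \<gamma>" "\<gamma> \<le> 2" and \<kappa>: "0 \<le> \<kappa>" and C: "0 \<le> C"
    and small: "\<kappa> * C * R\<^sup>2 \<le> 1" and lam: "0 < lam"
    and \<rho>: "\<And>y. y \<in> {0..R} \<Longrightarrow> 1 \<le> \<rho> y" "\<And>y. y \<in> {0..R} \<Longrightarrow> \<rho> y \<le> 2" "continuous_on {0..R} \<rho>" "\<rho> R = 1"
    and D: "continuous_on {0<..R} D" "\<And>y. y \<in> {0<..R} \<Longrightarrow> 0 \<le> D y" "\<And>y. y \<in> {0<..R} \<Longrightarrow> D y \<le> C * y"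
    and \<xi>: "\<And>y. y \<in> {0<..R} \<Longrightarrow> (\<xi> has_real_derivative \<xi>1 y) (at y within {0<..R})"
    and c\<xi>1: "continuous_on {0<..R} \<xi>1"
    and w_def: "\<And>y. y \<in> {0<..R} \<Longrightarrow> w y = \<rho> y powr \<gamma> * y ^ (d + 1) * \<xi>1 y"
    and w: "\<And>y. y \<in> {0<..R} \<Longrightarrow> (w has_real_derivative
        (lam\<^sup>2 * y ^ (d + 1) * \<rho> y - \<kappa> * y ^ d * D y) / \<gamma> * \<xi> y) (at y within {0<..R})"
    and bc: "real d * \<xi> R + R * \<xi>1 R = 0"
    and J: "(\<lambda>y. y ^ (d + 1) * (\<xi> y)\<^sup>2) integrable_on {0..R}"
    and y0: "y0 \<in> {0<..R}"
  shows "\<xi> y0 = 0"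
proof -
  let ?J = "\<lambda>y. y ^ (d + 1) * (\<xi> y)\<^sup>2"
  let ?q = "\<lambda>y. (lam\<^sup>2 * y ^ (d + 1) * \<rho> y - \<kappa> * y ^ d * D y) / \<gamma>"
  \<comment> \<open>\<open>M\<close> bounds |q| / y^(d+1), from \<rho> \<le> 2, D y \<le> C y and
    \<gamma> \<ge> 1.\<close>
  define M where "M = 2 * lam\<^sup>2 + \<kappa> * C"
  have M: "0 \<le> M" using \<kappa> C by (simp add: M_def)
  define N where "N = integral {0..R} ?J + 1"
  have N: "integral {0..R} ?J < N" by (simp add: N_def)
  have N0: "0 < N" using N Henstock_Kurzweil_Integration.integral_nonneg[OF J] by fastforce
  have p: "1 \<le> \<rho> y powr \<gamma>" "\<rho> y powr \<gamma> \<le> 4" if y: "y \<in> {0<..R}" for y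
  proof -
    have r: "1 \<le> \<rho> y" "\<rho> y \<le> 2" using \<rho>(1,2)[of y] y by auto
    show "1 \<le> \<rho> y powr \<gamma>" using r \<gamma> by (intro ge_one_powr_ge_zero) auto
    have "\<rho> y powr \<gamma> \<le> \<rho> y powr 2" using r \<gamma> by (intro powr_mono) auto
    also have "\<dots> = (\<rho> y)\<^sup>2" using r by simp
    also have "\<dots> \<le> 2\<^sup>2" using r by (intro power_mono) auto
    finally show "\<rho> y powr \<gamma> \<le> 4" by simp
  qed
  have q: "\<bar>?q y\<bar> \<le> M * y ^ (d + 1)" if y: "y \<in> {0<..R}" for y
  proof -
    have 1: "0 \<le> lam\<^sup>2 * y ^ (d + 1) * \<rho> y" "lam\<^sup>2 * y ^ (d + 1) * \<rho> y \<le> lam\<^sup>2 * y ^ (d + 1) * 2"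
      using y \<rho>(1)[of y] \<rho>(2)[of y] by (auto intro!: mult_left_mono mult_nonneg_nonneg)
    have 2: "0 \<le> \<kappa> * y ^ d * D y" "\<kappa> * y ^ d * D y \<le> \<kappa> * y ^ d * (C * y)"
      using y D(2)[OF y] D(3)[OF y] \<kappa> by (auto intro!: mult_left_mono mult_nonneg_nonneg)
    have "lam\<^sup>2 * y ^ (d + 1) * 2 + \<kappa> * y ^ d * (C * y) = M * y ^ (d + 1)"
      by (simp add: M_def algebra_simps)
    then have *: "\<bar>lam\<^sup>2 * y ^ (d + 1) * \<rho> y - \<kappa> * y ^ d * D y\<bar> \<le> M * y ^ (d + 1)"
      using 1 2 by linarith
    have "\<bar>?q y\<bar> = \<bar>lam\<^sup>2 * y ^ (d + 1) * \<rho> y - \<kappa> * y ^ d * D y\<bar> / \<gamma>" using \<gamma> by simp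
    also have "\<dots> \<le> \<bar>lam\<^sup>2 * y ^ (d + 1) * \<rho> y - \<kappa> * y ^ d * D y\<bar> / 1"
      using \<gamma> by (intro divide_left_mono) auto
    finally show ?thesis using * by simp
  qed
  define E where "E = M\<^sup>2 * N"
  have E0: "0 \<le> E" using N0 by (simp add: E_def)
  have w2: "(w y)\<^sup>2 \<le> E * y ^ (d + 2)" if y: "y \<in> {0<..R}" for y
  proof -
    have "\<bar>w y\<bar> \<le> M * sqrt (N * y ^ (d + 2))"
      by (rule flux_square_bound[OF d M y \<xi> w w_def _ p(2) q J N]) (use p(1) in force)+
    then have "\<bar>w y\<bar>\<^sup>2 \<le> (M * sqrt (N * y ^ (d + 2)))\<^sup>2" by (intro power_mono) auto
    also have "\<dots> = E * y ^ (d + 2)"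
      using N0 y by (simp add: power_mult_distrib E_def)
    finally show ?thesis by simp
  qed
  have sub: "{a..R} \<subseteq> {0<..R}" if "0 < a" for a using that by auto
  have c\<xi>: "continuous_on {0<..R} \<xi>" using \<xi> by (rule DERIV_continuous_on)
  \<comment> \<open>As \<rho>^\<gamma> \<ge> 1, the energy density is at most w^2 / s^(d+1) \<le> E
    s, so the energy stays bounded up to the centre.\<close>
  have P: "s ^ (d + 1) * (\<xi>1 s)\<^sup>2 \<le> E * R" if s: "s \<in> {0<..R}" for s
  proof -
    have "1\<^sup>2 \<le> (\<rho> s powr \<gamma>)\<^sup>2" using p(1)[OF s] by (intro power_mono) auto
    then have "1 * (s ^ (d + 1) * (s ^ (d + 1) * (\<xi>1 s)\<^sup>2)) \<le> (\<rho> s powr \<gamma>)\<^sup>2 * (s ^ (d + 1) * (s ^ (d + 1) * (\<xi>1 s)\<^sup>2))"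
      using s by (intro mult_right_mono) auto
    also have "\<dots> = (w s)\<^sup>2" unfolding w_def[OF s] by (simp add: power2_eq_square algebra_simps)
    also have "\<dots> \<le> E * s ^ (d + 2)" by (rule w2[OF s])
    also have "\<dots> = s ^ (d + 1) * (E * s)" by simp
    finally have "s ^ (d + 1) * (\<xi>1 s)\<^sup>2 \<le> E * s" using s by simp
    also have "\<dots> \<le> E * R" using s E0 by (intro mult_left_mono) auto
    finally show ?thesis .
  qed
  have Pi: "(\<lambda>s. s ^ (d + 1) * (\<xi>1 s)\<^sup>2) integrable_on {a..R}" if a: "0 < a" for a
    by (intro integrable_continuous_real continuous_intros continuous_on_subset[OF c\<xi>1 sub[OF a]])
  have Gi: "\<xi>1 integrable_on {a..R}" if a: "0 < a" for a
    by (intro integrable_continuous_real continuous_on_subset[OF c\<xi>1 sub[OF a]])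
  have inc: "\<xi> R - \<xi> y = integral {y..R} \<xi>1" if y: "y \<in> {0<..R}" for y
  proof (rule integral_unique[symmetric], rule fundamental_theorem_of_calculus)
    fix s assume "s \<in> {y..R}"
    then show "(\<xi> has_vector_derivative \<xi>1 s) (at s within {y..R})"
      unfolding has_real_derivative_iff_has_vector_derivative[symmetric]
      using y by (intro has_field_derivative_subset[OF \<xi>]) auto
  qed (use y in auto)
  \<comment> \<open>The decay w^2 \<le> E y^(d+2) beats \<xi>^2 = O(y^(-d)) from
    \<open>Hardy_pointwise\<close> and leaves the multiple \<open>F2\<close> of y^2.\<close>
  define F2 where "F2 = E * (2 * (\<xi> R)\<^sup>2 * R ^ d + 2 * E * R\<^sup>2 / real d)"
  have F0: "0 \<le> F2" using E0 R by (simp add: F2_def)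
  have f: "\<bar>w y * \<xi> y\<bar> \<le> sqrt F2 * y" if y: "y \<in> {0<..R}" for y
  proof -
    have "integral {y..R} (\<lambda>s. s ^ (d + 1) * (\<xi>1 s)\<^sup>2) \<le> integral {y..R} (\<lambda>s. E * R)"
      using y by (intro integral_le Pi P) auto
    also have "\<dots> = (R - y) * (E * R)" using y by simp
    also have "\<dots> \<le> R * (E * R)" using y E0 R by (intro mult_right_mono) auto
    finally have A: "integral {y..R} (\<lambda>s. s ^ (d + 1) * (\<xi>1 s)\<^sup>2) \<le> E * R\<^sup>2" by (simp add: power2_eq_square mult_ac)
    have "(\<xi> y)\<^sup>2 \<le> 2 * (\<xi> R)\<^sup>2 + 2 / (real d * y ^ d) * integral {y..R} (\<lambda>s. s ^ (d + 1) * (\<xi>1 s)\<^sup>2)"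
      using y d by (intro Hardy_pointwise Gi Pi inc) auto
    also have "\<dots> \<le> 2 * (\<xi> R)\<^sup>2 + 2 / (real d * y ^ d) * (E * R\<^sup>2)"
      using A y by (intro add_left_mono mult_left_mono) auto
    finally have x2: "(\<xi> y)\<^sup>2 \<le> 2 * (\<xi> R)\<^sup>2 + 2 / (real d * y ^ d) * (E * R\<^sup>2)" .
    have "(w y * \<xi> y)\<^sup>2 \<le> (E * y ^ (d + 2)) * (2 * (\<xi> R)\<^sup>2 + 2 / (real d * y ^ d) * (E * R\<^sup>2))"
      unfolding power_mult_distrib using w2[OF y] x2 E0 y by (intro mult_mono) auto
    also have "\<dots> = E * (2 * (\<xi> R)\<^sup>2 * y ^ d + 2 * E * R\<^sup>2 / real d * (y ^ d / y ^ d)) * y\<^sup>2"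
      by (simp add: power_add power2_eq_square algebra_simps)
    also have "\<dots> = E * (2 * (\<xi> R)\<^sup>2 * y ^ d + 2 * E * R\<^sup>2 / real d) * y\<^sup>2" using y by simp
    also have "\<dots> \<le> E * (2 * (\<xi> R)\<^sup>2 * R ^ d + 2 * E * R\<^sup>2 / real d) * y\<^sup>2"
      using y E0 by (intro mult_right_mono mult_left_mono add_right_mono power_mono) auto
    also have "\<dots> = (sqrt F2 * y)\<^sup>2" using F0 by (simp add: F2_def power_mult_distrib)
    finally have "\<bar>w y * \<xi> y\<bar>\<^sup>2 \<le> (sqrt F2 * y)\<^sup>2" by simp
    then show ?thesis by (rule power2_le_imp_le) (use F0 y in auto)
  qed
  have key: "lam\<^sup>2 * integral {a..R} ?J \<le> \<gamma> * sqrt F2 * a" if a: "0 < a" "a \<le> R" for a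
  proof -
    have s: "{a..R} \<subseteq> {0..R}" using a by auto
    note cs = continuous_on_subset[OF c\<xi> sub[OF a(1)]] continuous_on_subset[OF c\<xi>1 sub[OF a(1)]]
      continuous_on_subset[OF D(1) sub[OF a(1)]] continuous_on_subset[OF \<rho>(3) s]
    have "\<forall>y\<in>{a..R}. \<rho> y \<noteq> 0"
    proof
      fix y assume "y \<in> {a..R}"
      then show "\<rho> y \<noteq> 0" using \<rho>(1)[of y] a by auto
    qed
    then have cp: "continuous_on {a..R} (\<lambda>y. \<rho> y powr \<gamma>)"
      by (intro continuous_intros cs)
    let ?B = "\<lambda>y. \<kappa> * y ^ d * (\<xi> y)\<^sup>2 * D y"
    let ?A = "\<lambda>y. \<gamma> * \<rho> y powr \<gamma> * y ^ (d + 1) * (\<xi>1 y)\<^sup>2"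
    let ?L = "\<lambda>y. lam\<^sup>2 * (y ^ (d + 1) * \<rho> y * (\<xi> y)\<^sup>2)"
    have A: "?A integrable_on {a..R}" and B: "?B integrable_on {a..R}" and L: "?L integrable_on {a..R}"
      and Ja: "?J integrable_on {a..R}"
      by (intro integrable_continuous_real continuous_intros cs cp)+
    have "((\<lambda>y. \<gamma> * (?q y * (\<xi> y)\<^sup>2 + w y * \<xi>1 y)) has_integral \<gamma> * (w R * \<xi> R - w a * \<xi> a)) {a..R}"
      by (intro has_integral_mult_right integral_energy_identity a \<xi> w)
    moreover have "((\<lambda>y. ?L y - ?B y + ?A y) has_integral (integral {a..R} ?L - integral {a..R} ?B + integral {a..R} ?A)) {a..R}"
      by (intro has_integral_add has_integral_diff integrable_integral A B L)
    then have "((\<lambda>y. \<gamma> * (?q y * (\<xi> y)\<^sup>2 + w y * \<xi>1 y)) has_integral (integral {a..R} ?L - integral {a..R} ?B + integral {a..R} ?A)) {a..R}"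
    proof (rule has_integral_eq[rotated])
      fix y assume "y \<in> {a..R}"
      then have y: "y \<in> {0<..R}" using a by auto
      have "\<gamma> * (?q y * (\<xi> y)\<^sup>2) = (lam\<^sup>2 * y ^ (d + 1) * \<rho> y - \<kappa> * y ^ d * D y) * (\<xi> y)\<^sup>2"
        using \<gamma> by simp
      moreover have "w y * \<xi>1 y = \<rho> y powr \<gamma> * y ^ (d + 1) * (\<xi>1 y)\<^sup>2"
        unfolding w_def[OF y] by (simp add: power2_eq_square)
      ultimately show "?L y - ?B y + ?A y = \<gamma> * (?q y * (\<xi> y)\<^sup>2 + w y * \<xi>1 y)"
        by (simp add: algebra_simps)
    qed
    ultimately have id: "\<gamma> * (w R * \<xi> R - w a * \<xi> a) = integral {a..R} ?L - integral {a..R} ?B + integral {a..R} ?A"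
      by (rule has_integral_unique)
    \<comment> \<open>At R, the value \<rho> = 1 and the boundary condition turn \<gamma> times the
      flux term into exactly minus the boundary term of the form.\<close>
    have "w R * \<xi> R = R ^ d * (R * \<xi>1 R) * \<xi> R"
      using w_def[of R] R \<rho>(4) by (simp add: mult_ac)
    also have "R * \<xi>1 R = - real d * \<xi> R" using bc by simp
    finally have wR: "w R * \<xi> R = - real d * R ^ d * (\<xi> R)\<^sup>2" by (simp add: power2_eq_square)
    have "integral {a..R} ?B \<le> integral {a..R} ?A + real d * \<gamma> * R ^ d * (\<xi> R)\<^sup>2"
      by (rule truncated_energy_bound[where C = C])
        (use d a \<gamma> \<kappa> small \<rho> D cs Gi Pi A inc in auto)
    moreover have "\<gamma> * (w R * \<xi> R) = - (real d * \<gamma> * R ^ d * (\<xi> R)\<^sup>2)" unfolding wR by simp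
    ultimately have L_le: "integral {a..R} ?L \<le> - (\<gamma> * (w a * \<xi> a))"
      using id by (simp add: right_diff_distrib)
    have "lam\<^sup>2 * integral {a..R} ?J = integral {a..R} (\<lambda>y. lam\<^sup>2 * ?J y)" by simp
    also have "\<dots> \<le> integral {a..R} ?L"
    proof (rule integral_le[OF _ L])
      show "(\<lambda>y. lam\<^sup>2 * ?J y) integrable_on {a..R}" by (intro integrable_on_mult_right Ja)
      fix y assume y: "y \<in> {a..R}"
      then have "1 * ?J y \<le> \<rho> y * ?J y" using a \<rho>(1)[of y] by (intro mult_right_mono) auto
      from mult_left_mono[OF this, of "lam\<^sup>2"]
      show "lam\<^sup>2 * ?J y \<le> ?L y" by (simp add: mult_ac)
    qed
    also have "\<dots> \<le> - (\<gamma> * (w a * \<xi> a))" by (rule L_le)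
    also have "\<dots> \<le> \<gamma> * \<bar>w a * \<xi> a\<bar>"
      using \<gamma> mult_left_mono[of "- (w a * \<xi> a)" "\<bar>w a * \<xi> a\<bar>" \<gamma>] by simp
    also have "\<dots> \<le> \<gamma> * (sqrt F2 * a)"
      using \<gamma> f[of a] a by (intro mult_left_mono) auto
    finally show ?thesis by (simp add: mult.assoc)
  qed
  \<comment> \<open>Half of \<open>y0\<close> gives a nondegenerate interval containing
    \<open>y0\<close> even when y0 = R; \<open>b\<close> stays fixed while \<open>a\<close> tends to
    0.\<close>
  define b where "b = y0 / 2"
  have b: "0 < b" "b < R" "y0 \<in> {b..R}" using y0 by (auto simp: b_def)
  have cJ: "continuous_on {b..R} ?J"
    by (intro continuous_intros continuous_on_subset[OF c\<xi> sub[OF b(1)]])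
  have Jp: "0 \<le> ?J y" if "y \<in> {b..R}" for y using that b by simp
  have "lam\<^sup>2 * integral {b..R} ?J \<le> 0"
  proof (rule tendsto_lowerbound)
    show "((\<lambda>a. \<gamma> * sqrt F2 * a) \<longlongrightarrow> 0) (at_right 0)"
      by (auto intro!: tendsto_eq_intros)
    have "lam\<^sup>2 * integral {b..R} ?J \<le> \<gamma> * sqrt F2 * a" if a: "0 < a" "a < b" for a
    proof -
      have Ja: "?J integrable_on {a..R}"
        by (rule integrable_on_subinterval[OF J]) (use a in auto)
      have "integral {b..R} ?J \<le> integral {a..R} ?J"
        by (intro integral_subset_le integrable_continuous_real cJ Ja) (use a in auto)
      then have "lam\<^sup>2 * integral {b..R} ?J \<le> lam\<^sup>2 * integral {a..R} ?J" by (rule mult_left_mono) simp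
      also have "\<dots> \<le> \<gamma> * sqrt F2 * a" using a b by (intro key) auto
      finally show ?thesis .
    qed
    then show "\<forall>\<^sub>F a in at_right 0. lam\<^sup>2 * integral {b..R} ?J \<le> \<gamma> * sqrt F2 * a"
      using b(1) by (auto simp: eventually_at_right_field)
  qed simp
  then have "integral {b..R} ?J \<le> 0" using lam by (simp add: mult_le_0_iff)
  moreover have "0 \<le> integral {b..R} ?J"
    using Jp by (intro Henstock_Kurzweil_Integration.integral_nonneg integrable_continuous_real cJ)
  ultimately have "integral {b..R} ?J = 0" by simp
  then have "?J y0 = 0" using integral_eq_0_iff[OF cJ b(2) Jp] b(3) by blast
  then show ?thesis using y0 by simp
qed

text \<open>The flux w = \<rho>^\<gamma> y^(d+1) \<xi>1 converts the second-order equation in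
  \<open>Lop\<close> into a formula for w' as a multiple of \<xi>.\<close>

lemma no_growing_mode:
  assumes n: "CARD('n::finite) = d + 2" and d: "2 \<le> d" and R: "0 < R" and \<gamma>: "1 \<le> \<gamma>" "\<gamma> \<le> 2" 
    and \<kappa>: "0 \<le> 2 * (real d - 1) - real d * \<gamma>" and C: "0 \<le> C"
    and small: "(2 * (real d - 1) - real d * \<gamma>) * C * R\<^sup>2 \<le> 1"
    and \<rho>: "\<And>y. y \<in> {0..R} \<Longrightarrow> 1 \<le> \<rho>b y" "\<And>y. y \<in> {0..R} \<Longrightarrow> \<rho>b y \<le> 2" "continuous_on {0..R} \<rho>b" "\<rho>b R = 1"
    and D: "continuous_on {0<..R} D" "\<And>y. y \<in> {0<..R} \<Longrightarrow> 0 \<le> D y" "\<And>y. y \<in> {0<..R} \<Longrightarrow> D y \<le> C * y"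
    and D\<rho>: "\<And>y. y \<in> {0<..R} \<Longrightarrow> ((\<lambda>s. \<rho>b s powr \<gamma>) has_real_derivative - D y) (at y within {0..R})"
  shows "\<not> growing_mode TYPE('n) d \<gamma> \<rho>b R lam \<xi>"
proof
  assume gm: "growing_mode TYPE('n) d \<gamma> \<rho>b R lam \<xi>"
  define \<kappa> where "\<kappa> = 2 * (real d - 1) - real d * \<gamma>"
  let ?S = "{0<..R}"
  have lam: "0 < lam" and H: "H1r TYPE('n) R \<xi>"
    and C2: "C2_on_left_closed R \<xi>"
    and ode: "\<And>y. y \<in> ?S \<Longrightarrow> Lop d \<gamma> \<rho>b R \<xi> y = - lam\<^sup>2 * y ^ (d + 1) * \<rho>b y * \<xi> y"
    and bc: "real d * \<xi> R + R * vector_derivative \<xi> (at R within ?S) = 0"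
    using gm by (auto simp: growing_mode_def)
  obtain y0 where y0: "y0 \<in> ?S" "\<xi> y0 \<noteq> 0" using gm by (auto simp: growing_mode_def)
  obtain \<xi>1 \<xi>2 where \<xi>: "\<And>y. y \<in> ?S \<Longrightarrow> (\<xi> has_real_derivative \<xi>1 y) (at y within ?S)"
    and \<xi>1: "\<And>y. y \<in> ?S \<Longrightarrow> (\<xi>1 has_real_derivative \<xi>2 y) (at y within ?S)"
    using C2 unfolding C2_on_left_closed_def by blast
  have v\<xi>: "vector_derivative \<xi> (at y within ?S) = \<xi>1 y" if "y \<in> ?S" for y
    by (rule vector_derivative_half_open[OF \<xi>[OF that] that])
  have p: "((\<lambda>s. \<rho>b s powr \<gamma>) has_real_derivative - D y) (at y within ?S)" if "y \<in> ?S" for y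
    by (rule has_field_derivative_subset[OF D\<rho>[OF that]]) auto
  define w where "w y = \<rho>b y powr \<gamma> * y ^ (d + 1) * \<xi>1 y" for y
  have w: "(w has_real_derivative (lam\<^sup>2 * y ^ (d + 1) * \<rho>b y - \<kappa> * y ^ d * D y) / \<gamma> * \<xi> y) (at y within ?S)"
    if y: "y \<in> ?S" for y
  proof -
    \<comment> \<open>Only the existence of w' comes from the product rule; its value is then read
      off from the equation.\<close>
    obtain w' where w': "(w has_real_derivative w') (at y within ?S)"
      unfolding w_def [abs_def] using DERIV_mult[OF DERIV_mult[OF p[OF y] DERIV_pow] \<xi>1[OF y]] by blast
    have "((\<lambda>s. \<rho>b s powr \<gamma> * s ^ (d + 1) * vector_derivative \<xi> (at s within ?S)) has_real_derivative w') (at y within ?S)"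
      by (rule has_field_derivative_transform_within[OF w' zero_less_one y]) (simp add: w_def v\<xi>)
    then have "vector_derivative (\<lambda>s. \<rho>b s powr \<gamma> * s ^ (d + 1) * vector_derivative \<xi> (at s within ?S)) (at y within ?S) = w'"
      by (rule vector_derivative_half_open[OF _ y])
    moreover have "vector_derivative (\<lambda>s. \<rho>b s powr \<gamma>) (at y within ?S) = - D y"
      by (rule vector_derivative_half_open[OF p[OF y] y])
    ultimately have "- \<gamma> * w' + \<kappa> * y ^ d * (- D y) * \<xi> y = - lam\<^sup>2 * y ^ (d + 1) * \<rho>b y * \<xi> y"
      using ode[OF y] by (simp add: Lop_def \<kappa>_def)
    then have "\<gamma> * w' = (lam\<^sup>2 * y ^ (d + 1) * \<rho>b y - \<kappa> * y ^ d * D y) * \<xi> y"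
      by (simp add: algebra_simps)
    then have "w' = (lam\<^sup>2 * y ^ (d + 1) * \<rho>b y - \<kappa> * y ^ d * D y) / \<gamma> * \<xi> y"
      using \<gamma> by (simp add: field_simps)
    then show ?thesis using w' by simp
  qed
  have "(\<lambda>r. r ^ (CARD('n) - 1) * (\<xi> r)\<^sup>2) integrable_on {0..R}"
    using H1r_square_integrable[OF H] by (rule set_lebesgue_integral_eq_integral(1))
  then have J: "(\<lambda>r. r ^ (d + 1) * (\<xi> r)\<^sup>2) integrable_on {0..R}" by (simp add: n)
  have "\<xi> y0 = 0"
  proof (rule no_growing_mode_ode[where C = C and \<kappa> = \<kappa> and d = d and R = R and \<gamma> = \<gamma>
        and lam = lam and \<rho> = \<rho>b and D = D and \<xi> = \<xi> and ?\<xi>1.0 = \<xi>1 and w = w and ?y0.0 = y0])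
    show "continuous_on ?S \<xi>1" using \<xi>1 by (rule DERIV_continuous_on)
    show "real d * \<xi> R + R * \<xi>1 R = 0" using bc v\<xi>[of R] R by simp
    show "0 \<le> \<kappa>" "\<kappa> * C * R\<^sup>2 \<le> 1" using \<kappa> small by (simp_all add: \<kappa>_def)
    show "w y = \<rho>b y powr \<gamma> * y ^ (d + 1) * \<xi>1 y" for y by (rule w_def)
  qed (fact d R \<gamma> C lam \<rho> D \<xi> w J y0)+
  then show False using y0 by simp
qed

section \<open>Choice of the density threshold\<close>

theorem theorem1p1:
  fixes d :: nat and \<gamma> :: real
  assumes "3 \<le> d" and "1 \<le> \<gamma>" and "\<gamma> < 2" and "\<gamma> < 2 * (real d - 1) / real d"
    and "CARD('n::finite) = d + 2"
  shows "\<exists>\<epsilon>>0. \<forall>\<rho>0 \<rho>b R. liquid_star d \<gamma> \<rho>0 \<rho>b R \<and> \<rho>0 < 1 + \<epsilon> \<longrightarrow>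
           linearly_stable TYPE('n) d \<gamma> \<rho>b R \<and>
           (\<forall>\<xi>. H1r TYPE('n) R \<xi> \<longrightarrow> 0 \<le> Qform d \<gamma> \<rho>b R \<xi>)"
proof -
  let ?\<kappa> = "2 * (real d - 1) - real d * \<gamma>"
  let ?C = "16 * pi / real d"
  \<comment> \<open>With \<kappa> \<le> 2 d, C = 16 pi / d and (2 pi / d) R^2 \<le> \<rho>0^2 - 1
    \<le> 3 \<epsilon>, the product \<kappa> C R^2 is at most 2 d * 8 * 3 \<epsilon> = 48 d
    \<epsilon>, which this choice makes 1. As \<epsilon> \<le> 1, also \<rho>0 \<le> 2.\<close>
  define \<epsilon> where "\<epsilon> = 1 / (48 * real d)"
  have d: "0 < d" "2 \<le> d" "0 < real d" using assms by auto
  have \<epsilon>: "0 < \<epsilon>" "\<epsilon> \<le> 1" using d assms(1) by (simp_all add: \<epsilon>_def)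
  \<comment> \<open>\<kappa> is the coefficient of the term containing the nonpositive derivative of
    \<rho>^\<gamma>; for \<kappa> \<ge> 0 this term is the negative part of the form.\<close>
  have \<kappa>: "0 \<le> ?\<kappa>" using assms(4) d by (simp add: pos_less_divide_eq mult.commute)
  have \<kappa>': "?\<kappa> \<le> 2 * real d" proof -
    have "0 \<le> real d * \<gamma>" using assms(2) by simp
    moreover have "2 * (x - 1) - t \<le> 2 * x" if "0 \<le> t" for x t :: real using that by simp
    ultimately show ?thesis by blast
  qed
  show ?thesis
  proof (intro exI[of _ \<epsilon>] conjI allI impI \<epsilon>(1))
    fix \<rho>0 \<rho>b R assume "liquid_star d \<gamma> \<rho>0 \<rho>b R \<and> \<rho>0 < 1 + \<epsilon>"
    then have star: "liquid_star d \<gamma> \<rho>0 \<rho>b R" and \<rho>0: "\<rho>0 < 1 + \<epsilon>" by auto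
    have \<rho>01: "1 < \<rho>0" using star by (simp add: liquid_star_def)
    have "\<gamma> \<le> 2" and "\<rho>0 \<le> 2" using assms(3) \<rho>0 \<epsilon> by auto
    obtain D where R: "0 < R" and
      \<rho>b: "\<rho>b R = 1" "\<And>y. y \<in> {0..R} \<Longrightarrow> 1 \<le> \<rho>b y" "\<And>y. y \<in> {0..R} \<Longrightarrow> \<rho>b y \<le> 2"
        "continuous_on {0..R} \<rho>b" and
      D: "continuous_on {0<..R} D"
        "\<And>y. y \<in> {0<..R} \<Longrightarrow> ((\<lambda>s. \<rho>b s powr \<gamma>) has_real_derivative - D y) (at y within {0..R})"
        "\<And>y. y \<in> {0<..R} \<Longrightarrow> 0 \<le> D y" "\<And>y. y \<in> {0<..R} \<Longrightarrow> D y \<le> ?C * y" and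
      R2: "2 * pi / real d * R\<^sup>2 \<le> \<rho>0\<^sup>2 - 1"
      by (rule liquid_star_bounds[OF star d(1) assms(2) \<open>\<gamma> \<le> 2\<close> \<open>\<rho>0 \<le> 2\<close>]) (rule that; simp)
    have "\<rho>0\<^sup>2 - 1 = (\<rho>0 - 1) * (\<rho>0 + 1)" by (simp add: power2_eq_square algebra_simps)
    also have "\<dots> \<le> \<epsilon> * 3" using \<rho>0 \<rho>01 \<epsilon> by (intro mult_mono) auto
    finally have R2': "2 * pi / real d * R\<^sup>2 \<le> 3 * \<epsilon>" using R2 by simp
    have small: "?\<kappa> * ?C * R\<^sup>2 \<le> 1"
    proof -
      have "?\<kappa> * ?C * R\<^sup>2 = ?\<kappa> * (8 * (2 * pi / real d * R\<^sup>2))" by simp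
      also have "\<dots> \<le> 2 * real d * (8 * (3 * \<epsilon>))"
        by (rule mult_mono[OF \<kappa>' mult_left_mono[OF R2', of 8]]) auto
      also have "\<dots> = 1" using d by (simp add: \<epsilon>_def)
      finally show ?thesis .
    qed
    have C: "0 \<le> ?C" by simp
    show "linearly_stable TYPE('n) d \<gamma> \<rho>b R"
      unfolding linearly_stable_def
      using no_growing_mode[OF assms(5) d(2) R assms(2) \<open>\<gamma> \<le> 2\<close> \<kappa> C small \<rho>b(2-4) \<rho>b(1) D(1,3,4,2)]
      by blast
    show "0 \<le> Qform d \<gamma> \<rho>b R \<xi>" if "H1r TYPE('n) R \<xi>" for \<xi>
      by (rule Qform_nonneg[OF that R d(1) assms(2) \<kappa> small \<rho>b(2,4) D(1,4,2)])
  qed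
qed

end
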